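(* Let $N\ge1$, $s\in(0,1)$, let $\Omega\subset\mathbb{R}^N$ be an open set, let $c\in L^\infty(\Omega)$, and let $u\in H^s_0(\Omega)\cap C(\mathbb{R}^N)$ satisfy, in the weak sense, $$(-\Delta)^s u\ge c(x)u\ \text{ in }\Omega,\qquad u=0\ \text{ in }\mathbb{R}^N\setminus\Omega.$$ Let $x_0\in\partial\Omega$, and suppose that $\Omega$ satisfies an interior ball condition at $x_0$, i.e. there is a ball $B_R(y_0)\subset\Omega$ with $x_0\in\partial B_R(y_0)$. Suppose that there exists a ball $B_\delta(x_0)$ of radius $\delta>0$ centered at $x_0$ such that $u\ge0$ in $B_\delta(x_0)$. Let $U$ be the Caffarelli-Silvestre extension of $u$. If $$\liminf_{t\to0^+}\frac{U(x_0,t)-U(x_0,0)}{t^{2s}}>0,$$ then $u$ satisfies Hopf's Lemma at $x_0$, that is, for every $\beta\in\left(0,\frac{\pi}{2}\right)$, $$\liminf_{\substack{x\to x_0\\ x\in C_\beta(x_0)}}\frac{u(x)}{|x-x_0|^s}>0.$$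
   Context: $H^s(\mathbb{R}^N)$ is the space of $u\in L^2(\mathbb{R}^N)$ with finite Gagliardo seminorm $[u]_{H^s(\mathbb{R}^N)}=\left(\int_{\mathbb{R}^N}\int_{\mathbb{R}^N}\frac{|u(x)-u(y)|^2}{|x-y|^{N+2s}}\,dx\,dy\right)^{1/2}$. $H^s_0(\Omega)$ is the closure of $C^\infty_c(\Omega)$ with respect to the Gagliardo seminorm (functions extended by $0$ outside $\Omega$). The weak sense of "$(-\Delta)^su\ge c(x)u$ in $\Omega$, $u=0$ in $\mathbb{R}^N\setminus\Omega$" is: $u\in H^s(\mathbb{R}^N)$, $u\in H^s_0(\Omega)$, and $$\int_{\mathbb{R}^N}\int_{\mathbb{R}^N}\frac{(u(x)-u(y))(\varphi(x)-\varphi(y))}{|x-y|^{N+2s}}\,dx\,dy\ge\int_\Omega c(x)u(x)\varphi(x)\,dx$$ for every $\varphi\in H^s_0(\Omega)$ with $\varphi\ge0$ in $\Omega$ (no normalizing constant in front of the double integral). Since $u$ is continuous, $u=0$ in $\mathbb{R}^N\setminus\Omega$ holds pointwise. With $B_R(y_0)$ the interior ball at $x_0$, for $\beta\in\left(0,\frac{\pi}{2}\right)$, $$C_\beta(x_0):=\left\{x\in\Omega\,\Big|\,\arccos\left(\frac{x-x_0}{|x-x_0|}\cdot\frac{y_0-x_0}{|y_0-x_0|}\right)<\beta\right\}.$$ The Caffarelli-Silvestre extension of $u\in H^s(\mathbb{R}^N)$ is the solution $U$ on $\mathbb{R}^{N+1}_+=\mathbb{R}^N\times\mathbb{R}^+$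 of $\operatorname{div}(t^{1-2s}\nabla U)=0$ in $\mathbb{R}^{N+1}_+$, $U(x,0)=u(x)$ in $\mathbb{R}^N$; it is given for $t>0$ by $$U(x,t)=P_{N,s}\int_{\mathbb{R}^N}\frac{u(y)\,t^{2s}}{(|x-y|^2+t^2)^{\frac{N+2s}{2}}}\,dy,\qquad P_{N,s}=\pi^{-\frac N2}\frac{\Gamma\left(\frac{N+2s}{2}\right)}{\Gamma(s)}.$$ *)

theory Defs
  imports "HOL-Analysis.Analysis"
begin

text \<open>The ambient space is an arbitrary Euclidean space, with dimension $N$ = \<open>DIM('a)\<close>.\<close>

primrec Ck :: "nat \<Rightarrow> ('a::euclidean_space \<Rightarrow> real) \<Rightarrow> bool" where
  "Ck 0 f \<longleftrightarrow> continuous_on UNIV f"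
| "Ck (Suc k) f \<longleftrightarrow>
     f differentiable_on UNIV \<and> (\<forall>v. Ck k (\<lambda>x. frechet_derivative f (at x) v))"

definition Cc_infinity :: "'a::euclidean_space set \<Rightarrow> ('a \<Rightarrow> real) set" where
  "Cc_infinity \<Omega> =
     {f. (\<forall>k. Ck k f) \<and> compact (closure {x. f x \<noteq> 0}) \<and> closure {x. f x \<noteq> 0} \<subseteq> \<Omega>}"

text \<open>The double integrals are integrals against Lebesgue measure on the product space. On the
  diagonal the integrands take the value 0, since division by 0 yields 0.\<close>

definition gagliardo_integrand ::
    "real \<Rightarrow> ('a::euclidean_space \<Rightarrow> real) \<Rightarrow> ('a \<Rightarrow> real) \<Rightarrow> 'a \<times> 'a \<Rightarrow> real" where
  "gagliardo_integrand s u v =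
     (\<lambda>(x, y). ((u x - u y) * (v x - v y)) / norm (x - y) powr (real DIM('a) + 2 * s))"

definition gagliardo_form ::
    "real \<Rightarrow> ('a::euclidean_space \<Rightarrow> real) \<Rightarrow> ('a \<Rightarrow> real) \<Rightarrow> real" where
  "gagliardo_form s u v = integral\<^sup>L lebesgue (gagliardo_integrand s u v)"

text \<open>This Bochner integral is 0 when the seminorm is infinite, so finiteness is required
  separately in \<open>Hs\<close>; the seminorm is only used for differences of members of \<open>Hs\<close>.\<close>

definition gagliardo_seminorm :: "real \<Rightarrow> ('a::euclidean_space \<Rightarrow> real) \<Rightarrow> real" where
  "gagliardo_seminorm s u = sqrt (gagliardo_form s u u)"

definition Hs :: "real \<Rightarrow> ('a::euclidean_space \<Rightarrow> real) set" where
  "Hs s = {u. u \<in> borel_measurable lebesgue \<and> integrable lebesgue (\<lambda>x. (u x)\<^sup>2) \<and>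
              integrable lebesgue (gagliardo_integrand s u u)}"

text \<open>The closure is taken inside \<open>Hs\<close>. That the functions are extended by 0 has to be demanded
  explicitly: for $N = 1$ and $s \ge 1/2$ the seminorm closure alone may contain functions that
  equal a nonzero constant on the complement of \<open>\<Omega>\<close>.\<close>

definition Hs0 :: "real \<Rightarrow> 'a::euclidean_space set \<Rightarrow> ('a \<Rightarrow> real) set" where
  "Hs0 s \<Omega> = {u \<in> Hs s. (AE x in lebesgue. x \<notin> \<Omega> \<longrightarrow> u x = 0) \<and>
     (\<forall>\<epsilon>>0. \<exists>\<phi> \<in> Cc_infinity \<Omega>. gagliardo_seminorm s (\<lambda>x. u x - \<phi> x) < \<epsilon>)}"

definition L_infinity :: "'a::euclidean_space set \<Rightarrow> ('a \<Rightarrow> real) set" where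
  "L_infinity \<Omega> = {c. c \<in> borel_measurable (lebesgue_on \<Omega>) \<and>
                       (\<exists>M. AE x in lebesgue_on \<Omega>. \<bar>c x\<bar> \<le> M)}"

text \<open>Weak sense of $(-\Delta)^s u \ge c u$ in \<open>\<Omega>\<close>, $u = 0$ outside \<open>\<Omega>\<close>. The exterior condition
  is pointwise, since the definition is applied to continuous functions.\<close>

definition weak_supersolution ::
    "real \<Rightarrow> 'a::euclidean_space set \<Rightarrow> ('a \<Rightarrow> real) \<Rightarrow> ('a \<Rightarrow> real) \<Rightarrow> bool" where
  "weak_supersolution s \<Omega> c u \<longleftrightarrow>
     u \<in> Hs s \<and> u \<in> Hs0 s \<Omega> \<and> (\<forall>x. x \<notin> \<Omega> \<longrightarrow> u x = 0) \<and>
     (\<forall>\<phi> \<in> Hs0 s \<Omega>. (AE x in lebesgue. x \<in> \<Omega> \<longrightarrow> 0 \<le> \<phi> x) \<longrightarrow>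
        gagliardo_form s u \<phi> \<ge> (LINT x:\<Omega>|lebesgue. c x * u x * \<phi> x))"

definition inner_cone ::
    "'a::euclidean_space set \<Rightarrow> 'a \<Rightarrow> 'a \<Rightarrow> real \<Rightarrow> 'a set" where
  "inner_cone \<Omega> x0 y0 \<beta> =
     {x \<in> \<Omega>. arccos (((x - x0) /\<^sub>R norm (x - x0)) \<bullet> ((y0 - x0) /\<^sub>R norm (y0 - x0))) < \<beta>}"

text \<open>The Caffarelli-Silvestre extension, given by its Poisson formula for $t > 0$ and by the
  boundary value at $t = 0$; the value for $t < 0$ is irrelevant.\<close>

definition cs_extension ::
    "real \<Rightarrow> ('a::euclidean_space \<Rightarrow> real) \<Rightarrow> 'a \<Rightarrow> real \<Rightarrow> real" where
  "cs_extension s u x t =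
     (if t > 0 then
        pi powr (- (real DIM('a) / 2)) * (Gamma ((real DIM('a) + 2 * s) / 2) / Gamma s) *
        (LINT y|lebesgue. u y * t powr (2 * s) /
           ((norm (x - y))\<^sup>2 + t\<^sup>2) powr ((real DIM('a) + 2 * s) / 2))
      else u x)"

end

theory Submission
  imports Defs "HOL-Real_Asymp.Real_Asymp"
begin

text \<open>
The proof has two halves: the extension provides a source, and a barrier turns the source into growth.

Since \<open>u x0 = 0\<close>, the difference quotient of the extension at \<open>x0\<close> is a multiple of the integral of
\<open>u y / ((norm (y - x0))\<^sup>2 + t\<^sup>2) powr ((N + 2 * s) / 2)\<close>. If its lower limit is positive, then for some small \<open>\<rho>\<close> the
integral of \<open>u y / norm (y - x0) powr (N + 2 * s)\<close> over \<open>norm (y - x0) \<ge> \<rho>\<close> is positive (\<open>far_mass_positive\<close>). Let \<open>w\<close> be the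
truncation of \<open>u\<close> to the ball of radius \<open>\<rho>\<close> around \<open>x0\<close>; it is nonnegative everywhere. Write \<open>(-\<Delta>)\<^sup>s f x\<close> for the integral of
the second difference \<open>2 * f x - f (x + h) - f (x - h)\<close> against \<open>norm h powr (- (N + 2 * s))\<close>. Cutting off the far part of \<open>u\<close>
adds to \<open>(-\<Delta>)\<^sup>s u\<close> near \<open>x0\<close> a source of about twice that positive mass, while \<open>c * u\<close> is small there. So, near \<open>x0\<close>,
\<open>(-\<Delta>)\<^sup>s w \<ge> \<kappa>\<close> weakly with some \<open>\<kappa> > 0\<close>. Tested with translates of a smooth bump, this becomes a pointwise
inequality for the mollification \<open>v\<close> of \<open>w\<close> (\<open>supersolution_near_boundary\<close>).

The barrier is \<open>W x = (max 0 (r\<^sup>2 - (norm (x - x1))\<^sup>2)) powr s\<close> on a ball inside the given one that touches \<open>x0\<close>. If \<open>v - m * W\<close> had a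
negative minimum, then \<open>(-\<Delta>)\<^sup>s v\<close> would be at most \<open>m * (-\<Delta>)\<^sup>s W\<close> there, which is impossible for small \<open>m\<close> once
\<open>(-\<Delta>)\<^sup>s W\<close> is bounded above (\<open>comparison_with_barrier\<close>). Letting the bump shrink gives \<open>u \<ge> m * W\<close>, and in a cone with
vertex \<open>x0\<close> and axis through the center, \<open>W\<close> grows like \<open>norm (x - x0) powr s\<close> (\<open>cone_in_tangent_ball\<close>).

The bound for \<open>(-\<Delta>)\<^sup>s W\<close> (\<open>fractional_laplacian_barrier_bounded\<close>) is the quantitative core, and it depends on the exponent of \<open>W\<close>
being exactly \<open>s\<close>. On every line through a point of the ball, \<open>W\<close> is the \<open>s\<close>-th power of a concave quadratic polynomial.
Seen from the point, in units of the distance to the nearer root, it differs from a multiple of the one-sided power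
\<open>(max 0 (1 + l)) powr s\<close> by an error with uniformly bounded integral (\<open>nn_integral_line_difference_le\<close>); and the one-sided
power is \<open>s\<close>-harmonic (\<open>integral_half_line_nonpos\<close>). The bound in the ball follows by integrating over all lines.
\<close>

section \<open>Powers on the half-line\<close>

lemma has_bochner_integral_powr_from_0:
  fixes a c :: real
  assumes "-1 < a" "0 \<le> c"
  shows "has_bochner_integral lborel (\<lambda>x. x powr a * indicator {0..c} x) (c powr (a + 1) / (a + 1))"
proof (rule has_bochner_integral_nn_integral)
  have "(\<integral>\<^sup>+ x. ennreal (x powr a) * indicator {0..c} x \<partial>lborel) = ennreal (c powr (a+1) / (a+1))"
    by (rule nn_integral_has_integral_lebesgue') (use has_integral_powr_from_0[OF assms] in auto)
  then show "(\<integral>\<^sup>+ x. ennreal (x powr a * indicator {0..c} x) \<partial>lborel) = ennreal (c powr (a+1) / (a+1))"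
    by (simp add: ennreal_mult' ennreal_indicator)
qed (use assms in auto)

lemma has_bochner_integral_powr_to_inf:
  fixes e c :: real
  assumes "e < -1" "0 < c"
  shows "has_bochner_integral lborel (\<lambda>x. x powr e * indicator {c..} x) (c powr (e + 1) / - (e + 1))"
proof (rule has_bochner_integral_nn_integral)
  have eq: "- (c powr (e + 1)) / (e + 1) = c powr (e + 1) / - (e + 1)"
    by (simp only: minus_divide_left[symmetric] minus_divide_right)
  have "(\<integral>\<^sup>+ x. ennreal (x powr e) * indicator {c..} x \<partial>lborel) = ennreal (c powr (e+1) / - (e+1))"
    by (rule nn_integral_has_integral_lebesgue') (use has_integral_powr_to_inf[OF assms, unfolded eq] in simp_all)
  then show "(\<integral>\<^sup>+ x. ennreal (x powr e * indicator {c..} x) \<partial>lborel) = ennreal (c powr (e+1) / - (e+1))"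
    by (simp add: ennreal_mult' ennreal_indicator)
  show "0 \<le> c powr (e + 1) / - (e + 1)"
    using assms by (intro divide_nonneg_nonneg) auto
qed (use assms in auto)

lemma powr_le_tangent:
  fixes x s :: real
  assumes "0 \<le> x" "0 \<le> s" "s \<le> 1"
  shows "x powr s \<le> s * x + (1 - s)"
proof (cases "x = 0")
  case False
  then show ?thesis
    using Youngs_inequality_0[of s "1-s" x 1] assms by simp
qed (use assms in auto)

lemma powr_ge_self:
  fixes t s :: real
  assumes "0 \<le> t" "t \<le> 1" "s \<le> 1"
  shows "t \<le> t powr s"
proof (cases "t = 0")
  case False
  then have "t powr 1 \<le> t powr s"
    using assms by (intro powr_mono') auto
  then show ?thesis using assms by simp
qed auto

text \<open>Convexity of the error: the lower bound is concavity of the power function, the upper bound is the arithmetic-geometric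
mean inequality together with \<open>(1 + m) powr s * (1 - m) powr s = (1 - m\<^sup>2) powr s \<ge> 1 - m\<^sup>2\<close>.\<close>

lemma second_difference_powr_bounds:
  fixes m s :: real
  assumes "0 < s" "s < 1" "0 \<le> m" "m \<le> 1"
  shows "0 \<le> 2 - (1 + m) powr s - (1 - m) powr s"
    and "2 - (1 + m) powr s - (1 - m) powr s \<le> 2 * m\<^sup>2"
proof -
  have "(1 + m) powr s \<le> s * (1+m) + (1 - s)" "(1 - m) powr s \<le> s * (1-m) + (1 - s)"
    using assms by (intro powr_le_tangent; simp)+
  then show "0 \<le> 2 - (1 + m) powr s - (1 - m) powr s"
    by (simp add: algebra_simps)
  define X Y where "X = (1 + m) powr s" and "Y = (1 - m) powr s"
  have m2: "m\<^sup>2 \<le> 1"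
    using assms by (simp add: power_le_one)
  have "X * Y = (1 - m\<^sup>2) powr s"
    using assms unfolding X_def Y_def
    by (subst powr_mult[symmetric]) (auto simp: power2_eq_square algebra_simps)
  also have "\<dots> \<ge> 1 - m\<^sup>2"
    using assms m2 by (intro powr_ge_self) auto
  finally have "1 - m\<^sup>2 \<le> X * Y" .
  moreover have "4 * (X * Y) \<le> (X + Y)\<^sup>2"
    using zero_le_power2[of "X - Y"] by (simp add: power2_eq_square algebra_simps)
  moreover have "(1 - m\<^sup>2)\<^sup>2 \<le> 1 - m\<^sup>2"
    using m2 by (simp add: power2_eq_square mult_left_le)
  ultimately have "4 * (1 - m\<^sup>2)\<^sup>2 \<le> (X + Y)\<^sup>2"
    by linarith
  also have "4 * (1 - m\<^sup>2)\<^sup>2 = (2 * (1 - m\<^sup>2))\<^sup>2"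
    by (simp only: power_mult_distrib) simp
  finally have "2 * (1 - m\<^sup>2) \<le> X + Y"
    by (rule power2_le_imp_le) (simp add: X_def Y_def)
  then show "2 - (1 + m) powr s - (1 - m) powr s \<le> 2 * m\<^sup>2"
    by (simp add: X_def Y_def)
qed

text \<open>The second difference, with increment \<open>m\<close>, of the one-sided power \<open>t \<mapsto> (max 0 t) powr s\<close> at the point \<open>1\<close>.\<close>

definition half_line_difference :: "real \<Rightarrow> real \<Rightarrow> real" where
  "half_line_difference s m = 2 - (1 + m) powr s - (max 0 (1 - m)) powr s"

lemma half_line_difference_le: 
  assumes "0 < s" "s < 1" "0 \<le> m" "m \<le> 1"
  shows "\<bar>half_line_difference s m\<bar> \<le> 2 * m\<^sup>2"
  using second_difference_powr_bounds[OF assms] assms by (auto simp: half_line_difference_def)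

lemma double_powr_le:
  fixes m s :: real
  assumes "0 < s" "s < 1" "1 \<le> m"
  shows "(1 + m) powr s \<le> 2 * m powr s"
proof -
  have "(1 + m) powr s \<le> (2 * m) powr s" using assms by (intro powr_mono2) auto
  also have "\<dots> = 2 powr s * m powr s" using assms by (simp add: powr_mult)
  also have "\<dots> \<le> 2 * m powr s"
    using powr_mono[of s 1 2] assms by (intro mult_right_mono) auto
  finally show ?thesis .
qed

lemma half_line_difference_le_large: 
  assumes "0 < s" "s < 1" "1 \<le> m"
  shows "\<bar>half_line_difference s m\<bar> \<le> 4 * m powr s"
proof -
  have "(1 + m) powr s \<le> 2 * m powr s" using assms by (rule double_powr_le)
  moreover have "1 \<le> m powr s" using assms by (intro ge_one_powr_ge_zero) auto
  moreover have "half_line_difference s m = 2 - (1 + m) powr s"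
    using assms by (simp add: half_line_difference_def)
  ultimately show ?thesis using powr_ge_zero[of "1 + m" s] by linarith
qed

text \<open>Near \<open>0\<close> the integrand is of order \<open>m powr (1 - 2 * s)\<close>, at infinity of order \<open>m powr (- 1 - s)\<close>; both are
integrable because \<open>0 < s < 1\<close>.\<close>

lemma integrable_half_line:
  assumes "0 < s" "s < 1"
  shows "integrable lborel (\<lambda>m. half_line_difference s m * m powr (- 1 - 2 * s) * indicator {0<..} m)"
proof (rule Bochner_Integration.integrable_bound)
  show "integrable lborel (\<lambda>m. 2 * (m powr (1 - 2 * s) * indicator {0..1} m) + 4 * (m powr (- 1 - s) * indicator {1..} m))"
    using has_bochner_integral_powr_from_0[where a = "1 - 2 * s" and c = 1] has_bochner_integral_powr_to_inf[where e = "- 1 - s" and c = 1] assms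
    by (intro Bochner_Integration.integrable_add integrable_mult_right) (auto simp: has_bochner_integral_iff)
  show "(\<lambda>m. half_line_difference s m * m powr (- 1 - 2 * s) * indicator {0<..} m) \<in> borel_measurable lborel"
    unfolding half_line_difference_def by measurable
  have 1: "\<bar>half_line_difference s m\<bar> * m powr (- 1 - 2 * s) \<le> 2 * m powr (1 - 2 * s)" if "0 < m" "m \<le> 1" for m
  proof -
    have "\<bar>half_line_difference s m\<bar> * m powr (- 1 - 2 * s) \<le> 2 * m\<^sup>2 * m powr (- 1 - 2 * s)"
      using half_line_difference_le[OF assms, of m] that by (intro mult_right_mono) auto
    also have "\<dots> = 2 * (m powr 2 * m powr (- 1 - 2 * s))" using that by simp
    also have "\<dots> = 2 * m powr (1 - 2 * s)" by (subst powr_add[symmetric]) simp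
    finally show ?thesis .
  qed
  have 2: "\<bar>half_line_difference s m\<bar> * m powr (- 1 - 2 * s) \<le> 4 * m powr (-1 - s)" if "1 \<le> m" for m
  proof -
    have "\<bar>half_line_difference s m\<bar> * m powr (- 1 - 2 * s) \<le> 4 * m powr s * m powr (- 1 - 2 * s)"
      using half_line_difference_le_large[OF assms, of m] that by (intro mult_right_mono) auto
    also have "\<dots> = 4 * (m powr s * m powr (- 1 - 2 * s))" by simp
    also have "\<dots> = 4 * m powr (-1 - s)" by (subst powr_add[symmetric]) (simp add: algebra_simps)
    finally show ?thesis .
  qed
  show "AE m in lborel. norm (half_line_difference s m * m powr (- 1 - 2 * s) * indicator {0<..} m)
     \<le> norm (2 * (m powr (1 - 2 * s) * indicator {0..1} m) + 4 * (m powr (- 1 - s) * indicator {1..} m))"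
  proof (intro AE_I2)
    fix m :: real
    consider "m \<le> 0" | "0 < m" "m < 1" | "m = 1" | "1 < m" by linarith
    then show "norm (half_line_difference s m * m powr (- 1 - 2 * s) * indicator {0<..} m)
     \<le> norm (2 * (m powr (1 - 2 * s) * indicator {0..1} m) + 4 * (m powr (- 1 - s) * indicator {1..} m))"
      using 1[of m] 2[of m] by cases (auto simp: indicator_def abs_mult)
  qed
qed

text \<open>Functions whose positive part has no uniform bound are compared with an integrable majorant by moving negative parts to
the other side. In this form the estimate survives a further integration, where a difference of integrals would
require integrability of \<open>q\<close>.\<close>

lemma nn_integral_le_of_dominated_difference:
  fixes q Q :: "'a \<Rightarrow> real"
  assumes q[measurable]: "q \<in> borel_measurable M" and Q: "integrable M Q" and le: "\<And>x. x \<in> space M \<Longrightarrow> q x \<le> Q x"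
    and C: "integral\<^sup>L M Q \<le> C"
  shows "(\<integral>\<^sup>+x. ennreal (q x) \<partial>M) \<le> ennreal C + (\<integral>\<^sup>+x. ennreal (- q x) \<partial>M)"
proof -
  note [measurable] = borel_measurable_integrable[OF Q]
  define P N where "P = (\<integral>\<^sup>+x. ennreal (Q x) \<partial>M)" and "N = (\<integral>\<^sup>+x. ennreal (- Q x) \<partial>M)"
  have fin: "P \<noteq> \<infinity>" "N \<noteq> \<infinity>"
    using Q unfolding P_def N_def real_integrable_def by auto
  have "integral\<^sup>L M Q = enn2real P - enn2real N"
    unfolding P_def N_def by (rule real_lebesgue_integral_def[OF Q])
  then have "enn2real P \<le> C + enn2real N"
    using C by simp
  then have "ennreal (enn2real P) \<le> ennreal (C + enn2real N)"
    by (rule ennreal_leI)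
  also have "\<dots> \<le> ennreal C + ennreal (enn2real N)"
    by (cases "C \<ge> 0") (auto simp: ennreal_plus ennreal_neg intro!: ennreal_leI)
  finally have PN: "P \<le> ennreal C + N"
    using fin by (simp add: less_top)
  have "(\<integral>\<^sup>+x. ennreal (q x) \<partial>M) + N = (\<integral>\<^sup>+x. ennreal (q x) + ennreal (- Q x) \<partial>M)"
    unfolding N_def by (subst nn_integral_add) auto
  also have "\<dots> \<le> (\<integral>\<^sup>+x. ennreal (Q x) + ennreal (- q x) \<partial>M)"
  proof (intro nn_integral_mono)
    fix x assume "x \<in> space M"
    then have "q x \<le> Q x" by (rule le)
    then show "ennreal (q x) + ennreal (- Q x) \<le> ennreal (Q x) + ennreal (- q x)"
      by (cases "q x \<ge> 0"; cases "Q x \<ge> 0") (auto simp: ennreal_neg intro!: ennreal_leI)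
  qed
  also have "\<dots> = P + (\<integral>\<^sup>+x. ennreal (- q x) \<partial>M)"
    unfolding P_def by (subst nn_integral_add) auto
  also have "\<dots> \<le> (ennreal C + (\<integral>\<^sup>+x. ennreal (- q x) \<partial>M)) + N"
    using PN by (metis add.commute add.left_commute add_right_mono)
  finally show ?thesis
    using fin by (simp add: add.commute ennreal_add_left_cancel_le)
qed

lemma integral_le_of_nn_integral_le:
  fixes F q :: "'a \<Rightarrow> real"
  assumes q[measurable]: "q \<in> borel_measurable M" and F: "integrable M F" and le: "\<And>x. x \<in> space M \<Longrightarrow> F x \<le> q x"
    and fin: "(\<integral>\<^sup>+x. ennreal (- q x) \<partial>M) \<noteq> \<infinity>" and C0: "0 \<le> C"
    and C: "(\<integral>\<^sup>+x. ennreal (q x) \<partial>M) \<le> ennreal C + (\<integral>\<^sup>+x. ennreal (- q x) \<partial>M)"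
  shows "integral\<^sup>L M F \<le> C"
proof -
  have finp: "(\<integral>\<^sup>+x. ennreal (q x) \<partial>M) \<noteq> \<infinity>"
    using fin C by (auto simp: top_unique)
  have qi: "integrable M q"
    using fin finp by (auto simp: real_integrable_def)
  have "integral\<^sup>L M F \<le> integral\<^sup>L M q"
    by (intro integral_mono F qi le)
  also have "\<dots> = enn2real (\<integral>\<^sup>+x. ennreal (q x) \<partial>M) - enn2real (\<integral>\<^sup>+x. ennreal (- q x) \<partial>M)"
    by (rule real_lebesgue_integral_def[OF qi])
  also have "\<dots> \<le> C"
  proof -
    have "enn2real (\<integral>\<^sup>+x. ennreal (q x) \<partial>M) \<le> enn2real (ennreal C + (\<integral>\<^sup>+x. ennreal (- q x) \<partial>M))"
      using fin by (intro enn2real_mono C) (auto simp: less_top)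
    also have "\<dots> = C + enn2real (\<integral>\<^sup>+x. ennreal (- q x) \<partial>M)"
      using fin C0 by (subst enn2real_plus) (auto simp: less_top)
    finally show ?thesis by simp
  qed
  finally show ?thesis .
qed

text \<open>With the substitution \<open>m = n / (1 - n)\<close> in the part of the half-line integral that comes from \<open>(1 + m) powr s\<close>, both
parts live on the unit interval, and with \<open>A = (1 - n) powr s\<close> and \<open>B = (1 - n) powr (s - 1)\<close> the joint integrand is
\<open>(1 - A) * (1 - B) * n powr (- 1 - 2 * s)\<close>. This function is an antiderivative of its negative.\<close>

definition folded_primitive :: "real \<Rightarrow> real \<Rightarrow> real" where
  "folded_primitive s n = (1 - (1 - n) powr s)\<^sup>2 * n powr (- 2 * s) / (2 * s)"

lemma DERIV_folded_primitive:
  assumes "0 < s" "0 < n" "n < 1"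
  shows "DERIV (folded_primitive s) n :> 
     - ((1 - (1 - n) powr s) * n powr (- 1 - 2 * s)
         - ((1 + n / (1 - n)) powr s - 1) * (n / (1 - n)) powr (- 1 - 2 * s) * (1 / (1 - n)\<^sup>2))"
proof -
  define A B where "A = (1 - n) powr s" and "B = (1 - n) powr (s - 1)"
  have n1: "(1 - n) powr 1 = 1 - n" using assms by simp
  have AB: "A = B * (1 - n)"
    unfolding A_def B_def using assms n1 by (metis diff_add_cancel powr_add)
  have d: "DERIV (folded_primitive s) n :> (2 * (1 - A) * (s * B) * n powr (- 2 * s) + (1 - A)\<^sup>2 * (- 2 * s * n powr (- 1 - 2 * s))) / (2 * s)"
  proof -
    have "DERIV (\<lambda>n. (1 - n) powr s) n :> - (s * B)"
      unfolding B_def using assms by (auto intro!: derivative_eq_intros)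
    moreover have "DERIV (\<lambda>n. n powr (- 2 * s)) n :> - 2 * s * n powr (- 1 - 2 * s)"
    proof -
      have "- 2 * s - 1 = - 1 - 2 * s" by simp
      then show ?thesis using has_real_derivative_powr[of n "- 2 * s"] assms by metis
    qed
    moreover have "DERIV (\<lambda>n. (1 - f n)\<^sup>2 * g n / (2 * s)) n :> (2 * (1 - f n) * f' * g n + (1 - f n)\<^sup>2 * g') / (2 * s)"
      if "DERIV f n :> - f'" "DERIV g n :> g'" for f g f' g'
      using that assms by (auto intro!: derivative_eq_intros simp: field_simps)
    ultimately show ?thesis
      unfolding folded_primitive_def A_def by blast
  qed
  have nn: "n powr (- 2 * s) = n * n powr (- 1 - 2 * s)"
    using assms powr_add[of n 1 "- 1 - 2 * s"] by simp
  have e1: "(1 + n / (1 - n)) powr s = 1 / A"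
  proof -
    have "1 + n / (1 - n) = 1 / (1 - n)" using assms by (simp add: field_simps)
    then show ?thesis using assms by (simp add: A_def powr_divide)
  qed
  have e2: "(n / (1 - n)) powr (- 1 - 2 * s) * (1 / (1 - n)\<^sup>2) / n powr (- 1 - 2 * s) = A * B"
  proof -
    have "A * B = (1 - n) powr (2 * s - 1)"
      unfolding A_def B_def by (subst powr_add[symmetric]) (simp add: algebra_simps)
    also have "\<dots> = (1 - n) powr (2 * s + 1) * (1 - n) powr (- 2)"
      by (subst powr_add[symmetric]) simp
    also have "\<dots> = 1 / (1 - n) powr (- 1 - 2 * s) / (1 - n)\<^sup>2"
      using assms by (simp add: powr_minus_divide[symmetric] powr_minus_divide)
    finally show ?thesis
      using assms by (simp add: powr_divide)
  qed
  have "(2 * (1 - A) * (s * B) * n powr (- 2 * s) + (1 - A)\<^sup>2 * (- 2 * s * n powr (- 1 - 2 * s))) / (2 * s)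
     = - ((1 - A) - (1 / A - 1) * (A * B)) * n powr (- 1 - 2 * s)"
  proof -
    have "(2 * (1 - A) * (s * B) * n powr (- 2 * s) + (1 - A)\<^sup>2 * (- 2 * s * n powr (- 1 - 2 * s))) / (2 * s)
      = ((1 - A) * B * n - (1 - A)\<^sup>2) * n powr (- 1 - 2 * s)"
      unfolding nn using assms by (simp add: field_simps power2_eq_square)
    moreover have "(1 - A) * B * n - (1 - A)\<^sup>2 = - ((1 - A) - (1 - A) * B)"
      unfolding AB by (simp add: power2_eq_square algebra_simps)
    moreover have "(1 / A - 1) * (A * B) = (1 - A) * B"
      using assms by (simp add: A_def field_simps)
    ultimately show ?thesis by metis
  qed
  also have "\<dots> = - ((1 - A) * n powr (- 1 - 2 * s)
         - (1 / A - 1) * (n / (1 - n)) powr (- 1 - 2 * s) * (1 / (1 - n)\<^sup>2))"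
    using e2 assms by (simp add: field_simps)
  finally show ?thesis
    using d unfolding e1 A_def[symmetric] by simp
qed

text \<open>The substitution sends the cutoff \<open>e\<close> to \<open>e / (1 + e) < e\<close>. Since the folded integrand that is lost in between has
a sign, restricting it to \<open>[e, 1 - e]\<close> costs nothing in this direction, and there the fundamental theorem of calculus applies.\<close>

lemma half_line_tail_le:
  assumes s: "0 < s" "s < 1" and e: "0 < e" "e < 1/2"
  shows "(LINT m|lborel. half_line_difference s m * m powr (- 1 - 2 * s) * indicator {e..} m)
    \<le> folded_primitive s e - folded_primitive s (1 - e) + (1 - e) powr (- 2 * s) / (2 * s)"
proof -
  let ?w = "\<lambda>m::real. m powr (- 1 - 2 * s)"
  let ?g = "\<lambda>n::real. n / (1 - n)"
  let ?u = "\<lambda>m. ((1 + m) powr s - 1) * ?w m"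
  let ?v = "\<lambda>m. (1 - (max 0 (1 - m)) powr s) * ?w m"
  have w: "has_bochner_integral lborel (\<lambda>m. ?w m * indicator {c..} m) (c powr (- 2 * s) / (2 * s))" if "0 < c" for c
    using has_bochner_integral_powr_to_inf[where e = "- 1 - 2 * s" and c = c] that s by (simp add: algebra_simps)
  have K: "integrable lborel (\<lambda>m. half_line_difference s m * ?w m * indicator {e..} m)"
  proof (rule Bochner_Integration.integrable_bound[OF integrable_half_line[OF s]])
    show "(\<lambda>m. half_line_difference s m * ?w m * indicator {e..} m) \<in> borel_measurable lborel"
      unfolding half_line_difference_def by measurable
  qed (use e in \<open>auto simp: indicator_def\<close>)
  have v01: "0 \<le> 1 - (max 0 (1 - m)) powr s" "1 - (max 0 (1 - m)) powr s \<le> 1" if "e \<le> m" for m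
    using that e s powr_mono2[of s "max 0 (1 - m)" 1] by auto
  have V: "integrable lborel (\<lambda>m. ?v m * indicator {e..} m)"
  proof (rule Bochner_Integration.integrable_bound)
    show "integrable lborel (\<lambda>m. ?w m * indicator {e..} m)"
      using w[OF e(1)] by (simp add: has_bochner_integral_iff)
    show "AE m in lborel. norm (?v m * indicator {e..} m) \<le> norm (?w m * indicator {e..} m)"
      using v01 by (intro AE_I2) (auto simp: indicator_def abs_mult intro!: mult_left_le_one_le)
  qed measurable
  have kvu: "half_line_difference s m * ?w m * indicator {e..} m = ?v m * indicator {e..} m - ?u m * indicator {e..} m" for m
    by (simp add: half_line_difference_def algebra_simps)
  have U: "integrable lborel (\<lambda>m. ?u m * indicator {e..} m)"
  proof -
    have "(\<lambda>m. ?u m * indicator {e..} m) = (\<lambda>m. ?v m * indicator {e..} m - half_line_difference s m * ?w m * indicator {e..} m)"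
      using kvu by (simp add: fun_eq_iff)
    then show ?thesis using V K by simp
  qed
  \<comment> \<open>The upper cutoff keeps the folded integrand away from its singularity at \<open>1\<close>; tying it to \<open>e\<close> saves a second limit.\<close>
  define b where "b = 1 - e"
  have b: "e < b" "b < 1" "0 < b" using e by (auto simp: b_def)
  have gmono: "?g e \<le> ?g b"
    using e b by (simp add: field_simps)
  have ge: "e \<le> ?g e" using e by (simp add: field_simps)
  have dg: "DERIV ?g n :> 1 / (1 - n)\<^sup>2" if "n \<in> {e..b}" for n
    using that b e by (auto intro!: derivative_eq_intros simp: power2_eq_square field_simps)
  have cg: "continuous_on {e..b} (\<lambda>n. 1 / (1 - n)\<^sup>2)"
    using b by (auto intro!: continuous_intros)
  have Ug: "set_integrable lborel {?g e..?g b} ?u"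
    unfolding set_integrable_def
  proof (rule Bochner_Integration.integrable_bound[OF U])
    show "AE m in lborel. norm (indicator {?g e..?g b} m *\<^sub>R ?u m) \<le> norm (?u m * indicator {e..} m)"
      using ge by (auto simp: indicator_def)
  qed measurable
  note sub = integral_substitution[OF Ug dg cg _ less_imp_le[OF b(1)], simplified]
  have u0: "0 \<le> ?u m" if "0 < m" for m
    using that s by (auto intro!: mult_nonneg_nonneg ge_one_powr_ge_zero)
  have "(LINT n|lborel. ?u (?g n) * (1 / (1 - n)\<^sup>2) * indicator {e..b} n) = (LINT m|lborel. ?u m * indicator {?g e..?g b} m)"
    using sub(2) by simp
  also have "\<dots> \<le> (LINT m|lborel. ?u m * indicator {e..} m)"
  proof (rule integral_mono[OF _ U])
    show "integrable lborel (\<lambda>m. ?u m * indicator {?g e..?g b} m)"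
      using Ug by (simp add: set_integrable_def mult.commute)
    show "?u m * indicator {?g e..?g b} m \<le> ?u m * indicator {e..} m" for m
      using ge e u0[of m] by (auto simp: indicator_def)
  qed
  finally have ule: "(LINT n|lborel. ?u (?g n) * (1 / (1 - n)\<^sup>2) * indicator {e..b} n) \<le> (LINT m|lborel. ?u m * indicator {e..} m)" .
  have Us: "integrable lborel (\<lambda>n. ?u (?g n) * (1 / (1 - n)\<^sup>2) * indicator {e..b} n)"
    using sub(1) by (simp add: set_integrable_def mult.commute)
  have d: "DERIV (\<lambda>n. - folded_primitive s n) n :> ?v n - ?u (?g n) * (1 / (1 - n)\<^sup>2)" if "e \<le> n" "n \<le> b" for n
    using DERIV_minus[OF DERIV_folded_primitive[of s n]] that e b s by simp
  have ftc: "has_bochner_integral lborel (\<lambda>n. (?v n - ?u (?g n) * (1 / (1 - n)\<^sup>2)) * indicator {e..b} n)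
     ((- folded_primitive s b) - (- folded_primitive s e))"
  proof (rule has_bochner_integral_FTC_Icc_real[OF less_imp_le[OF b(1)] d])
    fix n assume n: "e \<le> n" "n \<le> b"
    have "0 < n" "n < 1" "0 < 1 + n / (1 - n)" using n b e by (auto intro!: add_pos_nonneg)
    then show "isCont (\<lambda>n. ?v n - ?u (?g n) * (1 / (1 - n)\<^sup>2)) n"
      using s by (intro continuous_intros) auto
  qed
  have "(LINT m|lborel. ?v m * indicator {e..} m) \<le> (LINT m|lborel. (?v m - ?u (?g m) * (1 / (1 - m)\<^sup>2)) * indicator {e..b} m + 
     ?u (?g m) * (1 / (1 - m)\<^sup>2) * indicator {e..b} m + ?w m * indicator {b..} m)"
  proof (rule integral_mono[OF V])
    show "integrable lborel (\<lambda>m. (?v m - ?u (?g m) * (1 / (1 - m)\<^sup>2)) * indicator {e..b} m + 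
     ?u (?g m) * (1 / (1 - m)\<^sup>2) * indicator {e..b} m + ?w m * indicator {b..} m)"
      using ftc Us w[OF b(3)] by (intro Bochner_Integration.integrable_add) (auto simp: has_bochner_integral_iff)
    fix m :: real
    have "?v m \<le> ?w m" if "b \<le> m" using v01[of m] that b by (intro mult_left_le_one_le) auto
    then show "?v m * indicator {e..} m \<le> (?v m - ?u (?g m) * (1 / (1 - m)\<^sup>2)) * indicator {e..b} m + 
     ?u (?g m) * (1 / (1 - m)\<^sup>2) * indicator {e..b} m + ?w m * indicator {b..} m"
      using b by (auto simp: indicator_def)
  qed
  also have "\<dots> = (folded_primitive s e - folded_primitive s b) + (LINT n|lborel. ?u (?g n) * (1 / (1 - n)\<^sup>2) * indicator {e..b} n)
     + b powr (- 2 * s) / (2 * s)"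
    using ftc Us w[OF b(3)] by (simp add: has_bochner_integral_iff)
  also have "\<dots> \<le> (folded_primitive s e - folded_primitive s b) + (LINT m|lborel. ?u m * indicator {e..} m)
     + b powr (- 2 * s) / (2 * s)"
    using ule by simp
  finally have "(LINT m|lborel. ?v m * indicator {e..} m) - (LINT m|lborel. ?u m * indicator {e..} m)
     \<le> folded_primitive s e - folded_primitive s b + b powr (- 2 * s) / (2 * s)" by simp
  then show ?thesis
    unfolding kvu b_def using U V by simp
qed

text \<open>The one-sided power \<open>t \<mapsto> (max 0 t) powr s\<close> is \<open>s\<close>-harmonic on the positive half-line, so this integral is in fact
zero. Only the inequality enters: as the cutoff tends to zero, \<open>folded_primitive s e\<close> vanishes because \<open>2 - 2 * s > 0\<close>,
and the remaining two terms cancel.\<close>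

lemma integral_half_line_nonpos:
  assumes s: "0 < s" "s < 1"
  shows "(LINT m|lborel. half_line_difference s m * m powr (- 1 - 2 * s) * indicator {0<..} m) \<le> 0"
proof -
  let ?K = "\<lambda>m. half_line_difference s m * m powr (- 1 - 2 * s)"
  let ?e = "\<lambda>n::nat. 1 / (real n + 3)"
  have 1: "(\<lambda>n. LINT m|lborel. ?K m * indicator {?e n..} m) \<longlonglongrightarrow> (LINT m|lborel. ?K m * indicator {0<..} m)"
  proof (rule integral_dominated_convergence[where w = "\<lambda>m. \<bar>?K m * indicator {0<..} m\<bar>"])
    show "AE m in lborel. (\<lambda>n. ?K m * indicator {?e n..} m) \<longlonglongrightarrow> ?K m * indicator {0<..} m"
    proof (intro AE_I2 tendsto_mult tendsto_const)
      fix m :: real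
      show "(\<lambda>n. indicator {?e n..} m :: real) \<longlonglongrightarrow> indicator {0<..} m"
      proof (cases "0 < m")
        case True
        have "?e \<longlonglongrightarrow> 0" by real_asymp
        then have "eventually (\<lambda>n. ?e n < m) sequentially"
          using True by (rule order_tendstoD)
        then have "eventually (\<lambda>n. indicator {?e n..} m = (indicator {0<..} m :: real)) sequentially"
          by eventually_elim (use True in auto)
        then show ?thesis by (rule tendsto_eventually)
      next
        case False
        then have "\<not> ?e n \<le> m" for n
          by (smt (verit) divide_pos_pos of_nat_0_le_iff)
        then show ?thesis using False by simp
      qed
    qed
    show "AE m in lborel. norm (?K m * indicator {?e n..} m) \<le> \<bar>?K m * indicator {0<..} m\<bar>" for n
    proof (intro AE_I2)
      fix m :: real
      have "0 < ?e n" by simp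
      then have "m \<in> {?e n..} \<Longrightarrow> m \<in> {0<..}"
        unfolding atLeast_iff greaterThan_iff by (rule less_le_trans)
      then show "norm (?K m * indicator {?e n..} m) \<le> \<bar>?K m * indicator {0<..} m\<bar>"
        by (cases "m \<in> {?e n..}") (simp_all del: atLeast_iff greaterThan_iff)
    qed
    show "integrable lborel (\<lambda>m. \<bar>?K m * indicator {0<..} m\<bar>)"
      using integrable_half_line[OF s] by (rule integrable_abs)
    show "(\<lambda>m. ?K m * indicator {?e n..} m) \<in> borel_measurable lborel" for n
      unfolding half_line_difference_def by measurable
    show "(\<lambda>m. ?K m * indicator {0<..} m) \<in> borel_measurable lborel"
      unfolding half_line_difference_def by measurable
  qed
  have 2: "(\<lambda>n. folded_primitive s (?e n) - folded_primitive s (1 - ?e n) + (1 - ?e n) powr (- 2 * s) / (2 * s))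
     \<longlonglongrightarrow> 0"
    unfolding folded_primitive_def using s by real_asymp
  show ?thesis
    by (rule LIMSEQ_le[OF 1 2]) (use half_line_tail_le[OF s] in \<open>auto intro!: exI[of _ 1]\<close>)
qed

section \<open>The barrier on a line\<close>

text \<open>The second difference at \<open>0\<close> of \<open>l \<mapsto> (max 0 ((a + l) * (b - l))) powr s\<close>, the profile of the barrier on a chord of the
ball. The point splits the chord into pieces of lengths \<open>a\<close> and \<open>b\<close>.\<close>

definition line_difference :: "real \<Rightarrow> real \<Rightarrow> real \<Rightarrow> real \<Rightarrow> real" where
  "line_difference s a b l = 2 * (a * b) powr s - (max 0 ((a + l) * (b - l))) powr s - (max 0 ((a - l) * (b + l))) powr s"

text \<open>After normalizing the shorter piece of the chord to length \<open>1\<close> the profile is \<open>(1 + l) powr s * (p - l) powr s\<close>. Freezing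
the second factor at \<open>l = 0\<close> gives the half-line difference; the remainder is a product of first differences plus a
second difference of \<open>(p - l) powr s\<close>, hence quadratic in \<open>m\<close>, uniformly in \<open>p\<close>.\<close>

lemma line_difference_le_near:
  assumes s: "0 < s" "s < 1" and m: "0 < m" "m \<le> 1" and p: "1 \<le> p"
  shows "line_difference s 1 p m \<le> p powr s * half_line_difference s m + 6 * m\<^sup>2"
proof -
  define t where "t = m / p"
  have t: "0 < t" "t \<le> 1" "m = t * p" "t \<le> m" using m p by (auto simp: t_def field_simps)
  let ?P = "(1 + m) powr s" and ?M = "(1 - m) powr s" and ?A = "(1 + t) powr s" and ?B = "(1 - t) powr s"
  have pt: "(p - m) powr s = p powr s * ?B" "(p + m) powr s = p powr s * ?A"
  proof -
    have "p - m = p * (1 - t)" "p + m = p * (1 + t)" using t(3) by (auto simp: algebra_simps)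
    then show "(p - m) powr s = p powr s * ?B" "(p + m) powr s = p powr s * ?A"
      using t p by (auto simp: powr_mult)
  qed
  have "line_difference s 1 p m = 2 * p powr s - ?P * (p - m) powr s - ?M * (p + m) powr s"
    using m p by (simp add: line_difference_def powr_mult max_def zero_le_mult_iff) 
  then have eq: "line_difference s 1 p m - p powr s * half_line_difference s m = 
      p powr s * (?P * (2 - ?A - ?B) + (?P - ?M) * (?A - 1))"
    using m by (simp only: half_line_difference_def pt) (simp add: algebra_simps)
  have "?P \<le> s * (1 + m) + (1 - s)" using m s by (intro powr_le_tangent) auto
  moreover have "s * m \<le> m" using m s by simp
  ultimately have P: "?P \<le> 1 + m" by (simp add: algebra_simps)
  have M: "1 - m \<le> ?M" using m s by (intro powr_ge_self) auto
  have "?A \<le> s * (1 + t) + (1 - s)" using t s by (intro powr_le_tangent) auto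
  moreover have "s * t \<le> t" using t s by simp
  ultimately have A: "?A - 1 \<le> t" by (simp add: algebra_simps)
  have A0: "0 \<le> ?A - 1" using t s by (simp add: ge_one_powr_ge_zero)
  have "?P * (2 - ?A - ?B) \<le> 2 * (2 * t\<^sup>2)"
    using P m second_difference_powr_bounds[OF s, of t] t by (intro mult_mono) auto
  moreover have "(?P - ?M) * (?A - 1) \<le> (2 * m) * t"
    using P M A A0 m by (intro mult_mono) auto
  ultimately have "?P * (2 - ?A - ?B) + (?P - ?M) * (?A - 1) \<le> 4 * t\<^sup>2 + 2 * m * t" by simp
  then have "line_difference s 1 p m - p powr s * half_line_difference s m \<le> p powr s * (4 * t\<^sup>2 + 2 * m * t)"
    unfolding eq by (intro mult_left_mono) auto
  also have "\<dots> \<le> p * (4 * t\<^sup>2 + 2 * m * t)"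
    using p s t m powr_mono[of s 1 p] by (intro mult_right_mono) auto
  also have "\<dots> = 4 * (m * t) + 2 * m * m" using t by (simp add: power2_eq_square algebra_simps)
  also have "\<dots> \<le> 4 * (m * m) + 2 * m * m" using t m by (intro add_mono mult_left_mono) auto
  also have "\<dots> = 6 * m\<^sup>2" by (simp add: power2_eq_square)
  finally show ?thesis by simp
qed

lemma line_difference_le_middle:
  assumes s: "0 < s" "s < 1" and m: "1 \<le> m" "m \<le> p"
  shows "line_difference s 1 p m \<le> p powr s * half_line_difference s m + 2 * p powr (s - 1) * m powr (1 + s)"
proof -
  define t where "t = m / p"
  have t: "0 < t" "t \<le> 1" "m = t * p" using m by (auto simp: t_def field_simps)
  let ?P = "(1 + m) powr s"
  have pt: "(p - m) powr s = p powr s * (1 - t) powr s"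
  proof -
    have "p - m = p * (1 - t)" using t(3) by (auto simp: algebra_simps)
    then show ?thesis using t m by (auto simp: powr_mult)
  qed
  have "max 0 ((1 - m) * (p + m)) = 0"
    using m by (intro max_absorb1) (auto simp: mult_le_0_iff)
  then have "line_difference s 1 p m = 2 * p powr s - ?P * (p - m) powr s"
    using m by (simp add: line_difference_def powr_mult max_def zero_le_mult_iff) 
  then have "line_difference s 1 p m - p powr s * half_line_difference s m = ?P * (p powr s * (1 - (1 - t) powr s))"
    using m by (simp add: half_line_difference_def pt algebra_simps)
  also have "\<dots> \<le> (2 * m powr s) * (p powr s * t)"
  proof (intro mult_mono)
    show "?P \<le> 2 * m powr s" using s m by (intro double_powr_le)
    show "1 - (1 - t) powr s \<le> t" using powr_ge_self[of "1 - t" s] s t by simp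
    show "0 \<le> 1 - (1 - t) powr s"
      using t s powr_le1[of s "1 - t"] by simp
  qed (use t s powr_le1[of s "1 - t"] in auto)
  also have "\<dots> = 2 * p powr (s - 1) * m powr (1 + s)"
    using m s by (simp add: t_def powr_diff powr_add)
  finally show ?thesis by simp
qed

lemma line_difference_le_far:
  assumes s: "0 < s" "s < 1" and m: "1 \<le> p" "p \<le> m"
  shows "line_difference s 1 p m \<le> p powr s * half_line_difference s m + 2 * p powr s * m powr s"
proof -
  have "max 0 ((1 - m) * (p + m)) = 0" "max 0 ((1 + m) * (p - m)) = 0"
    using m by (auto intro!: max_absorb1 simp: mult_le_0_iff)
  then have "line_difference s 1 p m = 2 * p powr s"
    using m by (simp add: line_difference_def)
  then have "line_difference s 1 p m - p powr s * half_line_difference s m = p powr s * (1 + m) powr s"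
    using m by (simp add: half_line_difference_def algebra_simps)
  also have "\<dots> \<le> p powr s * (2 * m powr s)"
    using m s by (intro mult_left_mono double_powr_le) auto
  finally show ?thesis by simp
qed

text \<open>The half-line part has the unbounded factor \<open>p powr s\<close>, which is harmless only because its integral is nonpositive;
the three error terms integrate to a constant that depends on \<open>s\<close> alone.\<close>

lemma nn_integral_line_difference_le_normalized:
  assumes s: "0 < s" "s < 1" and p: "1 \<le> p"
  shows "(\<integral>\<^sup>+m. ennreal (line_difference s 1 p m * m powr (- 1 - 2 * s) * indicator {0<..} m) \<partial>lborel)
    \<le> ennreal (5 / (1 - s) + 2 / s) + 
      (\<integral>\<^sup>+m. ennreal (- (line_difference s 1 p m * m powr (- 1 - 2 * s) * indicator {0<..} m)) \<partial>lborel)"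
proof (rule nn_integral_le_of_dominated_difference)
  let ?w = "\<lambda>m::real. m powr (- 1 - 2 * s)"
  let ?Q = "\<lambda>m. p powr s * (half_line_difference s m * ?w m * indicator {0<..} m)
     + 6 * (m powr (1 - 2 * s) * indicator {0..1} m)
     + 2 * p powr (s - 1) * (m powr (- s) * indicator {0..p} m)
     + 2 * p powr s * (m powr (- 1 - s) * indicator {p..} m)"
  have i1: "has_bochner_integral lborel (\<lambda>m. m powr (1 - 2 * s) * indicator {0..1} m) (1 / (2 - 2 * s))"
    using has_bochner_integral_powr_from_0[where a = "1 - 2 * s" and c = 1] s by simp
  have i2: "has_bochner_integral lborel (\<lambda>m. m powr (- s) * indicator {0..p} m) (p powr (1 - s) / (1 - s))"
    using has_bochner_integral_powr_from_0[where a = "- s" and c = p] s p by simp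
  have i3: "has_bochner_integral lborel (\<lambda>m. m powr (- 1 - s) * indicator {p..} m) (p powr (- s) / s)"
    using has_bochner_integral_powr_to_inf[where e = "- 1 - s" and c = p] s p by simp
  show "(\<lambda>m. line_difference s 1 p m * ?w m * indicator {0<..} m) \<in> borel_measurable lborel"
    unfolding line_difference_def by measurable
  show "integrable lborel ?Q"
    using integrable_half_line[OF s] i1 i2 i3 by (intro Bochner_Integration.integrable_add integrable_mult_right) (auto simp: has_bochner_integral_iff)
  have "integral\<^sup>L lborel ?Q = p powr s * (LINT m|lborel. half_line_difference s m * ?w m * indicator {0<..} m)
     + 6 * (1 / (2 - 2 * s)) + 2 * p powr (s - 1) * (p powr (1 - s) / (1 - s)) + 2 * p powr s * (p powr (- s) / s)" (is "_ = ?I + ?a + ?b + ?c")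
    using integrable_half_line[OF s] i1 i2 i3 by (simp add: has_bochner_integral_iff)
  also have "\<dots> \<le> 0 + 3 / (1 - s) + 2 / (1 - s) + 2 / s"
  proof -
    have "p powr s * (LINT m|lborel. half_line_difference s m * ?w m * indicator {0<..} m) \<le> 0"
      using integral_half_line_nonpos[OF s] by (simp add: mult_nonneg_nonpos)
    moreover have "?a = 3 / (1 - s)" using s by (simp add: field_simps)
    moreover have "p powr (s - 1) * p powr (1 - s) = 1" using p by (subst powr_add[symmetric]) simp
    then have "2 * p powr (s - 1) * (p powr (1 - s) / (1 - s)) = 2 / (1 - s)" by simp
    moreover have "p powr s * p powr (- s) = 1" using p by (subst powr_add[symmetric]) simp
    then have "2 * p powr s * (p powr (- s) / s) = 2 / s" by simp
    ultimately show ?thesis by linarith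
  qed
  finally show "integral\<^sup>L lborel ?Q \<le> 5 / (1 - s) + 2 / s"
    by (simp add: add_divide_distrib[symmetric])
  fix m :: real
  have pw: "m powr a * ?w m = m powr (a - 1 - 2 * s)" for a
    by (subst powr_add[symmetric]) (simp add: algebra_simps)
  show "line_difference s 1 p m * ?w m * indicator {0<..} m \<le> ?Q m"
  proof -
    have r: "x * ?w m \<le> p powr s * (half_line_difference s m * ?w m) + c * m powr (a - 1 - 2 * s)"
      if "x \<le> p powr s * half_line_difference s m + c * m powr a" for x c a
      using mult_right_mono[OF that, of "?w m"] pw[of a] by (simp add: algebra_simps)
    have nn: "0 \<le> 2 * p powr (s - 1) * (m powr (- s) * indicator {0..p} m)"
      "0 \<le> 2 * p powr s * (m powr (- 1 - s) * indicator {p..} m)" 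
      "0 \<le> 6 * (m powr (1 - 2 * s) * indicator {0..1} m)" by auto
    consider "m \<le> 0" | "0 < m" "m \<le> 1" | "1 < m" "m \<le> p" | "1 < m" "p < m" by linarith
    then show ?thesis
    proof cases
      case 1
      then show ?thesis using nn by simp
    next
      case 2
      have "m powr 2 = m\<^sup>2" using 2 by simp
      then have "line_difference s 1 p m * ?w m \<le> p powr s * (half_line_difference s m * ?w m) + 6 * m powr (1 - 2 * s)"
        using r[of _ 6 2, OF line_difference_le_near[OF s 2 p, folded \<open>m powr 2 = m\<^sup>2\<close>]] by simp
      moreover have "indicator {0<..} m = (1::real)" "indicator {0..1} m = (1::real)" using 2 by auto
      ultimately show ?thesis using nn(1,2) by (simp only: mult_1_right)
    next
      case 3
      then show ?thesis using r[OF line_difference_le_middle[OF s, of m p]]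
        by (auto simp: indicator_def intro!: add_increasing2)
    next
      case 4
      then show ?thesis using r[OF line_difference_le_far[OF s p, of m]] nn by (simp add: algebra_simps)
    qed
  qed
qed

text \<open>Both sides are invariant under scaling and under exchanging the two pieces of the chord, which reduces the claim to the
normalized one.\<close>

lemma nn_integral_line_difference_le:
  assumes s: "0 < s" "s < 1" and a: "0 < a" and b: "0 < b"
  shows "(\<integral>\<^sup>+l. ennreal (line_difference s a b l * l powr (- 1 - 2 * s) * indicator {0<..} l) \<partial>lborel)
    \<le> ennreal (5 / (1 - s) + 2 / s) + 
      (\<integral>\<^sup>+l. ennreal (- (line_difference s a b l * l powr (- 1 - 2 * s) * indicator {0<..} l)) \<partial>lborel)"
proof -
  have main: "(\<integral>\<^sup>+l. ennreal (line_difference s a b l * l powr (- 1 - 2 * s) * indicator {0<..} l) \<partial>lborel)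
    \<le> ennreal (5 / (1 - s) + 2 / s) + 
      (\<integral>\<^sup>+l. ennreal (- (line_difference s a b l * l powr (- 1 - 2 * s) * indicator {0<..} l)) \<partial>lborel)" 
    if a: "0 < a" and ab: "a \<le> b" for a b :: real
  proof -
    have sc: "(\<integral>\<^sup>+l. ennreal (\<sigma> * (line_difference s a b l * l powr (- 1 - 2 * s) * indicator {0<..} l)) \<partial>lborel)
       = (\<integral>\<^sup>+m. ennreal (\<sigma> * (line_difference s 1 (b/a) m * m powr (- 1 - 2 * s) * indicator {0<..} m)) \<partial>lborel)" for \<sigma>
    proof -
      have q: "line_difference s a b (a * m) = a powr (2 * s) * line_difference s 1 (b/a) m" for m
      proof -
        define c where "c = b / a"
        have e: "a * b = a\<^sup>2 * (1 * c)" "(a + a * m) * (b - a * m) = a\<^sup>2 * ((1 + m) * (c - m))"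
          "(a - a * m) * (b + a * m) = a\<^sup>2 * ((1 - m) * (c + m))"
          using a by (auto simp: c_def field_simps power2_eq_square)
        have mx: "max 0 (a\<^sup>2 * x) = a\<^sup>2 * max 0 x" for x
          using a by (auto simp: max_def zero_le_mult_iff)
        have "a\<^sup>2 powr s = a powr (2 * s)" using a by (simp add: powr_powr flip: powr_numeral)
        then show ?thesis
          unfolding c_def[symmetric] line_difference_def e mx using a ab by (simp add: powr_mult right_diff_distrib c_def[symmetric])
      qed
      have "(\<integral>\<^sup>+l. ennreal (\<sigma> * (line_difference s a b l * l powr (- 1 - 2 * s) * indicator {0<..} l)) \<partial>lborel)
        = \<bar>a\<bar> * (\<integral>\<^sup>+m. ennreal (\<sigma> * (line_difference s a b (0 + a * m) * (0 + a * m) powr (- 1 - 2 * s) * indicator {0<..} (0 + a * m))) \<partial>lborel)"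
        using a by (intro nn_integral_real_affine) (auto simp: line_difference_def)
      also have "\<dots> = (\<integral>\<^sup>+m. ennreal a * ennreal (\<sigma> * (line_difference s a b (0 + a * m) * (0 + a * m) powr (- 1 - 2 * s) * indicator {0<..} (0 + a * m))) \<partial>lborel)"
        using a by (subst nn_integral_cmult) (auto simp: line_difference_def)
      also have "\<dots> = (\<integral>\<^sup>+m. ennreal (\<sigma> * (line_difference s 1 (b/a) m * m powr (- 1 - 2 * s) * indicator {0<..} m)) \<partial>lborel)"
      proof (intro nn_integral_cong)
        fix m :: real
        have eq: "a * (\<sigma> * (line_difference s a b (a * m) * (a * m) powr (- 1 - 2 * s))) =
          (\<sigma> * (line_difference s 1 (b/a) m * m powr (- 1 - 2 * s)))" if "0 < m"
        proof -
          have "a * (a powr (2 * s) * a powr (- 1 - 2 * s)) = 1"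
            using a by (subst powr_add[symmetric]) (simp add: powr_minus_divide)
          moreover have "a * (\<sigma> * (line_difference s a b (a * m) * (a * m) powr (- 1 - 2 * s))) =
            (a * (a powr (2 * s) * a powr (- 1 - 2 * s))) * (\<sigma> * (line_difference s 1 (b/a) m * m powr (- 1 - 2 * s)))"
            using a that by (simp add: q powr_mult)
          ultimately show ?thesis by simp
        qed
        show "ennreal a * ennreal (\<sigma> * (line_difference s a b (0 + a * m) * (0 + a * m) powr (- 1 - 2 * s) * indicator {0<..} (0 + a * m)))
          = ennreal (\<sigma> * (line_difference s 1 (b/a) m * m powr (- 1 - 2 * s) * indicator {0<..} m))"
        proof (cases "0 < m")
          case True
          have "ennreal a * ennreal (\<sigma> * (line_difference s a b (0 + a * m) * (0 + a * m) powr (- 1 - 2 * s) * indicator {0<..} (0 + a * m)))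
            = ennreal (a * (\<sigma> * (line_difference s a b (a * m) * (a * m) powr (- 1 - 2 * s))))"
            using a True by (simp add: ennreal_mult' zero_less_mult_iff)
          then show ?thesis unfolding eq[OF True] using True by simp
        qed (use a in \<open>auto simp: zero_less_mult_iff\<close>)
      qed
      finally show ?thesis .
    qed
    show ?thesis
      using nn_integral_line_difference_le_normalized[OF s, of "b/a"] a ab sc[of 1] sc[of "-1"] by simp
  qed
  have sym: "line_difference s a b = line_difference s b a"
    by (simp add: line_difference_def fun_eq_iff mult.commute add.commute)
  show ?thesis
    using main[of a b] main[of b a] a b sym by (cases "a \<le> b") auto
qed

lemma nn_integral_lborel_scale:
  fixes f :: "'a::euclidean_space \<Rightarrow> ennreal"
  assumes [measurable]: "f \<in> borel_measurable borel" and c: "0 < c"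
  shows "(\<integral>\<^sup>+y. f y \<partial>lborel) = ennreal (c ^ DIM('a)) * (\<integral>\<^sup>+y. f (c *\<^sub>R y) \<partial>lborel)"
proof -
  have "(\<integral>\<^sup>+y. f y \<partial>lborel) = (\<integral>\<^sup>+y. f y \<partial>density (distr lborel borel (\<lambda>x. 0 + c *\<^sub>R x)) (\<lambda>_. \<bar>c\<bar> ^ DIM('a)))"
    using lborel_affine[of c "0::'a"] c by simp
  also have "\<dots> = ennreal (c ^ DIM('a)) * (\<integral>\<^sup>+y. f (c *\<^sub>R y) \<partial>lborel)"
    using c by (simp add: nn_integral_density nn_integral_distr nn_integral_cmult)
  finally show ?thesis .
qed

section \<open>Polar coordinates with a thick sphere\<close>

lemma nn_integral_log_shell:
  fixes y :: "'a::euclidean_space"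
  assumes "y \<noteq> 0"
  shows "(\<integral>\<^sup>+l. ennreal (inverse l) * indicator {l. 0 < l \<and> 1 \<le> norm (inverse l *\<^sub>R y) \<and> norm (inverse l *\<^sub>R y) \<le> 2} l \<partial>lborel) = ennreal (ln 2)"
proof -
  let ?n = "norm y"
  have n: "0 < ?n" using assms by simp
  have set: "{l. 0 < l \<and> 1 \<le> norm (inverse l *\<^sub>R y) \<and> norm (inverse l *\<^sub>R y) \<le> 2} = {?n / 2 .. ?n}"
  proof (intro set_eqI)
    fix l :: real
    show "l \<in> {l. 0 < l \<and> 1 \<le> norm (inverse l *\<^sub>R y) \<and> norm (inverse l *\<^sub>R y) \<le> 2} \<longleftrightarrow> l \<in> {?n / 2 .. ?n}"
      using n by (cases "0 < l") (auto simp: field_simps simp del: zero_less_norm_iff)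
  qed
  have "(\<integral>\<^sup>+l. ennreal (inverse l) * indicator {?n / 2 .. ?n} l \<partial>lborel) = ennreal (ln ?n - ln (?n / 2))"
    using n by (intro nn_integral_FTC_Icc) (auto intro!: DERIV_ln simp del: zero_less_norm_iff)
  also have "ln ?n - ln (?n / 2) = ln 2" using n by (simp add: ln_div)
  finally show ?thesis unfolding set .
qed

text \<open>Polar coordinates in which the unit sphere is replaced by the shell \<open>1 \<le> norm k \<le> 2\<close>: this needs no surface measure.
Exchanging the integrals and substituting \<open>y = l *\<^sub>R k\<close>, each point \<open>y\<close> is counted with the weight of \<open>1 / l\<close> over
\<open>norm y / 2 \<le> l \<le> norm y\<close>, which is \<open>ln 2\<close>.\<close>

lemma nn_integral_fat_polar:
  fixes F :: "'a::euclidean_space \<Rightarrow> ennreal"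
  assumes [measurable]: "F \<in> borel_measurable borel"
  shows "ennreal (ln 2) * (\<integral>\<^sup>+y. F y \<partial>lborel) =
    (\<integral>\<^sup>+k. indicator {k. 1 \<le> norm k \<and> norm k \<le> 2} k *
       (\<integral>\<^sup>+l. indicator {0<..} l * ennreal (l powr (real DIM('a) - 1)) * F (l *\<^sub>R k) \<partial>lborel) \<partial>lborel)"
proof -
  let ?S = "{k::'a. 1 \<le> norm k \<and> norm k \<le> 2}"
  let ?T = "\<lambda>y::'a. {l::real. 0 < l \<and> 1 \<le> norm (inverse l *\<^sub>R y) \<and> norm (inverse l *\<^sub>R y) \<le> 2}"
  have [measurable]: "?S \<in> sets borel" by measurable
  have ind: "indicator (?T y) l = (indicator {0<..} l * indicator ?S (inverse l *\<^sub>R y) :: ennreal)" for y l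
    by (auto simp: indicator_def)
  have [measurable]: "(\<lambda>(y, l). ennreal (inverse l) * indicator (?T y) l * F y) \<in> borel_measurable (lborel \<Otimes>\<^sub>M lborel)"
    unfolding ind by measurable
  have "(\<integral>\<^sup>+k. indicator ?S k * (\<integral>\<^sup>+l. indicator {0<..} l * ennreal (l powr (real DIM('a) - 1)) * F (l *\<^sub>R k) \<partial>lborel) \<partial>lborel)
    = (\<integral>\<^sup>+k. (\<integral>\<^sup>+l. indicator ?S k * (indicator {0<..} l * ennreal (l powr (real DIM('a) - 1)) * F (l *\<^sub>R k)) \<partial>lborel) \<partial>lborel)"
    by (intro nn_integral_cong nn_integral_cmult[symmetric]) measurable
  also have "\<dots> = (\<integral>\<^sup>+l. (\<integral>\<^sup>+k. indicator ?S k * (indicator {0<..} l * ennreal (l powr (real DIM('a) - 1)) * F (l *\<^sub>R k)) \<partial>lborel) \<partial>lborel)"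
    by (rule lborel_pair.Fubini'[symmetric]) measurable
  also have "\<dots> = (\<integral>\<^sup>+l. (\<integral>\<^sup>+y. ennreal (inverse l) * indicator (?T y) l * F y \<partial>lborel) \<partial>lborel)"
  proof (rule nn_integral_cong)
    fix l :: real
    show "(\<integral>\<^sup>+k. indicator ?S k * (indicator {0<..} l * ennreal (l powr (real DIM('a) - 1)) * F (l *\<^sub>R k)) \<partial>lborel)
      = (\<integral>\<^sup>+y. ennreal (inverse l) * indicator (?T y) l * F y \<partial>lborel)"
    proof (cases "0 < l")
      case True
      have "(\<integral>\<^sup>+y. ennreal (inverse l) * indicator (?T y) l * F y \<partial>lborel)
        = (\<integral>\<^sup>+y. ennreal (inverse l) * (indicator ?S (inverse l *\<^sub>R y) * F y) \<partial>lborel)"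
        unfolding ind using True by (simp add: mult.assoc)
      also have "\<dots> = ennreal (inverse l) * (\<integral>\<^sup>+y. indicator ?S (inverse l *\<^sub>R y) * F y \<partial>lborel)"
        by (intro nn_integral_cmult) measurable
      also have "(\<integral>\<^sup>+y. indicator ?S (inverse l *\<^sub>R y) * F y \<partial>lborel) = 
         ennreal (l ^ DIM('a)) * (\<integral>\<^sup>+k. indicator ?S (inverse l *\<^sub>R (l *\<^sub>R k)) * F (l *\<^sub>R k) \<partial>lborel)"
        by (rule nn_integral_lborel_scale[OF _ True]) measurable
      also have "\<dots> = ennreal (l ^ DIM('a)) * (\<integral>\<^sup>+k. indicator ?S k * F (l *\<^sub>R k) \<partial>lborel)"
        using True by simp
      finally have "(\<integral>\<^sup>+y. ennreal (inverse l) * indicator (?T y) l * F y \<partial>lborel)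
        = ennreal (inverse l) * (ennreal (l ^ DIM('a)) * (\<integral>\<^sup>+k. indicator ?S k * F (l *\<^sub>R k) \<partial>lborel))" .
      also have "\<dots> = ennreal (l powr (real DIM('a) - 1)) * (\<integral>\<^sup>+k. indicator ?S k * F (l *\<^sub>R k) \<partial>lborel)"
      proof -
        have "inverse l * l ^ DIM('a) = l powr (real DIM('a) - 1)"
          using True by (simp add: powr_diff powr_realpow field_simps)
        then show ?thesis using True by (simp add: mult.assoc[symmetric] ennreal_mult'[symmetric])
      qed
      also have "\<dots> = (\<integral>\<^sup>+k. ennreal (l powr (real DIM('a) - 1)) * (indicator ?S k * F (l *\<^sub>R k)) \<partial>lborel)"
        by (intro nn_integral_cmult[symmetric]) measurable
      finally show ?thesis
        using True by (simp add: ac_simps)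
    qed (auto simp: indicator_def)
  qed
  also have "\<dots> = (\<integral>\<^sup>+y. (\<integral>\<^sup>+l. ennreal (inverse l) * indicator (?T y) l * F y \<partial>lborel) \<partial>lborel)"
    by (rule lborel_pair.Fubini') measurable
  also have "\<dots> = (\<integral>\<^sup>+y. (\<integral>\<^sup>+l. ennreal (inverse l) * indicator (?T y) l \<partial>lborel) * F y \<partial>lborel)"
    unfolding ind by (intro nn_integral_cong nn_integral_multc) measurable
  also have "\<dots> = (\<integral>\<^sup>+y. ennreal (ln 2) * F y \<partial>lborel)"
  proof (intro nn_integral_cong_AE)
    have "AE y in lborel. y \<noteq> (0::'a)" by (rule AE_lborel_singleton)
    then show "AE y in lborel. (\<integral>\<^sup>+l. ennreal (inverse l) * indicator (?T y) l \<partial>lborel) * F y = ennreal (ln 2) * F y"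
      by eventually_elim (subst nn_integral_log_shell, assumption, rule refl)
  qed
  also have "\<dots> = ennreal (ln 2) * (\<integral>\<^sup>+y. F y \<partial>lborel)"
    by (intro nn_integral_cmult) measurable
  finally show ?thesis by simp
qed

section \<open>The fractional Laplacian of the barrier\<close>

definition second_difference :: "('a::real_vector \<Rightarrow> real) \<Rightarrow> 'a \<Rightarrow> 'a \<Rightarrow> real" where
  "second_difference f x h = 2 * f x - f (x + h) - f (x - h)"

definition fractional_kernel :: "real \<Rightarrow> 'a::euclidean_space \<Rightarrow> real" where
  "fractional_kernel s h = norm h powr (- (real DIM('a) + 2 * s))"

definition ball_barrier :: "real \<Rightarrow> real \<Rightarrow> 'a::euclidean_space \<Rightarrow> real" where
  "ball_barrier s r x = (max 0 (r\<^sup>2 - (norm x)\<^sup>2)) powr s"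

lemma fractional_kernel_measurable[measurable]: "fractional_kernel s \<in> borel_measurable borel"
  unfolding fractional_kernel_def by measurable

lemma second_difference_measurable[measurable]:
  fixes f :: "'a::euclidean_space \<Rightarrow> real"
  assumes [measurable]: "f \<in> borel_measurable borel"
  shows "second_difference f x \<in> borel_measurable borel"
  unfolding second_difference_def by measurable

lemma fractional_kernel_nonneg[simp]: "0 \<le> fractional_kernel s h"
  by (simp add: fractional_kernel_def)

lemma ball_barrier_measurable[measurable]: "ball_barrier s r \<in> borel_measurable borel"
  unfolding ball_barrier_def by measurable

text \<open>On a line through an interior point, \<open>r\<^sup>2 - (norm x)\<^sup>2\<close> is a quadratic polynomial with one root on each side; \<open>a\<close> and \<open>b\<close>
are the distances to the roots in units of \<open>norm k\<close>.\<close>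

lemma ball_barrier_on_line:
  fixes x k :: "'a::euclidean_space"
  assumes x: "norm x < r" and k: "k \<noteq> 0"
  obtains a b where "0 < a" "0 < b" 
    "\<And>l. second_difference (ball_barrier s r) x (l *\<^sub>R k) = norm k powr (2 * s) * line_difference s a b l"
proof
  define K A B where "K = (norm k)\<^sup>2" and "A = r\<^sup>2 - (norm x)\<^sup>2" and "B = x \<bullet> k"
  have K: "0 < K" using k by (simp add: K_def)
  have A: "0 < A" using x by (simp add: A_def abs_square_less_1 power_strict_mono)
  define R where "R = sqrt ((B / K)\<^sup>2 + A / K)"
  have R: "\<bar>B / K\<bar> < R"
    unfolding R_def using K A by (intro real_less_rsqrt) (auto simp: power_divide)
  have R2: "R\<^sup>2 = (B / K)\<^sup>2 + A / K" using A K by (simp add: R_def)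
  define a b where "a = B / K + R" and "b = - (B / K) + R"
  show "0 < a" "0 < b" using R unfolding abs_less_iff a_def b_def by linarith+
  have ab: "a * b = A / K"
    using R2 by (simp add: a_def b_def algebra_simps power2_eq_square)
  have KA: "K * (A / K) = A" "K * (B / K) = B" using K by auto
  have plus: "r\<^sup>2 - (norm (x + l *\<^sub>R k))\<^sup>2 = K * ((a + l) * (b - l))" for l
  proof -
    have "K * ((a + l) * (b - l)) = K * (a * b) + K * (b - a) * l - K * l\<^sup>2"
      by (simp add: algebra_simps power2_eq_square)
    also have "\<dots> = A - 2 * (K * (B / K)) * l - K * l\<^sup>2"
      unfolding ab KA using K by (simp add: a_def b_def algebra_simps)
    also have "\<dots> = r\<^sup>2 - (norm (x + l *\<^sub>R k))\<^sup>2"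
    proof -
      have "(norm (x + l *\<^sub>R k))\<^sup>2 = (norm x)\<^sup>2 + 2 * (l * B) + l\<^sup>2 * K"
        unfolding K_def B_def power2_norm_eq_inner
        by (simp add: inner_simps algebra_simps inner_commute power2_eq_square)
      then show ?thesis unfolding KA(2) A_def by (simp add: algebra_simps)
    qed
    finally show ?thesis by simp
  qed
  have minus: "r\<^sup>2 - (norm (x - l *\<^sub>R k))\<^sup>2 = K * ((a - l) * (b + l))" for l
    using plus[of "- l"] by simp
  have zero: "r\<^sup>2 - (norm x)\<^sup>2 = K * (a * b)"
    using plus[of 0] by simp
  have mx: "max 0 (K * t) = K * max 0 t" for t
    using K by (auto simp: max_def zero_le_mult_iff)
  have Ks: "K powr s = norm k powr (2 * s)"
    using k by (simp add: K_def powr_powr flip: powr_numeral)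
  have ab0: "max 0 (a * b) = a * b" using \<open>0 < a\<close> \<open>0 < b\<close> by simp
  show "second_difference (ball_barrier s r) x (l *\<^sub>R k) = norm k powr (2 * s) * line_difference s a b l" for l
    unfolding second_difference_def ball_barrier_def plus minus zero mx line_difference_def Ks[symmetric] ab0
    using K \<open>0 < a\<close> \<open>0 < b\<close> by (simp add: powr_mult algebra_simps)
qed

text \<open>In the thick polar coordinates the kernel and the Jacobian combine to \<open>l powr (- 1 - 2 * s)\<close>, so on each line the
one-dimensional estimate applies; integrating its constant over the shell gives the bound. It is uniform up to the
boundary of the ball, where positive and negative part both become large.\<close>

lemma nn_integral_second_difference_barrier_le:
  fixes x :: "'a::euclidean_space"
  assumes s: "0 < s" "s < 1" and x: "norm x < r"
  shows "(\<integral>\<^sup>+h. ennreal (second_difference (ball_barrier s r) x h * fractional_kernel s h) \<partial>lborel)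
    \<le> ennreal ((5 / (1 - s) + 2 / s) * measure lborel (cball (0::'a) 2) / ln 2) + 
      (\<integral>\<^sup>+h. ennreal (- (second_difference (ball_barrier s r) x h * fractional_kernel s h)) \<partial>lborel)"
proof -
  let ?q = "\<lambda>h. second_difference (ball_barrier s r) x h * fractional_kernel s h"
  let ?S = "{k::'a. 1 \<le> norm k \<and> norm k \<le> 2}"
  let ?N = "real DIM('a)"
  let ?C = "5 / (1 - s) + 2 / s"
  let ?in = "\<lambda>\<sigma> k. \<integral>\<^sup>+l. indicator {0<..} l * ennreal (l powr (?N - 1)) * ennreal (\<sigma> * ?q (l *\<^sub>R k)) \<partial>lborel"
  have C: "0 \<le> ?C" using s by simp
  have [measurable]: "?S \<in> sets borel" by measurable
  have polar: "ennreal (ln 2) * (\<integral>\<^sup>+h. ennreal (\<sigma> * ?q h) \<partial>lborel) = (\<integral>\<^sup>+k. indicator ?S k * ?in \<sigma> k \<partial>lborel)" for \<sigma>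
    by (rule nn_integral_fat_polar) measurable
  have inner_le: "?in 1 k \<le> ennreal ?C + ?in (-1) k" if k: "k \<in> ?S" for k
  proof -
    have k0: "k \<noteq> 0" using k by auto
    obtain a b where ab: "0 < a" "0 < b" and
      line: "\<And>l. second_difference (ball_barrier s r) x (l *\<^sub>R k) = norm k powr (2 * s) * line_difference s a b l"
      using ball_barrier_on_line[OF x k0, of s] by blast
    let ?L = "\<lambda>\<sigma>. \<integral>\<^sup>+l. ennreal (\<sigma> * (line_difference s a b l * l powr (- 1 - 2 * s) * indicator {0<..} l)) \<partial>lborel"
    have eq: "?in \<sigma> k = ennreal (norm k powr (- ?N)) * ?L \<sigma>" for \<sigma>
    proof -
      have "?in \<sigma> k = (\<integral>\<^sup>+l. ennreal (norm k powr (- ?N)) * ennreal (\<sigma> * (line_difference s a b l * l powr (- 1 - 2 * s) * indicator {0<..} l)) \<partial>lborel)"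
      proof (intro nn_integral_cong)
        fix l :: real
        show "indicator {0<..} l * ennreal (l powr (?N - 1)) * ennreal (\<sigma> * ?q (l *\<^sub>R k)) =
          ennreal (norm k powr (- ?N)) * ennreal (\<sigma> * (line_difference s a b l * l powr (- 1 - 2 * s) * indicator {0<..} l))"
        proof (cases "0 < l")
          case True
          have kk: "norm k powr (2 * s) * norm k powr (- (?N + 2 * s)) = norm k powr (- ?N)"
            by (subst powr_add[symmetric]) simp
          have ll: "l powr (?N - 1) * l powr (- (?N + 2 * s)) = l powr (- 1 - 2 * s)"
            by (subst powr_add[symmetric]) (simp add: algebra_simps)
          have "l powr (?N - 1) * (\<sigma> * ?q (l *\<^sub>R k)) = 
             \<sigma> * (line_difference s a b l * (l powr (?N - 1) * l powr (- (?N + 2 * s))) * (norm k powr (2 * s) * norm k powr (- (?N + 2 * s))))"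
            using True by (simp add: line fractional_kernel_def powr_mult)
          also have "\<dots> = norm k powr (- ?N) * (\<sigma> * (line_difference s a b l * l powr (- 1 - 2 * s)))"
            unfolding kk ll by simp
          finally have e: "l powr (?N - 1) * (\<sigma> * ?q (l *\<^sub>R k)) = norm k powr (- ?N) * (\<sigma> * (line_difference s a b l * l powr (- 1 - 2 * s)))" .
          have "indicator {0<..} l * ennreal (l powr (?N - 1)) * ennreal (\<sigma> * ?q (l *\<^sub>R k)) = ennreal (l powr (?N - 1) * (\<sigma> * ?q (l *\<^sub>R k)))"
            using True by (subst ennreal_mult') auto
          also have "\<dots> = ennreal (norm k powr (- ?N)) * ennreal (\<sigma> * (line_difference s a b l * l powr (- 1 - 2 * s) * indicator {0<..} l))"
            unfolding e using True by (subst ennreal_mult') auto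
          finally show ?thesis .
        qed auto
      qed
      also have "\<dots> = ennreal (norm k powr (- ?N)) * ?L \<sigma>"
        unfolding line_difference_def by (intro nn_integral_cmult) measurable
      finally show ?thesis .
    qed
    have "?L 1 \<le> ennreal ?C + ?L (-1)"
      using nn_integral_line_difference_le[OF s ab] by simp
    then have "?in 1 k \<le> ennreal (norm k powr (- ?N)) * (ennreal ?C + ?L (-1))"
      unfolding eq by (rule mult_left_mono) simp
    also have "\<dots> = ennreal (norm k powr (- ?N)) * ennreal ?C + ?in (-1) k"
      unfolding eq by (simp add: distrib_left)
    also have "\<dots> \<le> 1 * ennreal ?C + ?in (-1) k"
    proof (intro add_mono mult_right_mono)
      have "norm k powr (- ?N) \<le> norm k powr 0" using k by (intro powr_mono) auto
      also have "\<dots> = 1" using k0 by simp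
      finally show "ennreal (norm k powr (- ?N)) \<le> 1" by simp
    qed auto
    finally show ?thesis by simp
  qed
  have meas: "(\<lambda>k. indicator ?S k * ?in \<sigma> k) \<in> borel_measurable lborel" for \<sigma>
  proof -
    have "(\<lambda>(k::'a, l). indicator {0<..} l * ennreal (l powr (?N - 1)) * ennreal (\<sigma> * ?q (l *\<^sub>R k)))
        \<in> borel_measurable (lborel \<Otimes>\<^sub>M lborel)"
      by measurable
    then have [measurable]: "?in \<sigma> \<in> borel_measurable lborel"
      by (rule lborel.borel_measurable_nn_integral)
    show ?thesis by measurable
  qed
  have "ennreal (ln 2) * (\<integral>\<^sup>+h. ennreal (1 * ?q h) \<partial>lborel) \<le> (\<integral>\<^sup>+k. ennreal ?C * indicator (cball 0 2) k + indicator ?S k * ?in (-1) k \<partial>lborel)"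
    unfolding polar
  proof (intro nn_integral_mono)
    fix k :: 'a
    show "indicator ?S k * ?in 1 k \<le> ennreal ?C * indicator (cball 0 2) k + indicator ?S k * ?in (-1) k"
    proof (cases "k \<in> ?S")
      case True
      then have "indicator ?S k = (1::ennreal)" "indicator (cball 0 2) k = (1::ennreal)" by auto
      then show ?thesis
        using inner_le[OF True] by (simp only: mult_1_left mult_1_right)
    next
      case False
      then have "indicator ?S k = (0::ennreal)" by (rule indicator_simps)
      then show ?thesis by (simp only: mult_zero_left zero_le)
    qed
  qed
  also have "\<dots> = ennreal ?C * emeasure lborel (cball (0::'a) 2) + ennreal (ln 2) * (\<integral>\<^sup>+h. ennreal ((-1) * ?q h) \<partial>lborel)"
  proof -
    have cb: "cball (0::'a) 2 \<in> sets lborel" by simp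
    have "(\<lambda>k. ennreal ?C * indicator (cball (0::'a) 2) k) \<in> borel_measurable lborel"
      using cb by (intro borel_measurable_times_ennreal borel_measurable_const borel_measurable_indicator)
    then show ?thesis
      unfolding polar nn_integral_cmult_indicator[OF cb, symmetric] by (rule nn_integral_add[OF _ meas])
  qed
  also have "emeasure lborel (cball (0::'a) 2) = ennreal (measure lborel (cball (0::'a) 2))"
    by (intro emeasure_eq_ennreal_measure) (use emeasure_bounded_finite[OF bounded_cball, of "0::'a" 2] in \<open>simp add: less_top[symmetric]\<close>)
  also have "ennreal ?C * ennreal (measure lborel (cball (0::'a) 2)) = ennreal (ln 2) * ennreal (?C * measure lborel (cball (0::'a) 2) / ln 2)"
    using C by (subst ennreal_mult'[symmetric], simp, subst ennreal_mult'[symmetric]) auto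
  finally have "ennreal (ln 2) * (\<integral>\<^sup>+h. ennreal (1 * ?q h) \<partial>lborel) \<le> ennreal (ln 2) * (ennreal (?C * measure lborel (cball (0::'a) 2) / ln 2) + (\<integral>\<^sup>+h. ennreal ((-1) * ?q h) \<partial>lborel))"
    by (simp only: distrib_left)
  then show ?thesis
    by (subst (asm) ennreal_mult_le_mult_iff) auto
qed

text \<open>As long as \<open>x + h\<close> and \<open>x - h\<close> both stay in the ball, the second difference is nonnegative by concavity of the barrier.
So its negative part is bounded and supported away from the singularity of the kernel.\<close>

lemma nn_integral_negative_second_difference_barrier_finite:
  fixes x :: "'a::euclidean_space"
  assumes s: "0 < s" "s < 1" and x: "norm x < r"
  shows "(\<integral>\<^sup>+h. ennreal (- (second_difference (ball_barrier s r) x h * fractional_kernel s h)) \<partial>lborel) \<noteq> \<infinity>"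
proof -
  let ?W = "ball_barrier s r :: 'a \<Rightarrow> real"
  define d where "d = r - norm x"
  define M where "M = r\<^sup>2 - (norm x)\<^sup>2"
  have d: "0 < d" and r: "0 < r" using x norm_ge_zero[of x] by (auto simp: d_def simp del: norm_ge_zero)
  have M: "0 < M" using x by (simp add: M_def power_strict_mono)
  define B where "B = 2 * (r\<^sup>2) powr s * d powr (- (real DIM('a) + 2 * s))"
  have le: "- (second_difference ?W x h * fractional_kernel s h) \<le> B * indicator (cball 0 (2 * r)) h" for h
  proof (cases "norm h < d")
    case True
    define P Q where "P = r\<^sup>2 - (norm (x + h))\<^sup>2" and "Q = r\<^sup>2 - (norm (x - h))\<^sup>2"
    have "norm (x + h) < r" "norm (x - h) < r"
      using True norm_triangle_ineq[of x h] norm_triangle_ineq4[of x h] by (auto simp: d_def)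
    then have PQ: "0 < P" "0 < Q" by (auto simp: P_def Q_def power_strict_mono)
    have "P + Q = 2 * M - 2 * (norm h)\<^sup>2"
      by (simp add: P_def Q_def M_def power2_norm_eq_inner inner_simps algebra_simps inner_commute)
    moreover have "0 \<le> (norm h)\<^sup>2" by simp
    ultimately have "P + Q \<le> 2 * M" by linarith
    then have "(P + Q) / M \<le> 2" using M by (simp add: field_simps)
    then have *: "s * ((P + Q) / M) \<le> s * 2" using s by (intro mult_left_mono) auto
    have "(P / M) powr s + (Q / M) powr s \<le> (s * (P / M) + (1 - s)) + (s * (Q / M) + (1 - s))"
      using PQ M s by (intro add_mono powr_le_tangent) auto
    also have "\<dots> = s * ((P + Q) / M) + 2 * (1 - s)" by (simp add: add_divide_distrib algebra_simps)
    also have "\<dots> \<le> 2" using * by simp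
    finally have "M powr s * ((P / M) powr s + (Q / M) powr s) \<le> M powr s * 2" by (intro mult_left_mono) auto
    then have "P powr s + Q powr s \<le> 2 * M powr s"
      using PQ M by (simp add: powr_divide distrib_left)
    then have "0 \<le> second_difference ?W x h"
      using PQ M by (simp add: second_difference_def ball_barrier_def P_def Q_def M_def)
    then have "- (second_difference ?W x h * fractional_kernel s h) \<le> 0" by simp
    also have "0 \<le> B * indicator (cball 0 (2 * r)) h" by (simp add: B_def)
    finally show ?thesis .
  next
    case False
    have W0: "0 \<le> ?W z" for z by (simp add: ball_barrier_def)
    have W1: "?W z \<le> (r\<^sup>2) powr s" for z
      unfolding ball_barrier_def using s by (intro powr_mono2) auto
    have k: "fractional_kernel s h \<le> d powr (- (real DIM('a) + 2 * s))"
      unfolding fractional_kernel_def using False d s by (intro powr_mono2') auto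
    show ?thesis
    proof (cases "norm h \<le> 2 * r")
      case True
      have "- second_difference ?W x h \<le> 2 * (r\<^sup>2) powr s"
        using W0[of x] W1[of "x + h"] W1[of "x - h"] by (simp add: second_difference_def)
      then have "- second_difference ?W x h * fractional_kernel s h \<le> 2 * (r\<^sup>2) powr s * fractional_kernel s h"
        by (intro mult_right_mono) auto
      also have "\<dots> \<le> B" unfolding B_def using k by (intro mult_left_mono) auto
      finally show ?thesis using True by simp
    next
      case False
      have "r \<le> norm (x + h)" "r \<le> norm (x - h)"
        using False x norm_triangle_ineq2[of h "-x"] norm_triangle_ineq2[of h x] 
        by (auto simp: norm_minus_commute add.commute)
      then have "?W (x + h) = 0" "?W (x - h) = 0"
        using r by (auto simp: ball_barrier_def power_mono max_def)
      then have "0 \<le> second_difference ?W x h" using W0[of x] by (simp add: second_difference_def)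
      then show ?thesis using False by simp
    qed
  qed
  have "(\<integral>\<^sup>+h. ennreal (- (second_difference ?W x h * fractional_kernel s h)) \<partial>lborel)
    \<le> (\<integral>\<^sup>+h. ennreal B * indicator (cball (0::'a) (2 * r)) h \<partial>lborel)"
  proof (intro nn_integral_mono)
    fix h :: 'a
    have "ennreal (- (second_difference ?W x h * fractional_kernel s h)) \<le> ennreal (B * indicator (cball 0 (2 * r)) h)"
      by (intro ennreal_leI le)
    also have "\<dots> = ennreal B * indicator (cball 0 (2 * r)) h"
      by (simp add: B_def indicator_def)
    finally show "ennreal (- (second_difference ?W x h * fractional_kernel s h)) \<le> ennreal B * indicator (cball 0 (2 * r)) h" .
  qed
  also have "\<dots> < \<infinity>"
    using emeasure_bounded_finite[OF bounded_cball, of "0::'a" "2 * r"]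
    by (simp add: nn_integral_cmult_indicator ennreal_mult_less_top)
  finally show ?thesis by simp
qed

text \<open>The bound \<open>(-\<Delta>)\<^sup>s W \<le> C\<close> for the barrier, stated for integrable minorants \<open>F\<close> of the integrand, because this is how the
comparison argument uses it. The constant depends neither on the radius nor on the point.\<close>

lemma fractional_laplacian_barrier_bounded:
  assumes s: "0 < s" "s < 1"
  obtains C where "0 \<le> C"
    "\<And>r (x::'a::euclidean_space) F. norm x < r \<Longrightarrow> integrable lborel F \<Longrightarrow>
       (\<And>h. F h \<le> second_difference (ball_barrier s r) x h * fractional_kernel s h) \<Longrightarrow> integral\<^sup>L lborel F \<le> C"
proof
  let ?C = "(5 / (1 - s) + 2 / s) * measure lborel (cball (0::'a) 2) / ln 2"
  show C: "0 \<le> ?C" using s by simp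
  fix r and x :: 'a and F
  assume x: "norm x < r" and F: "integrable lborel F"
    and le: "\<And>h. F h \<le> second_difference (ball_barrier s r) x h * fractional_kernel s h"
  show "integral\<^sup>L lborel F \<le> ?C"
    by (rule integral_le_of_nn_integral_le[OF _ F le
          nn_integral_negative_second_difference_barrier_finite[OF s x] C nn_integral_second_difference_barrier_le[OF s x]])
       measurable
qed

section \<open>A smooth radial bump\<close>

text \<open>The powers of \<open>t\<close> in the denominator make this family closed under differentiation up to linear combinations.\<close>

definition exp_bump :: "nat \<Rightarrow> real \<Rightarrow> real" where
  "exp_bump n t = (if 0 < t then exp (- (1 / t)) / t ^ n else 0)"

lemma exp_bump_quotient_tendsto_0: "((\<lambda>t. exp_bump n t / t) \<longlongrightarrow> 0) (at 0)"
proof (rule filterlim_split_at_real)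
  have "((\<lambda>t::real. inverse t ^ Suc n / exp (inverse t)) \<longlongrightarrow> 0) (at_right 0)"
    by (rule filterlim_compose[OF tendsto_power_div_exp_0 filterlim_inverse_at_top_right])
  then show "((\<lambda>t. exp_bump n t / t) \<longlongrightarrow> 0) (at_right 0)"
  proof (rule Lim_transform_eventually)
    show "\<forall>\<^sub>F t in at_right 0. inverse t ^ Suc n / exp (inverse t) = exp_bump n t / t"
      unfolding eventually_at_filter
      by (auto intro!: always_eventually simp: exp_bump_def exp_minus field_simps)
  qed
  show "((\<lambda>t. exp_bump n t / t) \<longlongrightarrow> 0) (at_left 0)"
  proof (rule tendsto_eventually)
    show "\<forall>\<^sub>F t in at_left 0. exp_bump n t / t = 0"
      unfolding eventually_at_filter by (auto intro!: always_eventually simp: exp_bump_def)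
  qed
qed

lemma DERIV_exp_bump: "DERIV (exp_bump n) t :> exp_bump (n + 2) t - real n * exp_bump (n + 1) t"
proof -
  consider "0 < t" | "t < 0" | "t = 0" by linarith
  then show ?thesis
  proof cases
    case 1
    have "DERIV (\<lambda>t. exp (- (1 / t)) / t ^ n) t :> exp_bump (n + 2) t - real n * exp_bump (n + 1) t"
    proof -
      have "DERIV (\<lambda>t. exp (- (1 / t))) t :> exp (- (1 / t)) * (1 / t\<^sup>2)"
        using 1 by (auto intro!: derivative_eq_intros simp: power2_eq_square)
      moreover have "DERIV (\<lambda>t. inverse t ^ n) t :> real n * (- (inverse t ^ Suc (Suc 0)) * inverse t ^ (n - Suc 0))"
        using 1 by (intro DERIV_power DERIV_inverse) auto
      ultimately have "DERIV (\<lambda>t. exp (- (1 / t)) * inverse t ^ n) t :>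
         exp (- (1 / t)) * (1 / t\<^sup>2) * inverse t ^ n
         + real n * (- (inverse t ^ Suc (Suc 0)) * inverse t ^ (n - Suc 0)) * exp (- (1 / t))"
        by (rule DERIV_mult)
      also have "(\<lambda>t. exp (- (1 / t)) * inverse t ^ n) = (\<lambda>t::real. exp (- (1 / t)) / t ^ n)"
        by (simp add: divide_inverse power_inverse)
      also have "exp (- (1 / t)) * (1 / t\<^sup>2) * inverse t ^ n
         + real n * (- (inverse t ^ Suc (Suc 0)) * inverse t ^ (n - Suc 0)) * exp (- (1 / t))
         = exp_bump (n + 2) t - real n * exp_bump (n + 1) t"
        using 1 by (cases n) (simp_all add: exp_bump_def field_simps power2_eq_square)
      finally show ?thesis .
    qed
    then show ?thesis
    proof (rule has_field_derivative_transform_within_open)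
      show "open {0::real<..}" "t \<in> {0<..}" using 1 by auto
    qed (simp add: exp_bump_def)
  next
    case 2
    have "DERIV (\<lambda>_. 0) t :> exp_bump (n + 2) t - real n * exp_bump (n + 1) t"
      using 2 by (simp add: exp_bump_def)
    then show ?thesis
    proof (rule has_field_derivative_transform_within_open)
      show "open {..<0::real}" "t \<in> {..<0}" using 2 by auto
    qed (simp add: exp_bump_def)
  next
    case 3
    have "exp_bump n 0 = 0" by (simp add: exp_bump_def)
    then have "DERIV (exp_bump n) 0 :> 0"
      using exp_bump_quotient_tendsto_0[of n] by (simp add: DERIV_def)
    then show ?thesis using 3 by (simp add: exp_bump_def)
  qed
qed

text \<open>A space of functions that contains the bump and is closed under directional derivatives. Membership therefore gives
derivatives of all orders by induction, without formulas for them.\<close>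

inductive bump_span :: "'a::euclidean_space \<Rightarrow> real \<Rightarrow> ('a \<Rightarrow> real) \<Rightarrow> bool" for a :: 'a and \<epsilon> :: real where
  bump: "bump_span a \<epsilon> (\<lambda>x. exp_bump n (\<epsilon>\<^sup>2 - (norm (x - a))\<^sup>2))"
| add: "bump_span a \<epsilon> f \<Longrightarrow> bump_span a \<epsilon> g \<Longrightarrow> bump_span a \<epsilon> (\<lambda>x. f x + g x)"
| scale: "bump_span a \<epsilon> f \<Longrightarrow> bump_span a \<epsilon> (\<lambda>x. c * f x)"
| inner: "bump_span a \<epsilon> f \<Longrightarrow> bump_span a \<epsilon> (\<lambda>x. (x \<bullet> w) * f x)"

lemma bump_span_derivative:
  assumes "bump_span a \<epsilon> f"
  shows "\<exists>f'. (\<forall>x. (f has_derivative f' x) (at x)) \<and> (\<forall>v. bump_span a \<epsilon> (\<lambda>x. f' x v))"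
  using assms
proof induction
  case (bump n)
  define B where "B x = exp_bump (n + 2) (\<epsilon>\<^sup>2 - (norm (x - a))\<^sup>2) + (- real n) * exp_bump (n + 1) (\<epsilon>\<^sup>2 - (norm (x - a))\<^sup>2)" for x
  define f' where "f' x v = (- 2) * ((x \<bullet> v) * B x) + (2 * (a \<bullet> v)) * B x" for x v
  have B: "bump_span a \<epsilon> B"
    unfolding B_def by (intro bump_span.intros)
  show ?case
  proof (intro exI conjI allI)
    fix x :: 'a
    have d: "((\<lambda>x. \<epsilon>\<^sup>2 - (norm (x - a))\<^sup>2) has_derivative (\<lambda>v. - 2 * ((x - a) \<bullet> v))) (at x)"
      unfolding power2_norm_eq_inner
      by (auto intro!: derivative_eq_intros simp: inner_commute)
    have "((\<lambda>x. exp_bump n (\<epsilon>\<^sup>2 - (norm (x - a))\<^sup>2)) has_derivative (\<lambda>v. (- 2 * ((x - a) \<bullet> v)) * B x)) (at x)"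
      using DERIV_compose_FDERIV[OF DERIV_exp_bump d] by (simp add: B_def)
    also have "(\<lambda>v. (- 2 * ((x - a) \<bullet> v)) * B x) = f' x"
      by (simp add: f'_def fun_eq_iff inner_diff_left algebra_simps)
    finally show "((\<lambda>x. exp_bump n (\<epsilon>\<^sup>2 - (norm (x - a))\<^sup>2)) has_derivative f' x) (at x)" .
    show "bump_span a \<epsilon> (\<lambda>x. f' x v)" for v
      unfolding f'_def by (intro bump_span.intros B)
  qed
next
  case (add f g)
  then obtain f' g' where "\<And>x. (f has_derivative f' x) (at x)" "\<And>v. bump_span a \<epsilon> (\<lambda>x. f' x v)"
    "\<And>x. (g has_derivative g' x) (at x)" "\<And>v. bump_span a \<epsilon> (\<lambda>x. g' x v)" by blast
  then show ?case
    by (intro exI[of _ "\<lambda>x v. f' x v + g' x v"]) (auto intro!: has_derivative_add bump_span.add)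
next
  case (scale f c)
  then obtain f' where "\<And>x. (f has_derivative f' x) (at x)" "\<And>v. bump_span a \<epsilon> (\<lambda>x. f' x v)" by blast
  then show ?case
    by (intro exI[of _ "\<lambda>x v. c * f' x v"]) (auto intro!: has_derivative_mult_right bump_span.scale)
next
  case (inner f w)
  then obtain f' where f': "\<And>x. (f has_derivative f' x) (at x)" "\<And>v. bump_span a \<epsilon> (\<lambda>x. f' x v)" by blast
  show ?case
  proof (intro exI conjI allI)
    show "((\<lambda>x. (x \<bullet> w) * f x) has_derivative (\<lambda>v. (x \<bullet> w) * f' x v + (v \<bullet> w) * f x)) (at x)" for x
      using f'(1)[of x] by (auto intro!: derivative_eq_intros)
    show "bump_span a \<epsilon> (\<lambda>x. (x \<bullet> w) * f' x v + (v \<bullet> w) * f x)" for v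
      by (intro bump_span.intros f' inner)
  qed
qed

lemma bump_span_Ck: "bump_span a \<epsilon> f \<Longrightarrow> Ck k f"
proof (induction k arbitrary: f)
  case 0
  obtain f' where "\<And>x. (f has_derivative f' x) (at x)"
    using bump_span_derivative[OF 0] by blast
  then have "isCont f x" for x by (rule has_derivative_continuous)
  then show ?case by (simp add: continuous_at_imp_continuous_on)
next
  case (Suc k)
  obtain f' where f': "\<And>x. (f has_derivative f' x) (at x)" "\<And>v. bump_span a \<epsilon> (\<lambda>x. f' x v)"
    using bump_span_derivative[OF Suc.prems] by blast
  have "frechet_derivative f (at x) = f' x" for x
    using frechet_derivative_at[OF f'(1)] by simp
  moreover have "f differentiable_on UNIV"
    using f'(1) by (auto simp: differentiable_on_def differentiable_def)
  ultimately show ?case using Suc.IH[OF f'(2)] by simp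
qed

definition radial_bump :: "real \<Rightarrow> 'a::euclidean_space \<Rightarrow> real" where
  "radial_bump \<epsilon> z = exp_bump 0 (\<epsilon>\<^sup>2 - (norm z)\<^sup>2)"

lemma radial_bump_pos_iff: "0 < \<epsilon> \<Longrightarrow> 0 < radial_bump \<epsilon> z \<longleftrightarrow> norm z < \<epsilon>"
  by (auto simp: radial_bump_def exp_bump_def power_strict_mono dest: power2_less_imp_less)

lemma radial_bump_nonneg[simp]: "0 \<le> radial_bump \<epsilon> z"
  by (simp add: radial_bump_def exp_bump_def)

lemma radial_bump_le_1: "radial_bump \<epsilon> z \<le> 1"
  by (simp add: radial_bump_def exp_bump_def)

lemma radial_bump_eq_0: "0 < \<epsilon> \<Longrightarrow> \<epsilon> \<le> norm z \<Longrightarrow> radial_bump \<epsilon> z = 0"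
  using radial_bump_pos_iff[of \<epsilon> z] radial_bump_nonneg[of \<epsilon> z] by linarith

lemma radial_bump_Cc_infinity:
  assumes e: "0 < \<epsilon>" and sub: "cball a \<epsilon> \<subseteq> \<Omega>"
  shows "(\<lambda>x. radial_bump \<epsilon> (x - a)) \<in> Cc_infinity \<Omega>"
proof -
  have "{x. radial_bump \<epsilon> (x - a) \<noteq> 0} = ball a \<epsilon>"
  proof (intro set_eqI)
    fix x
    show "x \<in> {x. radial_bump \<epsilon> (x - a) \<noteq> 0} \<longleftrightarrow> x \<in> ball a \<epsilon>"
      unfolding mem_Collect_eq mem_ball dist_norm norm_minus_commute[of a x]
      using radial_bump_pos_iff[OF e, of "x - a"] radial_bump_nonneg[of \<epsilon> "x - a"]
      by linarith
  qed
  then have "closure {x. radial_bump \<epsilon> (x - a) \<noteq> 0} = cball a \<epsilon>"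
    using e by simp
  moreover have "Ck k (\<lambda>x. radial_bump \<epsilon> (x - a))" for k
    unfolding radial_bump_def by (rule bump_span_Ck[OF bump_span.bump])
  ultimately show ?thesis using sub compact_cball[of a \<epsilon>] unfolding Cc_infinity_def mem_Collect_eq by metis
qed

lemma exp_bump_0_lipschitz: "\<bar>exp_bump 0 p - exp_bump 0 q\<bar> \<le> 2 * \<bar>p - q\<bar>"
proof -
  have b: "\<bar>exp_bump 2 t\<bar> \<le> 2" for t
  proof (cases "0 < t")
    case True
    have "(1 / t)\<^sup>2 / 2 \<le> 1 + 1 / t + (1 / t)\<^sup>2 / 2" using True by simp
    also have "\<dots> \<le> exp (1 / t)" using True by (intro exp_lower_Taylor_quadratic) auto
    finally have "(1 / t)\<^sup>2 \<le> 2 * exp (1 / t)" by simp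
    then have "(1 / t)\<^sup>2 * exp (- (1 / t)) \<le> 2 * exp (1 / t) * exp (- (1 / t))"
      by (intro mult_right_mono) auto
    also have "\<dots> = 2" by (simp add: exp_minus)
    finally have "(1 / t)\<^sup>2 * exp (- (1 / t)) \<le> 2" .
    then show ?thesis using True by (simp add: exp_bump_def power_divide)
  qed (simp add: exp_bump_def)
  have "norm (exp_bump 0 p - exp_bump 0 q) \<le> 2 * norm (p - q)"
  proof (rule field_differentiable_bound)
    show "(exp_bump 0 has_field_derivative exp_bump 2 t) (at t within UNIV)" for t
      using DERIV_exp_bump[of 0 t] by (simp add: numeral_2_eq_2)
  qed (use b in auto)
  then show ?thesis by simp
qed

lemma radial_bump_lipschitz:
  assumes e: "0 < \<epsilon>"
  shows "\<bar>radial_bump \<epsilon> x - radial_bump \<epsilon> y\<bar> \<le> 4 * \<epsilon> * norm (x - y)"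
proof -
  have mx: "radial_bump \<epsilon> z = exp_bump 0 (\<epsilon>\<^sup>2 - (min \<epsilon> (norm z))\<^sup>2)" for z :: 'a
    by (cases "norm z \<le> \<epsilon>") (use e power_strict_mono[of \<epsilon> "norm z" 2] in \<open>auto simp: radial_bump_def exp_bump_def min_def\<close>)
  define p q where "p = min \<epsilon> (norm x)" and "q = min \<epsilon> (norm y)"
  have "\<bar>radial_bump \<epsilon> x - radial_bump \<epsilon> y\<bar> \<le> 2 * \<bar>(\<epsilon>\<^sup>2 - p\<^sup>2) - (\<epsilon>\<^sup>2 - q\<^sup>2)\<bar>"
    unfolding mx p_def q_def by (rule exp_bump_0_lipschitz)
  also have "(\<epsilon>\<^sup>2 - p\<^sup>2) - (\<epsilon>\<^sup>2 - q\<^sup>2) = (q + p) * (q - p)"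
    by (simp add: power2_eq_square algebra_simps)
  also have "2 * \<bar>(q + p) * (q - p)\<bar> = 2 * ((q + p) * \<bar>q - p\<bar>)"
    using e by (simp add: abs_mult p_def q_def)
  also have "\<dots> \<le> 2 * ((2 * \<epsilon>) * norm (x - y))"
  proof (intro mult_left_mono mult_mono)
    show "\<bar>q - p\<bar> \<le> norm (x - y)"
      using norm_triangle_ineq3[of x y] unfolding p_def q_def by linarith
  qed (use e in \<open>auto simp: p_def q_def\<close>)
  finally show ?thesis by simp
qed

lemma radial_bump_measurable[measurable]: "radial_bump \<epsilon> \<in> borel_measurable borel"
  unfolding radial_bump_def exp_bump_def by measurable

lemma integrable_radial_bump: "0 < \<epsilon> \<Longrightarrow> integrable lborel (radial_bump \<epsilon> :: 'a::euclidean_space \<Rightarrow> real)"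
proof (rule Bochner_Integration.integrable_bound)
  show "integrable lborel (indicat_real (cball (0::'a) \<epsilon>))"
    using emeasure_bounded_finite[OF bounded_cball, of "0::'a" \<epsilon>] by (simp add: less_top[symmetric])
  assume "0 < \<epsilon>"
  then have "norm (radial_bump \<epsilon> z) \<le> norm (indicat_real (cball (0::'a) \<epsilon>) z)" for z
    using radial_bump_eq_0[of \<epsilon> z] radial_bump_le_1[of \<epsilon> z] by (cases "norm z \<le> \<epsilon>") auto
  then show "AE z in lborel. norm (radial_bump \<epsilon> z) \<le> norm (indicat_real (cball (0::'a) \<epsilon>) z)"
    by (rule AE_I2)
qed simp

lemma integral_radial_bump_pos: "0 < \<epsilon> \<Longrightarrow> 0 < (LINT z|lborel. radial_bump \<epsilon> (z::'a::euclidean_space))"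
proof -
  assume e: "0 < \<epsilon>"
  define c where "c = exp_bump 0 (\<epsilon>\<^sup>2 - (\<epsilon> / 2)\<^sup>2)"
  have c: "0 < c" using e by (simp add: c_def exp_bump_def power_divide)
  have fin: "emeasure lborel (ball (0::'a) (\<epsilon> / 2)) < \<infinity>"
    by (intro emeasure_bounded_finite bounded_ball)
  have "0 < c * measure lborel (ball (0::'a) (\<epsilon> / 2))"
    using c e content_ball_pos[of "\<epsilon> / 2" "0::'a"] by simp
  also have "\<dots> = (LINT z|lborel. c * indicator (ball (0::'a) (\<epsilon> / 2)) z)"
    by simp
  also have "\<dots> \<le> (LINT z|lborel. radial_bump \<epsilon> (z::'a))"
  proof (rule integral_mono)
    show "integrable lborel (\<lambda>z. c * indicator (ball (0::'a) (\<epsilon> / 2)) z)"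
      using fin by simp
    show "integrable lborel (radial_bump \<epsilon> :: 'a \<Rightarrow> real)" by (rule integrable_radial_bump[OF e])
    fix z :: 'a
    show "c * indicator (ball (0::'a) (\<epsilon> / 2)) z \<le> radial_bump \<epsilon> z"
    proof (cases "norm z < \<epsilon> / 2")
      case True
      define p q where "p = \<epsilon>\<^sup>2 - (\<epsilon> / 2)\<^sup>2" and "q = \<epsilon>\<^sup>2 - (norm z)\<^sup>2"
      have "(norm z)\<^sup>2 \<le> (\<epsilon> / 2)\<^sup>2" using True by (intro power_mono) auto
      then have "p \<le> q" by (simp add: p_def q_def)
      moreover have "0 < p" using e unfolding p_def by (simp add: power_divide)
      ultimately have "1 / q \<le> 1 / p" "0 < q" by (auto intro: divide_left_mono)
      then have "exp_bump 0 p \<le> exp_bump 0 q" using \<open>0 < p\<close> by (simp add: exp_bump_def)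
      moreover have "z \<in> ball 0 (\<epsilon> / 2)" using True by simp
      ultimately show ?thesis unfolding c_def radial_bump_def p_def q_def by (simp only: indicator_simps mult_1_right)
    qed simp
  qed
  finally show ?thesis .
qed

section \<open>Lipschitz functions of compact support\<close>

lemma nn_integral_lborel_reflect:
  fixes f :: "'a::euclidean_space \<Rightarrow> ennreal"
  assumes [measurable]: "f \<in> borel_measurable borel"
  shows "(\<integral>\<^sup>+y. f (t - y) \<partial>lborel) = (\<integral>\<^sup>+y. f y \<partial>lborel)"
proof -
  have d: "lborel = density (distr lborel borel (\<lambda>x. t - x)) (\<lambda>_. 1)"
    using lborel_affine[of "-1" t] by simp
  have "(\<integral>\<^sup>+y. f y \<partial>lborel) = (\<integral>\<^sup>+y. f y \<partial>density (distr lborel borel (\<lambda>x. t - x)) (\<lambda>_. 1))"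
    using arg_cong[OF d, of "\<lambda>M. integral\<^sup>N M f"] .
  also have "\<dots> = (\<integral>\<^sup>+y. f (t - y) \<partial>lborel)"
    by (simp add: nn_integral_density nn_integral_distr)
  finally show ?thesis by simp
qed

lemma nn_integral_lborel_translate:
  fixes f :: "'a::euclidean_space \<Rightarrow> ennreal"
  assumes [measurable]: "f \<in> borel_measurable borel"
  shows "(\<integral>\<^sup>+y. f (t + y) \<partial>lborel) = (\<integral>\<^sup>+y. f y \<partial>lborel)"
proof -
  have d: "lborel = density (distr lborel borel (\<lambda>x. t + x)) (\<lambda>_. 1)"
    using lborel_affine[of 1 t] by simp
  have "(\<integral>\<^sup>+y. f y \<partial>lborel) = (\<integral>\<^sup>+y. f y \<partial>density (distr lborel borel (\<lambda>x. t + x)) (\<lambda>_. 1))"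
    using arg_cong[OF d, of "\<lambda>M. integral\<^sup>N M f"] .
  also have "\<dots> = (\<integral>\<^sup>+y. f (t + y) \<partial>lborel)"
    by (simp add: nn_integral_density nn_integral_distr)
  finally show ?thesis by simp
qed

lemma gagliardo_integrand_eq:
  "gagliardo_integrand s u v = (\<lambda>(x, y). (u x - u y) * (v x - v y) * fractional_kernel s (x - y))"
  unfolding gagliardo_integrand_def fractional_kernel_def powr_minus_divide by (simp add: fun_eq_iff)

lemma gagliardo_integrand_measurable[measurable]:
  fixes u v :: "'a::euclidean_space \<Rightarrow> real"
  assumes [measurable]: "u \<in> borel_measurable borel" "v \<in> borel_measurable borel"
  shows "gagliardo_integrand s u v \<in> borel_measurable (lborel \<Otimes>\<^sub>M lborel)"
  unfolding gagliardo_integrand_eq by measurable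

text \<open>The factor \<open>min 1 ((norm h)\<^sup>2)\<close> tames the singularity at the origin since \<open>s < 1\<close>; the decay at infinity suffices since
\<open>s > 0\<close>.\<close>

lemma nn_integral_truncated_kernel_finite:
  assumes s: "0 < s" "s < 1"
  shows "(\<integral>\<^sup>+h. ennreal (min 1 ((norm (h::'a::euclidean_space))\<^sup>2) * fractional_kernel s h) \<partial>lborel) < \<infinity>"
proof -
  let ?N = "real DIM('a)"
  let ?S = "{k::'a. 1 \<le> norm k \<and> norm k \<le> 2}"
  let ?f = "\<lambda>h::'a. min 1 ((norm h)\<^sup>2) * fractional_kernel s h"
  let ?b = "\<lambda>l::real. 4 * (l powr (1 - 2 * s) * indicator {0..1} l) + l powr (- 1 - 2 * s) * indicator {1..} l"
  have bi: "integrable lborel ?b"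
    using has_bochner_integral_powr_from_0[where a = "1 - 2 * s" and c = 1]
      has_bochner_integral_powr_to_inf[where e = "- 1 - 2 * s" and c = 1] s
    by (intro Bochner_Integration.integrable_add integrable_mult_right) (auto simp: has_bochner_integral_iff)
  define A where "A = (\<integral>\<^sup>+l. ennreal (?b l) \<partial>lborel)"
  have A: "A < \<infinity>"
    using bi unfolding A_def by (simp add: real_integrable_def less_top)
  have le: "(\<integral>\<^sup>+l. indicator {0<..} l * ennreal (l powr (?N - 1)) * ennreal (?f (l *\<^sub>R k)) \<partial>lborel) \<le> A" if k: "k \<in> ?S" for k
    unfolding A_def
  proof (rule nn_integral_mono)
    fix l :: real
    show "indicator {0<..} l * ennreal (l powr (?N - 1)) * ennreal (?f (l *\<^sub>R k)) \<le> ennreal (?b l)"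
    proof (cases "0 < l")
      case True
      have k0: "k \<noteq> 0" using k by auto
      have "norm k powr (- (?N + 2 * s)) \<le> norm k powr 0" using k s by (intro powr_mono) auto
      then have k1: "norm k powr (- (?N + 2 * s)) \<le> 1" using k0 by simp
      have "(norm k)\<^sup>2 \<le> 2\<^sup>2" using k by (intro power_mono) auto
      then have k2: "(norm k)\<^sup>2 \<le> 4" by simp
      have m: "min 1 ((norm (l *\<^sub>R k))\<^sup>2) \<le> (if l < 1 then 4 * l\<^sup>2 else 1)"
        using k2 mult_left_mono[OF k2, of "l\<^sup>2"] by (simp add: power_mult_distrib min_le_iff_disj)
      have ll: "l powr (?N - 1) * l powr (- (?N + 2 * s)) = l powr (- 1 - 2 * s)"
        by (subst powr_add[symmetric]) (simp add: algebra_simps)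
      have l2: "l\<^sup>2 * l powr (- 1 - 2 * s) = l powr (1 - 2 * s)"
      proof -
        have "l\<^sup>2 * l powr (- 1 - 2 * s) = l powr 2 * l powr (- 1 - 2 * s)" using True by simp
        also have "\<dots> = l powr (1 - 2 * s)" by (subst powr_add[symmetric]) simp
        finally show ?thesis .
      qed
      have "l powr (?N - 1) * ?f (l *\<^sub>R k) = min 1 ((norm (l *\<^sub>R k))\<^sup>2) * (l powr (?N - 1) * l powr (- (?N + 2 * s))) * norm k powr (- (?N + 2 * s))"
        using True by (simp add: fractional_kernel_def powr_mult)
      also have "\<dots> \<le> (if l < 1 then 4 * l\<^sup>2 else 1) * l powr (- 1 - 2 * s) * 1"
        unfolding ll using m k1 by (intro mult_mono) auto
      also have "\<dots> \<le> ?b l"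
        using True l2 by (auto simp: indicator_def)
      finally have "ennreal (l powr (?N - 1) * ?f (l *\<^sub>R k)) \<le> ennreal (?b l)" by (rule ennreal_leI)
      then show ?thesis using True by (simp add: ennreal_mult')
    qed simp
  qed
  have "ennreal (ln 2) * (\<integral>\<^sup>+h. ennreal (?f h) \<partial>lborel) = 
    (\<integral>\<^sup>+k. indicator ?S k * (\<integral>\<^sup>+l. indicator {0<..} l * ennreal (l powr (?N - 1)) * ennreal (?f (l *\<^sub>R k)) \<partial>lborel) \<partial>lborel)"
    by (rule nn_integral_fat_polar) measurable
  also have "\<dots> \<le> (\<integral>\<^sup>+k. A * indicator (cball (0::'a) 2) k \<partial>lborel)"
  proof (rule nn_integral_mono)
    fix k :: 'a
    show "indicator ?S k * (\<integral>\<^sup>+l. indicator {0<..} l * ennreal (l powr (?N - 1)) * ennreal (?f (l *\<^sub>R k)) \<partial>lborel) \<le> A * indicator (cball 0 2) k"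
    proof (cases "k \<in> ?S")
      case True
      then have "indicator ?S k = (1::ennreal)" "indicator (cball 0 2) k = (1::ennreal)" by auto
      then show ?thesis using le[OF True] by (simp only: mult_1_left mult_1_right)
    next
      case False
      then have "indicator ?S k = (0::ennreal)" by (rule indicator_simps)
      then show ?thesis by (simp only: mult_zero_left zero_le)
    qed
  qed
  also have "\<dots> = A * emeasure lborel (cball (0::'a) 2)"
    by (rule nn_integral_cmult_indicator) simp
  also have "\<dots> < \<infinity>"
    using A emeasure_bounded_finite[OF bounded_cball, of "0::'a" 2] by (simp add: ennreal_mult_less_top)
  finally show ?thesis
    by (auto simp: ennreal_mult_less_top)
qed

lemma integrable_gagliardo_lipschitz:
  fixes f :: "'a::euclidean_space \<Rightarrow> real"
  assumes s: "0 < s" "s < 1" and [measurable]: "f \<in> borel_measurable borel"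
    and L: "\<And>x y. \<bar>f x - f y\<bar> \<le> L * norm (x - y)" and B: "\<And>x. \<bar>f x\<bar> \<le> B"
    and supp: "\<And>x. x \<notin> cball a \<rho> \<Longrightarrow> f x = 0"
  shows "integrable (lborel \<Otimes>\<^sub>M lborel) (gagliardo_integrand s f f)"
proof -
  \<comment> \<open>The Lipschitz bound is used for close points, boundedness for distant ones.\<close>
  define M where "M = max (L\<^sup>2) ((2 * B)\<^sup>2)"
  have M: "0 \<le> M" by (simp add: M_def le_max_iff_disj)
  let ?\<kappa> = "\<lambda>h::'a. ennreal (min 1 ((norm h)\<^sup>2) * fractional_kernel s h)"
  let ?K = "cball a \<rho>"
  define A where "A = (\<integral>\<^sup>+h. ?\<kappa> h \<partial>lborel)"
  have A: "A < \<infinity>" unfolding A_def by (rule nn_integral_truncated_kernel_finite[OF s])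
  have [measurable]: "?K \<in> sets borel" by simp
  have le: "(f x - f y)\<^sup>2 \<le> M * min 1 ((norm (x - y))\<^sup>2)" for x y
  proof -
    have "\<bar>f x - f y\<bar>\<^sup>2 \<le> (L * norm (x - y))\<^sup>2" by (intro power_mono L) auto
    also have "\<dots> \<le> M * (norm (x - y))\<^sup>2"
      unfolding power_mult_distrib M_def by (intro mult_right_mono) auto
    finally have 1: "(f x - f y)\<^sup>2 \<le> M * (norm (x - y))\<^sup>2" by simp
    have "\<bar>f x - f y\<bar> \<le> 2 * B" using B[of x] B[of y] by linarith
    then have "\<bar>f x - f y\<bar>\<^sup>2 \<le> (2 * B)\<^sup>2" by (intro power_mono) auto
    also have "\<dots> \<le> M" by (simp add: M_def)
    finally have 2: "(f x - f y)\<^sup>2 \<le> M" by simp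
    show ?thesis using 1 2 by (simp add: min_def)
  qed
  have bound: "ennreal (norm (gagliardo_integrand s f f (x, y))) \<le> ennreal M * (indicator ?K x * ?\<kappa> (x - y) + indicator ?K y * ?\<kappa> (x - y))" for x y
  proof (cases "x \<in> ?K \<or> y \<in> ?K")
    case True
    have "norm (gagliardo_integrand s f f (x, y)) = (f x - f y)\<^sup>2 * fractional_kernel s (x - y)"
      by (simp add: gagliardo_integrand_eq power2_eq_square abs_mult)
    also have "\<dots> \<le> (M * min 1 ((norm (x - y))\<^sup>2)) * fractional_kernel s (x - y)"
      by (intro mult_right_mono le) auto
    finally have "ennreal (norm (gagliardo_integrand s f f (x, y))) \<le> ennreal M * ?\<kappa> (x - y)"
      using M by (simp add: ennreal_mult'[symmetric] mult.assoc ennreal_leI)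
    also have "\<dots> \<le> ennreal M * (indicator ?K x * ?\<kappa> (x - y) + indicator ?K y * ?\<kappa> (x - y))"
      using True by (intro mult_left_mono) (auto simp: indicator_def)
    finally show ?thesis .
  next
    case False
    then show ?thesis using supp[of x] supp[of y] by (simp add: gagliardo_integrand_eq)
  qed
  have inner: "(\<integral>\<^sup>+y. ?\<kappa> (x - y) \<partial>lborel) = A" for x
    unfolding A_def by (rule nn_integral_lborel_reflect) measurable
  have inner': "(\<integral>\<^sup>+x. ?\<kappa> (x - y) \<partial>lborel) = A" for y
    using nn_integral_lborel_translate[of ?\<kappa> "- y"] unfolding A_def by simp
  have "(\<integral>\<^sup>+z. ennreal (norm (gagliardo_integrand s f f z)) \<partial>(lborel \<Otimes>\<^sub>M lborel))
    = (\<integral>\<^sup>+x. \<integral>\<^sup>+y. ennreal (norm (gagliardo_integrand s f f (x, y))) \<partial>lborel \<partial>lborel)"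
    by (rule lborel.nn_integral_fst[symmetric]) measurable
  also have "\<dots> \<le> (\<integral>\<^sup>+x. \<integral>\<^sup>+y. ennreal M * (indicator ?K x * ?\<kappa> (x - y) + indicator ?K y * ?\<kappa> (x - y)) \<partial>lborel \<partial>lborel)"
    by (intro nn_integral_mono bound)
  also have "\<dots> = ennreal M * ((\<integral>\<^sup>+x. \<integral>\<^sup>+y. indicator ?K x * ?\<kappa> (x - y) \<partial>lborel \<partial>lborel) + (\<integral>\<^sup>+x. \<integral>\<^sup>+y. indicator ?K y * ?\<kappa> (x - y) \<partial>lborel \<partial>lborel))"
    by (simp add: nn_integral_add nn_integral_cmult)
  also have "(\<integral>\<^sup>+x. \<integral>\<^sup>+y. indicator ?K x * ?\<kappa> (x - y) \<partial>lborel \<partial>lborel) = (\<integral>\<^sup>+x. indicator ?K x * A \<partial>lborel)"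
    by (simp add: nn_integral_cmult inner)
  also have "(\<integral>\<^sup>+x. \<integral>\<^sup>+y. indicator ?K y * ?\<kappa> (x - y) \<partial>lborel \<partial>lborel) = (\<integral>\<^sup>+y. \<integral>\<^sup>+x. indicator ?K y * ?\<kappa> (x - y) \<partial>lborel \<partial>lborel)"
    by (rule lborel_pair.Fubini'[symmetric]) measurable
  also have "\<dots> = (\<integral>\<^sup>+y. indicator ?K y * A \<partial>lborel)"
    by (simp add: nn_integral_cmult inner')
  also have "(\<integral>\<^sup>+y. indicator ?K y * A \<partial>lborel) = A * emeasure lborel ?K"
    by (simp add: mult.commute nn_integral_cmult_indicator)
  also have "ennreal M * (A * emeasure lborel ?K + A * emeasure lborel ?K) < \<infinity>"
    using A emeasure_bounded_finite[OF bounded_cball, of a \<rho>] by (simp add: ennreal_mult_less_top)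
  finally show ?thesis
    by (intro integrableI_bounded) measurable
qed

lemma integrable_lebesgue_iff_lborel:
  fixes f :: "'a::euclidean_space \<Rightarrow> real"
  assumes "f \<in> borel_measurable borel"
  shows "integrable lebesgue f \<longleftrightarrow> integrable lborel f"
  using assms by (intro integrable_completion) simp

text \<open>Being smooth with support inside \<open>\<Omega>\<close>, the bump approximates itself in the definition of \<open>Hs0\<close>, so only the finiteness of its norms
has to be checked.\<close>

lemma radial_bump_Hs0:
  assumes s: "0 < s" "s < 1" and e: "0 < \<epsilon>" and sub: "cball a \<epsilon> \<subseteq> \<Omega>"
  shows "(\<lambda>x. radial_bump \<epsilon> (x - a)) \<in> Hs0 s \<Omega>"
    and "integrable (lborel \<Otimes>\<^sub>M lborel) (gagliardo_integrand s (\<lambda>x. radial_bump \<epsilon> (x - a)) (\<lambda>x. radial_bump \<epsilon> (x - a)))"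
proof -
  let ?\<zeta> = "\<lambda>x. radial_bump \<epsilon> (x - a)"
  have m[measurable]: "?\<zeta> \<in> borel_measurable borel" by measurable
  have out: "?\<zeta> x = 0" if "x \<notin> cball a \<epsilon>" for x
    using that e radial_bump_eq_0[OF e, of "x - a"] by (simp add: dist_norm norm_minus_commute)
  have lip: "\<bar>?\<zeta> x - ?\<zeta> y\<bar> \<le> 4 * \<epsilon> * norm (x - y)" for x y
    using radial_bump_lipschitz[OF e, of "x - a" "y - a"] by simp
  show gi: "integrable (lborel \<Otimes>\<^sub>M lborel) (gagliardo_integrand s ?\<zeta> ?\<zeta>)"
    by (rule integrable_gagliardo_lipschitz[OF s m lip _ out, where B = 1]) (use radial_bump_le_1[of \<epsilon>] in auto)
  then have g: "integrable lebesgue (gagliardo_integrand s ?\<zeta> ?\<zeta>)"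
    by (subst integrable_lebesgue_iff_lborel) (auto simp: lborel_prod dest: borel_measurable_integrable)
  have "integrable lborel (\<lambda>x. (?\<zeta> x)\<^sup>2)"
  proof (rule Bochner_Integration.integrable_bound)
    show "integrable lborel (indicat_real (cball a \<epsilon>))"
      using emeasure_bounded_finite[OF bounded_cball, of a \<epsilon>] by (simp add: less_top[symmetric])
    have "norm ((?\<zeta> x)\<^sup>2) \<le> norm (indicat_real (cball a \<epsilon>) x)" for x
      using out[of x] radial_bump_le_1[of \<epsilon> "x - a"] by (cases "x \<in> cball a \<epsilon>") (auto simp: power_le_one)
    then show "AE x in lborel. norm ((?\<zeta> x)\<^sup>2) \<le> norm (indicat_real (cball a \<epsilon>) x)" by (rule AE_I2)
  qed measurable
  then have "integrable lebesgue (\<lambda>x. (?\<zeta> x)\<^sup>2)"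
    by (subst integrable_lebesgue_iff_lborel) auto
  then have Hs: "?\<zeta> \<in> Hs s"
    using g measurable_completion[of ?\<zeta> lborel borel] by (auto simp: Hs_def)
  have "gagliardo_integrand s (\<lambda>x::'a. 0) (\<lambda>x. 0) = (\<lambda>z. 0)"
    by (simp add: gagliardo_integrand_eq fun_eq_iff)
  then have "gagliardo_seminorm s (\<lambda>x. ?\<zeta> x - ?\<zeta> x) = 0"
    by (simp add: gagliardo_seminorm_def gagliardo_form_def)
  then have "\<forall>\<eta>>0. \<exists>\<phi>\<in>Cc_infinity \<Omega>. gagliardo_seminorm s (\<lambda>x. ?\<zeta> x - \<phi> x) < \<eta>"
    using radial_bump_Cc_infinity[OF e sub] by (auto intro!: bexI[of _ ?\<zeta>])
  moreover have "?\<zeta> x = 0" if "x \<notin> \<Omega>" for x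
    by (rule out) (use sub that in blast)
  then have "AE x in lebesgue. x \<notin> \<Omega> \<longrightarrow> ?\<zeta> x = 0"
    by simp
  ultimately show "?\<zeta> \<in> Hs0 s \<Omega>"
    using Hs by (simp add: Hs0_def)
qed

section \<open>Testing with translates of a bump\<close>

lemma integrable_lborel_translate:
  fixes f :: "'a::euclidean_space \<Rightarrow> real"
  assumes f: "integrable lborel f"
  shows "integrable lborel (\<lambda>x. f (x + c))" and "(LINT x|lborel. f (x + c)) = (LINT x|lborel. f x)"
proof -
  have [measurable]: "f \<in> borel_measurable borel"
    using borel_measurable_integrable[OF f] by simp
  have d: "distr lborel borel (\<lambda>x. x + c) = lborel"
    using lborel_distr_plus[of c] by (simp add: add.commute[of _ c])
  have "integrable (distr lborel borel (\<lambda>x. x + c)) f"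
    unfolding d by (rule f)
  then show "integrable lborel (\<lambda>x. f (x + c))"
    by (subst (asm) integrable_distr_eq) auto
  have "(LINT x|lborel. f x) = (LINT x|distr lborel borel (\<lambda>x. x + c). f x)"
    unfolding d ..
  also have "\<dots> = (LINT x|lborel. f (x + c))"
    by (intro integral_distr) auto
  finally show "(LINT x|lborel. f (x + c)) = (LINT x|lborel. f x)" ..
qed

lemma distr_lborel_pair_shear:
  "distr (lborel \<Otimes>\<^sub>M lborel) (lborel \<Otimes>\<^sub>M lborel) (\<lambda>(x, h). (x, x + h)) = (lborel \<Otimes>\<^sub>M lborel :: ('a::euclidean_space \<times> 'a) measure)"
proof (rule measure_eqI)
  let ?P = "lborel \<Otimes>\<^sub>M lborel :: ('a \<times> 'a) measure"
  let ?T = "\<lambda>(x, h). (x, x + h) :: 'a \<times> 'a"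
  fix A assume A: "A \<in> sets (distr ?P ?P ?T)"
  have T: "?T \<in> ?P \<rightarrow>\<^sub>M ?P" by measurable
  define f where "f = (indicator A :: 'a \<times> 'a \<Rightarrow> ennreal)"
  have f: "f \<in> borel_measurable ?P"
    unfolding f_def using A by (intro borel_measurable_indicator) (simp only: sets_distr)
  have fT: "(\<lambda>z. f (?T z)) \<in> borel_measurable ?P"
    by (rule measurable_compose[OF T f])
  have "emeasure (distr ?P ?P ?T) A = (\<integral>\<^sup>+z. f z \<partial>distr ?P ?P ?T)"
    unfolding f_def by (rule nn_integral_indicator[OF A, symmetric])
  also have "\<dots> = (\<integral>\<^sup>+z. f (?T z) \<partial>?P)"
    by (rule nn_integral_distr[OF T]) (simp only: measurable_distr_eq1 f)
  also have "\<dots> = (\<integral>\<^sup>+x. \<integral>\<^sup>+h. f (?T (x, h)) \<partial>lborel \<partial>lborel)"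
    by (rule lborel.nn_integral_fst[OF fT, symmetric])
  also have "\<dots> = (\<integral>\<^sup>+x. \<integral>\<^sup>+y. f (x, y) \<partial>lborel \<partial>lborel)"
  proof (rule nn_integral_cong)
    fix x :: 'a
    have "(\<lambda>y. f (x, y)) \<in> borel_measurable lborel"
      by (rule measurable_compose[OF measurable_Pair1' f]) simp
    then have "(\<integral>\<^sup>+h. f (x, x + h) \<partial>lborel) = (\<integral>\<^sup>+y. f (x, y) \<partial>lborel)"
      by (intro nn_integral_lborel_translate[of "\<lambda>y. f (x, y)"]) simp
    then show "(\<integral>\<^sup>+h. f (?T (x, h)) \<partial>lborel) = (\<integral>\<^sup>+y. f (x, y) \<partial>lborel)" by simp
  qed
  also have "\<dots> = (\<integral>\<^sup>+z. f z \<partial>?P)"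
    by (rule lborel.nn_integral_fst[OF f])
  also have "\<dots> = emeasure ?P A"
    unfolding f_def using A by (intro nn_integral_indicator) (simp only: sets_distr)
  finally show "emeasure (distr ?P ?P ?T) A = emeasure ?P A" .
qed (rule sets_distr)

text \<open>Testing with translates of one function turns the bilinear form into the pointwise fractional Laplacian of a
mollification: substitute \<open>y = x + h\<close>, integrate over \<open>x\<close> first, and recognize each of the four products as a value of
\<open>v\<close>.\<close>

lemma gagliardo_form_mollified:
  fixes w \<zeta> :: "'a::euclidean_space \<Rightarrow> real"
  assumes w: "integrable lborel w"
    and \<zeta>m[measurable]: "\<zeta> \<in> borel_measurable borel" and \<zeta>: "\<And>z. \<bar>\<zeta> z\<bar> \<le> B"
    and F: "integrable (lborel \<Otimes>\<^sub>M lborel) (gagliardo_integrand s w (\<lambda>x. \<zeta> (x - a)))"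
  defines "v \<equiv> \<lambda>p. LINT x|lborel. w x * \<zeta> (x - p)"
  shows "integrable lborel (\<lambda>h. second_difference v a h * fractional_kernel s h)"
    and "(LINT h|lborel. second_difference v a h * fractional_kernel s h) = integral\<^sup>L (lborel \<Otimes>\<^sub>M lborel) (gagliardo_integrand s w (\<lambda>x. \<zeta> (x - a)))"
proof -
  let ?P = "lborel \<Otimes>\<^sub>M lborel :: ('a \<times> 'a) measure"
  let ?T = "\<lambda>(x, h). (x, x + h) :: 'a \<times> 'a"
  let ?F = "gagliardo_integrand s w (\<lambda>x. \<zeta> (x - a))"
  have [measurable]: "w \<in> borel_measurable borel"
    using borel_measurable_integrable[OF w] by simp
  have T[measurable]: "?T \<in> ?P \<rightarrow>\<^sub>M ?P" by measurable
  have Fm: "?F \<in> borel_measurable ?P" by measurable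
  let ?G = "\<lambda>x h. ?F (x, x + h)"
  have FT: "(\<lambda>z. ?F (?T z)) = (\<lambda>(x, h). ?G x h)" by (simp add: fun_eq_iff)
  have GI: "integrable ?P (\<lambda>(x, h). ?G x h)"
    using F integrable_distr_eq[OF T Fm] unfolding distr_lborel_pair_shear FT by simp
  have GE: "integral\<^sup>L ?P (\<lambda>(x, h). ?G x h) = integral\<^sup>L ?P ?F"
    using integral_distr[OF T Fm] unfolding distr_lborel_pair_shear FT by simp
  have prod: "integrable lborel (\<lambda>x. w x * \<zeta> (x - p))" for p
  proof (rule Bochner_Integration.integrable_bound)
    show "integrable lborel (\<lambda>x. B * w x)" using w by simp
    have "\<bar>w x * \<zeta> (x - p)\<bar> \<le> \<bar>w x\<bar> * \<bar>B\<bar>" for x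
      unfolding abs_mult using \<zeta>[of "x - p"] by (intro mult_left_mono) auto
    then show "AE x in lborel. norm (w x * \<zeta> (x - p)) \<le> norm (B * w x)"
      by (intro AE_I2) (simp add: abs_mult mult.commute)
  qed measurable
  have shifted: "integrable lborel (\<lambda>x. w (x + h) * \<zeta> (x + h - p))" "(LINT x|lborel. w (x + h) * \<zeta> (x + h - p)) = v p" for h p
    using integrable_lborel_translate[OF prod[of p], of h] by (simp_all add: v_def)
  have inner: "(LINT x|lborel. ?G x h) = second_difference v a h * fractional_kernel s h" for h
  proof -
    have "(LINT x|lborel. ?G x h) = (LINT x|lborel. (w x * \<zeta> (x - a) - w x * \<zeta> (x - (a - h)) - w (x + h) * \<zeta> (x + h - (a + h)) + w (x + h) * \<zeta> (x + h - a)) * fractional_kernel s h)"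
    proof (rule Bochner_Integration.integral_cong[OF refl])
      fix x
      have "fractional_kernel s (x - (x + h)) = fractional_kernel s h" by (simp add: fractional_kernel_def)
      moreover have "x - (a - h) = x + h - a" "x + h - (a + h) = x - a" by (simp_all add: algebra_simps)
      ultimately show "?G x h = (w x * \<zeta> (x - a) - w x * \<zeta> (x - (a - h)) - w (x + h) * \<zeta> (x + h - (a + h)) + w (x + h) * \<zeta> (x + h - a)) * fractional_kernel s h"
        by (simp add: gagliardo_integrand_eq algebra_simps)
    qed
    also have "\<dots> = (LINT x|lborel. w x * \<zeta> (x - a) - w x * \<zeta> (x - (a - h)) - w (x + h) * \<zeta> (x + h - (a + h)) + w (x + h) * \<zeta> (x + h - a)) * fractional_kernel s h"
      by (rule integral_mult_left_zero)
    also have "(LINT x|lborel. w x * \<zeta> (x - a) - w x * \<zeta> (x - (a - h)) - w (x + h) * \<zeta> (x + h - (a + h)) + w (x + h) * \<zeta> (x + h - a))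
      = v a - v (a - h) - v (a + h) + v a"
      using prod[of a] prod[of "a - h"] shifted[of h "a + h"] shifted[of h a]
      by (simp only: Bochner_Integration.integral_add Bochner_Integration.integral_diff Bochner_Integration.integrable_add Bochner_Integration.integrable_diff v_def)
    finally show ?thesis by (simp add: second_difference_def algebra_simps)
  qed
  show "integrable lborel (\<lambda>h. second_difference v a h * fractional_kernel s h)"
    using lborel_pair.integrable_snd[OF GI] unfolding inner .
  show "(LINT h|lborel. second_difference v a h * fractional_kernel s h) = integral\<^sup>L ?P ?F"
    using lborel_pair.integral_snd[OF GI] unfolding inner GE .
qed

text \<open>Where \<open>\<zeta>\<close> vanishes, deleting \<open>u\<close> changes the form only through products of values of \<open>u\<close> and \<open>\<zeta>\<close> at different
points. They appear twice by symmetry and with a positive sign: the deleted mass of \<open>u\<close> becomes a source term for what is left.\<close>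

lemma gagliardo_form_remove_far_part:
  fixes u \<zeta> :: "'a::euclidean_space \<Rightarrow> real"
  assumes "\<And>y. y \<in> A \<Longrightarrow> \<zeta> y = 0"
    and F: "integrable (lborel \<Otimes>\<^sub>M lborel) (gagliardo_integrand s u \<zeta>)"
    and H: "integrable (lborel \<Otimes>\<^sub>M lborel) (\<lambda>(x, y). \<zeta> x * (indicator A y * u y * fractional_kernel s (x - y)))"
  shows "integrable (lborel \<Otimes>\<^sub>M lborel) (gagliardo_integrand s (\<lambda>x. indicator (- A) x * u x) \<zeta>)"
    and "integral\<^sup>L (lborel \<Otimes>\<^sub>M lborel) (gagliardo_integrand s (\<lambda>x. indicator (- A) x * u x) \<zeta>) =
      integral\<^sup>L (lborel \<Otimes>\<^sub>M lborel) (gagliardo_integrand s u \<zeta>)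
      + 2 * (LINT x|lborel. \<zeta> x * (LINT y|lborel. indicator A y * u y * fractional_kernel s (x - y)))"
proof -
  let ?P = "lborel \<Otimes>\<^sub>M lborel :: ('a \<times> 'a) measure"
  let ?H = "\<lambda>x y. \<zeta> x * (indicator A y * u y * fractional_kernel s (x - y))"
  have Hs: "integrable ?P (\<lambda>(x, y). ?H y x)"
    using lborel_pair.integrable_product_swap[OF H] by simp
  have split: "gagliardo_integrand s (\<lambda>x. indicator (- A) x * u x) \<zeta> = (\<lambda>z. gagliardo_integrand s u \<zeta> z + (\<lambda>(x, y). ?H x y) z + (\<lambda>(x, y). ?H y x) z)"
  proof (rule ext)
    fix z :: "'a \<times> 'a"
    obtain x y where z: "z = (x, y)" by (cases z)
    have "fractional_kernel s (y - x) = fractional_kernel s (x - y)"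
      by (simp add: fractional_kernel_def norm_minus_commute)
    then show "gagliardo_integrand s (\<lambda>x. indicator (- A) x * u x) \<zeta> z = gagliardo_integrand s u \<zeta> z + (\<lambda>(x, y). ?H x y) z + (\<lambda>(x, y). ?H y x) z"
      using assms(1)[of x] assms(1)[of y] unfolding z gagliardo_integrand_eq
      by (cases "x \<in> A"; cases "y \<in> A") (simp_all add: algebra_simps)
  qed
  show "integrable ?P (gagliardo_integrand s (\<lambda>x. indicator (- A) x * u x) \<zeta>)"
    unfolding split by (intro Bochner_Integration.integrable_add F H Hs)
  have "(LINT x|lborel. \<zeta> x * (LINT y|lborel. indicator A y * u y * fractional_kernel s (x - y))) = (LINT x|lborel. LINT y|lborel. ?H x y)"
    by simp
  also have "\<dots> = integral\<^sup>L ?P (\<lambda>(x, y). ?H x y)"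
    by (rule lborel_pair.integral_fst[OF H])
  finally have e: "(LINT x|lborel. \<zeta> x * (LINT y|lborel. indicator A y * u y * fractional_kernel s (x - y))) = integral\<^sup>L ?P (\<lambda>(x, y). ?H x y)" .
  have "integral\<^sup>L ?P (\<lambda>(x, y). ?H y x) = integral\<^sup>L ?P (\<lambda>(x, y). ?H x y)"
    using lborel_pair.integral_product_swap[OF borel_measurable_integrable[OF H]] by simp
  then show "integral\<^sup>L ?P (gagliardo_integrand s (\<lambda>x. indicator (- A) x * u x) \<zeta>) = integral\<^sup>L ?P (gagliardo_integrand s u \<zeta>)
      + 2 * (LINT x|lborel. \<zeta> x * (LINT y|lborel. indicator A y * u y * fractional_kernel s (x - y)))"
    unfolding split e using F H Hs by simp
qed

lemma integrable_lborel_pair_times: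
  fixes f :: "'a::euclidean_space \<Rightarrow> real" and g :: "'b::euclidean_space \<Rightarrow> real"
  assumes f: "integrable lborel f" and g: "integrable lborel g"
  shows "integrable (lborel \<Otimes>\<^sub>M lborel) (\<lambda>(x, y). f x * g y)"
proof -
  have [measurable]: "f \<in> borel_measurable borel" "g \<in> borel_measurable borel"
    using borel_measurable_integrable[OF f] borel_measurable_integrable[OF g] by simp_all
  show ?thesis
  proof (rule lborel_pair.Fubini_integrable)
    have "integrable lborel (\<lambda>x. \<bar>f x\<bar> * (LINT y|lborel. \<bar>g y\<bar>))"
      using f by simp
    then show "integrable lborel (\<lambda>x. LINT y|lborel. norm (case (x, y) of (x, y) \<Rightarrow> f x * g y))"
      by (simp add: abs_mult)
    show "AE x in lborel. integrable lborel (\<lambda>y. case (x, y) of (x, y) \<Rightarrow> f x * g y)"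
      using g by simp
  qed measurable
qed

lemma fractional_kernel_near_le:
  fixes x y x0 :: "'a::euclidean_space"
  assumes s: "0 < s" and \<rho>: "0 < \<rho>" and y: "\<rho> \<le> norm (y - x0)" and x: "norm (x - x0) \<le> \<rho> / 2"
  shows "fractional_kernel s (x - y) \<le> 2 powr (real DIM('a) + 2 * s) * fractional_kernel s (y - x0)"
proof -
  let ?p = "real DIM('a) + 2 * s"
  have "norm (y - x0) \<le> norm (x - y) + norm (x - x0)"
    using norm_triangle_ineq[of "y - x" "x - x0"] by (simp add: norm_minus_commute)
  then have h: "norm (y - x0) / 2 \<le> norm (x - y)" using x y by linarith
  have "fractional_kernel s (x - y) \<le> (norm (y - x0) / 2) powr (- ?p)"
    unfolding fractional_kernel_def using h y \<rho> s by (intro powr_mono2') auto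
  moreover have "(n / 2) powr (- p) = 2 powr p * n powr (- p)" if "0 \<le> n" for n p :: real
    using that by (simp add: powr_divide powr_minus field_simps)
  then have "(norm (y - x0) / 2) powr (- ?p) = 2 powr ?p * fractional_kernel s (y - x0)"
    unfolding fractional_kernel_def using norm_ge_zero by blast
  ultimately show ?thesis by simp
qed

lemma integrable_far_interaction:
  fixes u \<zeta> :: "'a::euclidean_space \<Rightarrow> real"
  assumes s: "0 < s" and \<rho>: "0 < \<rho>" and [measurable]: "u \<in> borel_measurable borel"
    and \<zeta>: "integrable lborel \<zeta>" and supp: "\<And>x. \<rho> / 2 < norm (x - x0) \<Longrightarrow> \<zeta> x = 0"
    and g: "integrable lborel (\<lambda>y. indicator {y. \<rho> \<le> norm (y - x0)} y * u y * fractional_kernel s (y - x0))"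
  shows "integrable (lborel \<Otimes>\<^sub>M lborel) (\<lambda>(x, y). \<zeta> x * (indicator {y. \<rho> \<le> norm (y - x0)} y * u y * fractional_kernel s (x - y)))"
proof (rule Bochner_Integration.integrable_bound)
  have [measurable]: "\<zeta> \<in> borel_measurable borel"
    using borel_measurable_integrable[OF \<zeta>] by simp
  let ?A = "{y. \<rho> \<le> norm (y - x0)}"
  let ?M = "2 powr (real DIM('a) + 2 * s)"
  show "integrable (lborel \<Otimes>\<^sub>M lborel) (\<lambda>(x, y). (?M * \<zeta> x) * (indicator ?A y * u y * fractional_kernel s (y - x0)))"
    by (intro integrable_lborel_pair_times g) (simp add: \<zeta>)
  show "(\<lambda>(x, y). \<zeta> x * (indicator ?A y * u y * fractional_kernel s (x - y))) \<in> borel_measurable (lborel \<Otimes>\<^sub>M lborel)"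
    by measurable
  have "\<bar>\<zeta> x * (indicator ?A y * u y * fractional_kernel s (x - y))\<bar> \<le> \<bar>(?M * \<zeta> x) * (indicator ?A y * u y * fractional_kernel s (y - x0))\<bar>" for x y
  proof (cases "y \<in> ?A \<and> norm (x - x0) \<le> \<rho> / 2")
    case True
    then have "fractional_kernel s (x - y) \<le> ?M * fractional_kernel s (y - x0)"
      using fractional_kernel_near_le[OF s \<rho>, of y x0 x] by simp
    then have "\<bar>\<zeta> x * u y\<bar> * fractional_kernel s (x - y) \<le> \<bar>\<zeta> x * u y\<bar> * (?M * fractional_kernel s (y - x0))"
      by (intro mult_left_mono) auto
    moreover have "\<bar>\<zeta> x * (indicator ?A y * u y * fractional_kernel s (x - y))\<bar> = \<bar>\<zeta> x * u y\<bar> * fractional_kernel s (x - y)"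
      using True by (simp add: abs_mult)
    moreover have "\<bar>(?M * \<zeta> x) * (indicator ?A y * u y * fractional_kernel s (y - x0))\<bar> = \<bar>\<zeta> x * u y\<bar> * (?M * fractional_kernel s (y - x0))"
      using True by (simp add: abs_mult)
    ultimately show ?thesis by metis
  next
    case False
    then show ?thesis using supp[of x] by (auto simp: indicator_def not_le)
  qed
  then show "AE z in lborel \<Otimes>\<^sub>M lborel. norm ((\<lambda>(x, y). \<zeta> x * (indicator ?A y * u y * fractional_kernel s (x - y))) z)
     \<le> norm ((\<lambda>(x, y). (?M * \<zeta> x) * (indicator ?A y * u y * fractional_kernel s (y - x0))) z)"
    by (intro AE_I2) auto
qed

text \<open>For \<open>p\<close> close to \<open>x0\<close> and \<open>y\<close> away from \<open>x0\<close> the kernel at \<open>p - y\<close> is at most a multiple of the kernel at \<open>y - x0\<close>, which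
provides the majorant for dominated convergence.\<close>

lemma far_interaction_continuous:
  fixes u :: "'a::euclidean_space \<Rightarrow> real"
  assumes s: "0 < s" and \<rho>: "0 < \<rho>" and [measurable]: "u \<in> borel_measurable borel"
    and g: "integrable lborel (\<lambda>y. indicator {y. \<rho> \<le> norm (y - x0)} y * u y * fractional_kernel s (y - x0))"
  shows "isCont (\<lambda>p. LINT y|lborel. indicator {y. \<rho> \<le> norm (y - x0)} y * u y * fractional_kernel s (p - y)) x0"
  unfolding continuous_at_sequentially comp_def
proof (intro allI impI)
  fix p :: "nat \<Rightarrow> 'a" assume p: "p \<longlonglongrightarrow> x0"
  let ?A = "{y. \<rho> \<le> norm (y - x0)}"
  let ?M = "2 powr (real DIM('a) + 2 * s)"
  have "eventually (\<lambda>n. dist (p n) x0 < \<rho> / 2) sequentially"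
    using p \<rho> by (intro tendstoD) auto
  then obtain N where N': "\<forall>n\<ge>N. dist (p n) x0 < \<rho> / 2"
    unfolding eventually_sequentially by blast
  have N: "norm (p n - x0) \<le> \<rho> / 2" if "N \<le> n" for n
    using N'[rule_format, OF that] unfolding dist_norm by (rule less_imp_le)
  have "(\<lambda>n. LINT y|lborel. indicator ?A y * u y * fractional_kernel s (p (n + N) - y)) \<longlonglongrightarrow> (LINT y|lborel. indicator ?A y * u y * fractional_kernel s (x0 - y))"
  proof (rule integral_dominated_convergence[where w = "\<lambda>y. ?M * \<bar>indicator ?A y * u y * fractional_kernel s (y - x0)\<bar>"])
    show "integrable lborel (\<lambda>y. ?M * \<bar>indicator ?A y * u y * fractional_kernel s (y - x0)\<bar>)"
      using g by (intro integrable_mult_right integrable_abs)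
    show "AE y in lborel. (\<lambda>n. indicator ?A y * u y * fractional_kernel s (p (n + N) - y)) \<longlonglongrightarrow> indicator ?A y * u y * fractional_kernel s (x0 - y)"
    proof (intro AE_I2)
      fix y
      show "(\<lambda>n. indicator ?A y * u y * fractional_kernel s (p (n + N) - y)) \<longlonglongrightarrow> indicator ?A y * u y * fractional_kernel s (x0 - y)"
      proof (cases "y \<in> ?A")
        case True
        then have ne: "norm (x0 - y) \<noteq> 0" using \<rho> by (auto simp: norm_minus_commute)
        have t: "(\<lambda>n. norm (p (n + N) - y)) \<longlonglongrightarrow> norm (x0 - y)"
          by (intro tendsto_intros LIMSEQ_ignore_initial_segment p)
        have "(\<lambda>n. fractional_kernel s (p (n + N) - y)) \<longlonglongrightarrow> fractional_kernel s (x0 - y)"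
          unfolding fractional_kernel_def by (rule tendsto_powr[OF t tendsto_const ne])
        then show ?thesis by (intro tendsto_mult tendsto_const)
      qed simp
    qed
    fix n
    show "AE y in lborel. norm (indicator ?A y * u y * fractional_kernel s (p (n + N) - y)) \<le> ?M * \<bar>indicator ?A y * u y * fractional_kernel s (y - x0)\<bar>"
    proof (intro AE_I2)
      fix y
      show "norm (indicator ?A y * u y * fractional_kernel s (p (n + N) - y)) \<le> ?M * \<bar>indicator ?A y * u y * fractional_kernel s (y - x0)\<bar>"
      proof (cases "y \<in> ?A")
        case True
        then have "fractional_kernel s (p (n + N) - y) \<le> ?M * fractional_kernel s (y - x0)"
          using fractional_kernel_near_le[OF s \<rho>, of y x0 "p (n + N)"] N[of "n + N"] by simp
        then have "\<bar>u y\<bar> * fractional_kernel s (p (n + N) - y) \<le> \<bar>u y\<bar> * (?M * fractional_kernel s (y - x0))"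
          by (intro mult_left_mono) auto
        moreover have "norm (indicator ?A y * u y * fractional_kernel s (p (n + N) - y)) = \<bar>u y\<bar> * fractional_kernel s (p (n + N) - y)"
          using True by (simp add: abs_mult)
        moreover have "?M * \<bar>indicator ?A y * u y * fractional_kernel s (y - x0)\<bar> = \<bar>u y\<bar> * (?M * fractional_kernel s (y - x0))"
          using True by (simp add: abs_mult)
        ultimately show ?thesis by metis
      qed simp
    qed
  qed measurable
  then show "(\<lambda>n. LINT y|lborel. indicator ?A y * u y * fractional_kernel s (p n - y)) \<longlonglongrightarrow> (LINT y|lborel. indicator ?A y * u y * fractional_kernel s (x0 - y))"
    by (rule LIMSEQ_offset)
qed

section \<open>Positive mass away from the boundary point\<close>

text \<open>The Poisson kernel of the extension problem at height \<open>t\<close>, without its normalizing constant and the factor \<open>t powr (2 * s)\<close>. As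
\<open>t\<close> decreases to \<open>0\<close> it increases to the kernel of the fractional Laplacian.\<close>

definition poisson_kernel :: "real \<Rightarrow> real \<Rightarrow> 'a::euclidean_space \<Rightarrow> real" where
  "poisson_kernel s t z = 1 / ((norm z)\<^sup>2 + t\<^sup>2) powr ((real DIM('a) + 2 * s) / 2)"

lemma poisson_kernel_measurable[measurable]: "poisson_kernel s t \<in> borel_measurable borel"
  unfolding poisson_kernel_def by measurable

lemma poisson_kernel_nonneg[simp]: "0 \<le> poisson_kernel s t z"
  by (simp add: poisson_kernel_def)

lemma fractional_kernel_eq: "z \<noteq> 0 \<Longrightarrow> fractional_kernel s (z::'a::euclidean_space) = 1 / ((norm z)\<^sup>2) powr ((real DIM('a) + 2 * s) / 2)"
proof -
  assume z: "z \<noteq> 0"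
  have "(r\<^sup>2) powr (p / 2) = r powr p" if "0 < r" for r p :: real
    using that by (simp add: powr_powr flip: powr_numeral)
  then show ?thesis
    using z unfolding fractional_kernel_def powr_minus_divide by simp
qed

lemma poisson_kernel_le: 
  assumes "0 < s" "z \<noteq> 0"
  shows "poisson_kernel s t z \<le> fractional_kernel s z"
  unfolding fractional_kernel_eq[OF assms(2)] poisson_kernel_def using assms
  by (intro divide_left_mono powr_mono2 mult_pos_pos) (auto simp: add_pos_nonneg)

lemma fractional_kernel_le_poisson_kernel:
  fixes z :: "'a::euclidean_space"
  assumes s: "0 < s" and \<rho>: "0 < \<rho>" "\<rho> \<le> norm z"
  shows "fractional_kernel s z \<le> (1 + t\<^sup>2 / \<rho>\<^sup>2) powr ((real DIM('a) + 2 * s) / 2) * poisson_kernel s t z"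
proof -
  define p where "p = (real DIM('a) + 2 * s) / 2"
  have p: "0 \<le> p" using s by (simp add: p_def)
  have z: "z \<noteq> 0" using \<rho> by auto
  have zp: "0 < ((norm z)\<^sup>2) powr p" "0 < ((norm z)\<^sup>2 + t\<^sup>2) powr p" using z by (auto simp: add_pos_nonneg)
  have "t\<^sup>2 * \<rho>\<^sup>2 \<le> t\<^sup>2 * (norm z)\<^sup>2"
    using \<rho> by (intro mult_left_mono power_mono) auto
  then have "t\<^sup>2 \<le> (norm z)\<^sup>2 * (t\<^sup>2 / \<rho>\<^sup>2)"
    using \<rho> by (simp add: field_simps)
  then have "(norm z)\<^sup>2 + t\<^sup>2 \<le> (1 + t\<^sup>2 / \<rho>\<^sup>2) * (norm z)\<^sup>2"
    by (simp add: algebra_simps)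
  then have "((norm z)\<^sup>2 + t\<^sup>2) powr p \<le> ((1 + t\<^sup>2 / \<rho>\<^sup>2) * (norm z)\<^sup>2) powr p"
    using p by (intro powr_mono2) auto
  also have "\<dots> = (1 + t\<^sup>2 / \<rho>\<^sup>2) powr p * ((norm z)\<^sup>2) powr p"
    by (rule powr_mult)
  finally have "1 / ((norm z)\<^sup>2) powr p \<le> (1 + t\<^sup>2 / \<rho>\<^sup>2) powr p * (1 / ((norm z)\<^sup>2 + t\<^sup>2) powr p)"
    using zp by (simp add: field_simps)
  then show ?thesis
    unfolding fractional_kernel_eq[OF z] poisson_kernel_def p_def .
qed

lemma cs_extension_quotient:
  fixes u :: "'a::euclidean_space \<Rightarrow> real"
  assumes u: "u \<in> borel_measurable borel" and u0: "u x0 = 0" and t: "0 < t"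
  shows "(cs_extension s u x0 t - cs_extension s u x0 0) / t powr (2 * s) =
    pi powr (- (real DIM('a) / 2)) * (Gamma ((real DIM('a) + 2 * s) / 2) / Gamma s) * (LINT y|lborel. u y * poisson_kernel s t (y - x0))"
proof -
  note [measurable] = u
  have "(LINT y|lebesgue. u y * t powr (2 * s) / ((norm (x0 - y))\<^sup>2 + t\<^sup>2) powr ((real DIM('a) + 2 * s) / 2))
     = (LINT y|lborel. u y * t powr (2 * s) / ((norm (x0 - y))\<^sup>2 + t\<^sup>2) powr ((real DIM('a) + 2 * s) / 2))"
    by (rule integral_completion) measurable
  also have "\<dots> = (LINT y|lborel. t powr (2 * s) * (u y * poisson_kernel s t (y - x0)))"
    by (intro Bochner_Integration.integral_cong) (auto simp: poisson_kernel_def norm_minus_commute)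
  also have "\<dots> = t powr (2 * s) * (LINT y|lborel. u y * poisson_kernel s t (y - x0))"
    by (rule integral_mult_right_zero)
  finally show ?thesis
    using t u0 by (simp add: cs_extension_def)
qed

text \<open>This is the only use of the extension. The difference quotient is a positive multiple of the integral of \<open>u\<close> against the
Poisson kernel, so for all small \<open>t\<close> this integral exceeds some \<open>m > 0\<close> (and is a convergent one, since a divergent
integral has value \<open>0\<close>). Fix such a \<open>t\<close> for which, outside the ball of radius \<open>\<delta>\<close>, replacing the Poisson kernel by its limit costs
at most \<open>m / 4\<close>, and then \<open>\<rho>\<close> so small that the ball of radius \<open>\<rho>\<close> contributes at most \<open>m / 4\<close>. In the annulus in between \<open>u\<close> is
nonnegative, so there the replacement only increases the integral.\<close>

lemma far_mass_positive:
  fixes u :: "'a::euclidean_space \<Rightarrow> real"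
  assumes s: "0 < s" "s < 1" and u: "u \<in> borel_measurable borel" and u0: "u x0 = 0"
    and \<delta>: "0 < \<delta>" and pos: "\<And>x. x \<in> ball x0 \<delta> \<Longrightarrow> 0 \<le> u x"
    and lim: "0 < Liminf (at_right 0)
           (\<lambda>t. ereal ((cs_extension s u x0 t - cs_extension s u x0 0) / t powr (2 * s)))"
  obtains \<rho> where "0 < \<rho>" "\<rho> < \<delta>"
    "integrable lborel (\<lambda>y. indicator {y. \<rho> \<le> norm (y - x0)} y * u y * fractional_kernel s (y - x0))"
    "0 < (LINT y|lborel. indicator {y. \<rho> \<le> norm (y - x0)} y * u y * fractional_kernel s (y - x0))"
proof -
  note [measurable] = u
  define c where "c = pi powr (- (real DIM('a) / 2)) * (Gamma ((real DIM('a) + 2 * s) / 2) / Gamma s)"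
  have c: "0 < c"
    unfolding c_def using s by (intro mult_pos_pos divide_pos_pos Gamma_real_pos) (auto simp: add_pos_pos)
  define J where "J t = (LINT y|lborel. u y * poisson_kernel s t (y - x0))" for t
  let ?A = "\<lambda>\<rho>. {y. \<rho> \<le> norm (y - x0)}"
  let ?k = "\<lambda>y. fractional_kernel s (y - x0)"
  let ?D = "\<lambda>t y. poisson_kernel s t (y - x0)"
  obtain m0 where m0: "0 < ereal m0" "ereal m0 < Liminf (at_right 0)
           (\<lambda>t. ereal ((cs_extension s u x0 t - cs_extension s u x0 0) / t powr (2 * s)))"
    using ereal_dense2[OF lim] by auto
  define m where "m = m0 / c"
  have m: "0 < m" using m0 c by (simp add: m_def)
  have "eventually (\<lambda>t. ereal m0 < ereal ((cs_extension s u x0 t - cs_extension s u x0 0) / t powr (2 * s))) (at_right 0)"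
    by (rule less_LiminfD[OF m0(2)])
  moreover have "eventually (\<lambda>t::real. 0 < t) (at_right 0)"
    by (simp add: eventually_at_right_less)
  ultimately have evJ: "eventually (\<lambda>t. 0 < t \<and> m < J t) (at_right 0)"
  proof eventually_elim
    case (elim t)
    then have "m0 < c * J t"
      using cs_extension_quotient[where s = s, OF u u0, of t] by (simp add: c_def J_def)
    then show ?case using elim c by (simp add: m_def field_simps)
  qed
  \<comment> \<open>Dominated convergence is available along sequences.\<close>
  define \<tau> where "\<tau> n = 1 / real (Suc n)" for n
  have \<tau>: "filterlim \<tau> (at_right 0) sequentially"
    unfolding \<tau>_def by real_asymp
  then have \<tau>0: "\<tau> \<longlonglongrightarrow> 0" by (simp add: filterlim_at)
  have evn: "eventually (\<lambda>n. 0 < \<tau> n \<and> m < J (\<tau> n)) sequentially"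
    using evJ \<tau> by (rule eventually_compose_filterlim)
  have Dint: "integrable lborel (\<lambda>y. u y * ?D t y)" if "m < J t" for t
    using that m not_integrable_integral_eq[of lborel "\<lambda>y. u y * ?D t y"] by (auto simp: J_def)
  obtain t1 where t1: "0 < t1" "m < J t1"
    using eventually_happens[OF evJ] by auto
  have kint: "integrable lborel (\<lambda>y. indicator (?A \<rho>) y * u y * ?k y)" if \<rho>: "0 < \<rho>" for \<rho>
  proof (rule Bochner_Integration.integrable_bound)
    let ?M = "(1 + t1\<^sup>2 / \<rho>\<^sup>2) powr ((real DIM('a) + 2 * s) / 2)"
    show "integrable lborel (\<lambda>y. ?M * (u y * ?D t1 y))"
      by (intro integrable_mult_right Dint t1)
    have "\<bar>indicator (?A \<rho>) y * u y * ?k y\<bar> \<le> \<bar>?M * (u y * ?D t1 y)\<bar>" for y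
    proof (cases "y \<in> ?A \<rho>")
      case True
      then have "?k y \<le> ?M * ?D t1 y"
        by (intro fractional_kernel_le_poisson_kernel s \<rho>) auto
      then have "\<bar>u y\<bar> * ?k y \<le> \<bar>u y\<bar> * (?M * ?D t1 y)" by (intro mult_left_mono) auto
      moreover have "\<bar>indicator (?A \<rho>) y * u y * ?k y\<bar> = \<bar>u y\<bar> * ?k y" using True by (simp add: abs_mult)
      moreover have "\<bar>?M * (u y * ?D t1 y)\<bar> = \<bar>u y\<bar> * (?M * ?D t1 y)" by (simp add: abs_mult)
      ultimately show ?thesis by metis
    qed simp
    then show "AE y in lborel. norm (indicator (?A \<rho>) y * u y * ?k y) \<le> norm (?M * (u y * ?D t1 y))"
      by (intro AE_I2) (simp only: real_norm_def)
  qed measurable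
  define T where "T = (LINT y|lborel. indicator (?A \<delta>) y * u y * ?k y)"
  have tail: "(\<lambda>n. LINT y|lborel. indicator (?A \<delta>) y * u y * ?D (\<tau> n) y) \<longlonglongrightarrow> T"
    unfolding T_def
  proof (rule integral_dominated_convergence[where w = "\<lambda>y. \<bar>indicator (?A \<delta>) y * u y * ?k y\<bar>"])
    show "integrable lborel (\<lambda>y. \<bar>indicator (?A \<delta>) y * u y * ?k y\<bar>)"
      by (intro integrable_abs kint \<delta>)
    show "AE y in lborel. (\<lambda>n. indicator (?A \<delta>) y * u y * ?D (\<tau> n) y) \<longlonglongrightarrow> indicator (?A \<delta>) y * u y * ?k y"
    proof (intro AE_I2)
      fix y
      show "(\<lambda>n. indicator (?A \<delta>) y * u y * ?D (\<tau> n) y) \<longlonglongrightarrow> indicator (?A \<delta>) y * u y * ?k y"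
      proof (cases "y \<in> ?A \<delta>")
        case True
        then have z: "y - x0 \<noteq> 0" using \<delta> by auto
        have "(\<lambda>n. (norm (y - x0))\<^sup>2 + (\<tau> n)\<^sup>2) \<longlonglongrightarrow> (norm (y - x0))\<^sup>2 + 0\<^sup>2"
          by (intro tendsto_intros \<tau>0)
        then have b: "(\<lambda>n. (norm (y - x0))\<^sup>2 + (\<tau> n)\<^sup>2) \<longlonglongrightarrow> (norm (y - x0))\<^sup>2"
          by simp
        have "(\<lambda>n. ?D (\<tau> n) y) \<longlonglongrightarrow> ?k y"
          unfolding fractional_kernel_eq[OF z] poisson_kernel_def
          by (rule tendsto_divide[OF tendsto_const tendsto_powr[OF b tendsto_const]]) (use z in auto)
        then show ?thesis by (intro tendsto_mult tendsto_const)
      qed simp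
    qed
    fix n
    have "\<bar>indicator (?A \<delta>) y * u y * ?D (\<tau> n) y\<bar> \<le> \<bar>indicator (?A \<delta>) y * u y * ?k y\<bar>" for y
    proof (cases "y \<in> ?A \<delta>")
      case True
      then have "y - x0 \<noteq> 0" using \<delta> by auto
      from poisson_kernel_le[OF s(1) this] have "\<bar>u y\<bar> * ?D (\<tau> n) y \<le> \<bar>u y\<bar> * ?k y" by (intro mult_left_mono) auto
      then show ?thesis using True by (simp add: abs_mult)
    qed simp
    then show "AE y in lborel. norm (indicator (?A \<delta>) y * u y * ?D (\<tau> n) y) \<le> \<bar>indicator (?A \<delta>) y * u y * ?k y\<bar>"
      by (intro AE_I2) (simp only: real_norm_def)
  qed measurable
  have "eventually (\<lambda>n. (LINT y|lborel. indicator (?A \<delta>) y * u y * ?D (\<tau> n) y) < T + m / 4) sequentially"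
    by (rule order_tendstoD(2)[OF tail]) (use m in simp)
  with evn have "eventually (\<lambda>n. (0 < \<tau> n \<and> m < J (\<tau> n)) \<and> (LINT y|lborel. indicator (?A \<delta>) y * u y * ?D (\<tau> n) y) < T + m / 4) sequentially"
    by (rule eventually_conj)
  then obtain n where "0 < \<tau> n" "m < J (\<tau> n)" "(LINT y|lborel. indicator (?A \<delta>) y * u y * ?D (\<tau> n) y) < T + m / 4"
    using eventually_happens[of _ sequentially] by auto
  then obtain t where t: "0 < t" "m < J t" and tT: "(LINT y|lborel. indicator (?A \<delta>) y * u y * ?D t y) < T + m / 4"
    by blast
  note Di = Dint[OF t(2)]
  have ind: "integrable lborel (\<lambda>y. indicator S y * u y * ?D t y)" if [measurable]: "S \<in> sets borel" for S
  proof (rule Bochner_Integration.integrable_bound[OF Di])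
    show "AE y in lborel. norm (indicator S y * u y * ?D t y) \<le> norm (u y * ?D t y)"
      by (intro AE_I2) (auto simp: indicator_def)
  qed measurable
  define \<rho>\<^sub>n where "\<rho>\<^sub>n n = \<delta> / real (n + 2)" for n
  have \<rho>\<^sub>n: "0 < \<rho>\<^sub>n n" "\<rho>\<^sub>n n < \<delta>" for n using \<delta> by (auto simp: \<rho>\<^sub>n_def field_simps add_pos_nonneg)
  have "(\<lambda>n. LINT y|lborel. indicator (- ?A (\<rho>\<^sub>n n)) y * u y * ?D t y) \<longlonglongrightarrow> integral\<^sup>L lborel (\<lambda>y::'a. 0::real)"
  proof (rule integral_dominated_convergence[where w = "\<lambda>y. \<bar>u y * ?D t y\<bar>" and f = "\<lambda>y. 0"
        and s = "\<lambda>n y. indicator (- ?A (\<rho>\<^sub>n n)) y * u y * ?D t y"])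
    show "integrable lborel (\<lambda>y. \<bar>u y * ?D t y\<bar>)" by (intro integrable_abs Di)
    show "AE y in lborel. (\<lambda>n. indicator (- ?A (\<rho>\<^sub>n n)) y * u y * ?D t y) \<longlonglongrightarrow> 0"
    proof (intro AE_I2)
      fix y
      show "(\<lambda>n. indicator (- ?A (\<rho>\<^sub>n n)) y * u y * ?D t y) \<longlonglongrightarrow> 0"
      proof (cases "y = x0")
        case True
        then show ?thesis using u0 by simp
      next
        case False
        have "\<rho>\<^sub>n \<longlonglongrightarrow> 0" unfolding \<rho>\<^sub>n_def by real_asymp
        then have "eventually (\<lambda>n. \<rho>\<^sub>n n < norm (y - x0)) sequentially"
          using False by (intro order_tendstoD(2)) auto
        then have "eventually (\<lambda>n. indicator (- ?A (\<rho>\<^sub>n n)) y * u y * ?D t y = 0) sequentially"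
          by eventually_elim simp
        then show ?thesis by (rule tendsto_eventually)
      qed
    qed
    show "AE y in lborel. norm (indicator (- ?A (\<rho>\<^sub>n n)) y * u y * ?D t y) \<le> \<bar>u y * ?D t y\<bar>" for n
      by (intro AE_I2) (auto simp: indicator_def)
  qed measurable
  then have "(\<lambda>n. LINT y|lborel. indicator (- ?A (\<rho>\<^sub>n n)) y * u y * ?D t y) \<longlonglongrightarrow> 0" by simp
  then have "eventually (\<lambda>n. (LINT y|lborel. indicator (- ?A (\<rho>\<^sub>n n)) y * u y * ?D t y) < m / 4) sequentially"
    by (rule order_tendstoD(2)) (use m in simp)
  then obtain n where "(LINT y|lborel. indicator (- ?A (\<rho>\<^sub>n n)) y * u y * ?D t y) < m / 4"
    using eventually_happens[of _ sequentially] by auto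
  then obtain \<rho> where \<rho>: "0 < \<rho>" "\<rho> < \<delta>" and near: "(LINT y|lborel. indicator (- ?A \<rho>) y * u y * ?D t y) < m / 4"
    using \<rho>\<^sub>n by blast
  show ?thesis
  proof (rule that[OF \<rho> kint[OF \<rho>(1)]])
    have [measurable]: "?A \<rho> \<in> sets borel" for \<rho> by measurable
    have "J t = (LINT y|lborel. indicator (- ?A \<rho>) y * u y * ?D t y + indicator (?A \<rho> - ?A \<delta>) y * u y * ?D t y + indicator (?A \<delta>) y * u y * ?D t y)"
      unfolding J_def by (intro Bochner_Integration.integral_cong refl) (use \<rho> in \<open>auto simp: indicator_def\<close>)
    also have "\<dots> = (LINT y|lborel. indicator (- ?A \<rho>) y * u y * ?D t y) + (LINT y|lborel. indicator (?A \<rho> - ?A \<delta>) y * u y * ?D t y) + (LINT y|lborel. indicator (?A \<delta>) y * u y * ?D t y)"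
      using ind[of "- ?A \<rho>"] ind[of "?A \<rho> - ?A \<delta>"] ind[of "?A \<delta>"] by simp
    finally have "m < m / 4 + (LINT y|lborel. indicator (?A \<rho> - ?A \<delta>) y * u y * ?D t y) + (T + m / 4)"
      using t(2) near tT by linarith
    then have "0 < (LINT y|lborel. indicator (?A \<rho> - ?A \<delta>) y * u y * ?D t y) + T"
      using m by linarith
    also have "\<dots> = (LINT y|lborel. indicator (?A \<rho> - ?A \<delta>) y * u y * ?D t y + indicator (?A \<delta>) y * u y * ?k y)"
      unfolding T_def using ind[of "?A \<rho> - ?A \<delta>"] kint[OF \<delta>] by simp
    also have "\<dots> \<le> (LINT y|lborel. indicator (?A \<rho>) y * u y * ?k y)"
    proof (rule integral_mono[OF _ kint[OF \<rho>(1)]])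
      show "integrable lborel (\<lambda>y. indicator (?A \<rho> - ?A \<delta>) y * u y * ?D t y + indicator (?A \<delta>) y * u y * ?k y)"
        using ind[of "?A \<rho> - ?A \<delta>"] kint[OF \<delta>] by simp
      fix y
      show "indicator (?A \<rho> - ?A \<delta>) y * u y * ?D t y + indicator (?A \<delta>) y * u y * ?k y \<le> indicator (?A \<rho>) y * u y * ?k y"
      proof (cases "y \<in> ?A \<rho> - ?A \<delta>")
        case True
        then have "y - x0 \<noteq> 0" "0 \<le> u y" using \<rho> pos[of y] by (auto simp: dist_norm norm_minus_commute)
        then have "u y * ?D t y \<le> u y * ?k y"
          by (intro mult_left_mono poisson_kernel_le s)
        then show ?thesis using True by simp
      next
        case False
        then show ?thesis using \<rho> by (auto simp: indicator_def)
      qed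
    qed
    finally show "0 < (LINT y|lborel. indicator (?A \<rho>) y * u y * ?k y)" .
  qed
qed

section \<open>Comparison with the barrier\<close>

text \<open>At a negative minimum of \<open>v - m * W\<close> over the closed ball, which is then a global minimum because \<open>v\<close> is nonnegative and
\<open>W\<close> vanishes outside, every second difference of \<open>v\<close> is at most \<open>m\<close> times that of \<open>W\<close>. Integrating gives \<open>\<kappa> \<le> m * C\<close>.\<close>

lemma comparison_with_barrier:
  fixes v :: "'a::euclidean_space \<Rightarrow> real"
  assumes s: "0 < s" "s < 1"
    and C: "\<And>r (x::'a) F. norm x < r \<Longrightarrow> integrable lborel F \<Longrightarrow>
       (\<And>h. F h \<le> second_difference (ball_barrier s r) x h * fractional_kernel s h) \<Longrightarrow> integral\<^sup>L lborel F \<le> C"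
    and v0: "\<And>x. 0 \<le> v x" and cont: "continuous_on UNIV v" and r: "0 < r" and m: "0 < m" "m * C < \<kappa>"
    and int: "\<And>a. norm (a - x1) < r \<Longrightarrow> integrable lborel (\<lambda>h. second_difference v a h * fractional_kernel s h)"
    and super: "\<And>a. norm (a - x1) < r \<Longrightarrow> \<kappa> \<le> (LINT h|lborel. second_difference v a h * fractional_kernel s h)"
  shows "m * ball_barrier s r (x - x1) \<le> v x"
proof (rule ccontr)
  let ?W = "ball_barrier s r :: 'a \<Rightarrow> real"
  define \<phi> where "\<phi> x = v x - m * ?W (x - x1)" for x
  assume neg: "\<not> m * ball_barrier s r (x - x1) \<le> v x"
  have out: "?W (y - x1) = 0" if "r \<le> norm (y - x1)" for y
    using that r power_mono[of r "norm (y - x1)" 2] by (simp add: ball_barrier_def)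
  have "continuous_on (cball x1 r) \<phi>"
    unfolding \<phi>_def ball_barrier_def using s
    by (intro continuous_intros continuous_on_powr' continuous_on_subset[OF cont]) auto
  then obtain z where z: "z \<in> cball x1 r" and zmin: "\<And>y. y \<in> cball x1 r \<Longrightarrow> \<phi> z \<le> \<phi> y"
    using continuous_attains_inf[OF compact_cball, of x1 r \<phi>] r by auto
  have "norm (x - x1) < r"
    using neg v0[of x] out[of x] by fastforce
  then have "x \<in> cball x1 r" by (simp add: dist_norm norm_minus_commute)
  then have zneg: "\<phi> z < 0" using zmin[of x] neg by (simp add: \<phi>_def)
  have zmin': "\<phi> z \<le> \<phi> y" for y
  proof (cases "y \<in> cball x1 r")
    case False
    then have "?W (y - x1) = 0" by (intro out) (simp add: dist_norm norm_minus_commute)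
    then show ?thesis using zneg v0[of y] by (simp add: \<phi>_def)
  qed (rule zmin)
  have zr: "norm (z - x1) < r"
    using zneg v0[of z] out[of z] unfolding \<phi>_def by fastforce
  have le: "second_difference v z h \<le> m * second_difference ?W (z - x1) h" for h
  proof -
    have "z + h - x1 = z - x1 + h" "z - h - x1 = z - x1 - h" by simp_all
    then show ?thesis
      using zmin'[of "z + h"] zmin'[of "z - h"]
      by (simp add: second_difference_def \<phi>_def algebra_simps)
  qed
  have "integral\<^sup>L lborel (\<lambda>h. second_difference v z h * fractional_kernel s h / m) \<le> C"
  proof (rule C[OF zr])
    show "integrable lborel (\<lambda>h. second_difference v z h * fractional_kernel s h / m)"
      using int[OF zr] by simp
    fix h
    have "second_difference v z h / m \<le> second_difference ?W (z - x1) h"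
      using le[of h] m by (simp add: field_simps)
    then have "second_difference v z h / m * fractional_kernel s h \<le> second_difference ?W (z - x1) h * fractional_kernel s h"
      by (intro mult_right_mono) auto
    then show "second_difference v z h * fractional_kernel s h / m \<le> second_difference ?W (z - x1) h * fractional_kernel s h"
      by simp
  qed
  then have "(LINT h|lborel. second_difference v z h * fractional_kernel s h) \<le> m * C"
    using m by (simp add: field_simps)
  then show False using super[OF zr] m by linarith
qed

lemma mollification_continuous:
  fixes w :: "'a::euclidean_space \<Rightarrow> real"
  assumes w: "integrable lborel w" and e: "0 < \<epsilon>"
  shows "continuous_on UNIV (\<lambda>p. LINT x|lborel. w x * radial_bump \<epsilon> (x - p))"
proof -
  let ?v = "\<lambda>p. LINT x|lborel. w x * radial_bump \<epsilon> (x - p)"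
  have [measurable]: "w \<in> borel_measurable borel"
    using borel_measurable_integrable[OF w] by simp
  define L where "L = 4 * \<epsilon> * (LINT x|lborel. \<bar>w x\<bar>)"
  have i: "integrable lborel (\<lambda>x. w x * radial_bump \<epsilon> (x - p))" for p
  proof (rule Bochner_Integration.integrable_bound[OF w])
    have "\<bar>w x * radial_bump \<epsilon> (x - p)\<bar> \<le> \<bar>w x\<bar>" for x
      unfolding abs_mult using radial_bump_le_1[of \<epsilon> "x - p"] by (intro mult_right_le_one_le) auto
    then show "AE x in lborel. norm (w x * radial_bump \<epsilon> (x - p)) \<le> norm (w x)" by simp
  qed measurable
  have "L-lipschitz_on UNIV ?v"
  proof (rule lipschitz_onI)
    fix p q :: 'a
    have "?v p - ?v q = (LINT x|lborel. w x * radial_bump \<epsilon> (x - p) - w x * radial_bump \<epsilon> (x - q))"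
      using i[of p] i[of q] by simp
    also have "\<bar>\<dots>\<bar> \<le> (LINT x|lborel. \<bar>w x\<bar> * (4 * \<epsilon> * norm (p - q)))"
    proof (rule integral_abs_bound[THEN order_trans], rule integral_mono)
      show "integrable lborel (\<lambda>x. \<bar>w x * radial_bump \<epsilon> (x - p) - w x * radial_bump \<epsilon> (x - q)\<bar>)"
        using i[of p] i[of q] by simp
      show "integrable lborel (\<lambda>x. \<bar>w x\<bar> * (4 * \<epsilon> * norm (p - q)))" using w by simp
      fix x
      have "\<bar>radial_bump \<epsilon> (x - p) - radial_bump \<epsilon> (x - q)\<bar> \<le> 4 * \<epsilon> * norm (p - q)"
        using radial_bump_lipschitz[OF e, of "x - p" "x - q"] by (simp add: norm_minus_commute)
      then have "\<bar>w x\<bar> * \<bar>radial_bump \<epsilon> (x - p) - radial_bump \<epsilon> (x - q)\<bar> \<le> \<bar>w x\<bar> * (4 * \<epsilon> * norm (p - q))"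
        by (intro mult_left_mono) auto
      then show "\<bar>w x * radial_bump \<epsilon> (x - p) - w x * radial_bump \<epsilon> (x - q)\<bar> \<le> \<bar>w x\<bar> * (4 * \<epsilon> * norm (p - q))"
        by (simp only: abs_mult[symmetric] right_diff_distrib)
    qed
    also have "\<dots> = L * norm (p - q)" by (simp add: L_def)
    finally show "dist (?v p) (?v q) \<le> L * dist p q" by (simp add: dist_norm)
  qed (use e in \<open>simp add: L_def\<close>)
  then show ?thesis by (rule lipschitz_on_continuous_on)
qed

text \<open>The source produced by the far part of \<open>u\<close> is about \<open>2 * \<iota>\<close>, where \<open>\<iota> > 0\<close> is the far mass. The potential term
\<open>c * u\<close> is bounded by \<open>\<iota> / 2\<close> near \<open>x0\<close>, whatever the sign of \<open>c\<close>, because \<open>c\<close> is bounded and the continuous function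
\<open>u\<close> vanishes at \<open>x0\<close>. So the mollified truncation is a strict supersolution near \<open>x0\<close>.\<close>

lemma supersolution_near_boundary:
  fixes u c :: "'a::euclidean_space \<Rightarrow> real"
  assumes s: "0 < s" "s < 1" and op: "open \<Omega>" and c: "c \<in> L_infinity \<Omega>"
    and cont: "continuous_on UNIV u" and weak: "weak_supersolution s \<Omega> c u" and u0: "u x0 = 0"
    and \<rho>: "0 < \<rho>"
    and g: "integrable lborel (\<lambda>y. indicator {y. \<rho> \<le> norm (y - x0)} y * u y * fractional_kernel s (y - x0))"
    and I: "0 < (LINT y|lborel. indicator {y. \<rho> \<le> norm (y - x0)} y * u y * fractional_kernel s (y - x0))"
  defines "w \<equiv> \<lambda>x. indicator (- {y. \<rho> \<le> norm (y - x0)}) x * u x"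
  assumes w: "integrable lborel w"
  obtains \<eta> \<kappa> where "0 < \<eta>" "0 < \<kappa>"
    "\<And>a \<epsilon>. 0 < \<epsilon> \<Longrightarrow> cball a \<epsilon> \<subseteq> \<Omega> \<Longrightarrow> cball a \<epsilon> \<subseteq> ball x0 \<eta> \<Longrightarrow>
       integrable lborel (\<lambda>h. second_difference (\<lambda>p. LINT x|lborel. w x * radial_bump \<epsilon> (x - p)) a h * fractional_kernel s h)"
    "\<And>a \<epsilon>. 0 < \<epsilon> \<Longrightarrow> cball a \<epsilon> \<subseteq> \<Omega> \<Longrightarrow> cball a \<epsilon> \<subseteq> ball x0 \<eta> \<Longrightarrow>
       \<kappa> * (LINT z|lborel. radial_bump \<epsilon> (z::'a)) \<le>
       (LINT h|lborel. second_difference (\<lambda>p. LINT x|lborel. w x * radial_bump \<epsilon> (x - p)) a h * fractional_kernel s h)"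
proof -
  let ?A = "{y. \<rho> \<le> norm (y - x0)}"
  let ?P = "lborel \<Otimes>\<^sub>M lborel :: ('a \<times> 'a) measure"
  have um[measurable]: "u \<in> borel_measurable borel"
    by (rule borel_measurable_continuous_onI[OF cont])
  define G where "G p = (LINT y|lborel. indicator ?A y * u y * fractional_kernel s (p - y))" for p
  define \<iota> where "\<iota> = G x0"
  have \<iota>: "0 < \<iota>"
    using I unfolding \<iota>_def G_def by (simp add: fractional_kernel_def norm_minus_commute)
  have "isCont G x0"
    unfolding G_def[abs_def] by (rule far_interaction_continuous[OF s(1) \<rho> um g])
  then have "eventually (\<lambda>p. \<iota> / 2 < G p) (nhds x0)"
    using \<iota> by (intro order_tendstoD(1)[of G "G x0"]) (auto simp: isCont_def \<iota>_def tendsto_at_iff_tendsto_nhds)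
  then obtain \<eta>1 where \<eta>1: "0 < \<eta>1" "\<And>p. dist p x0 < \<eta>1 \<Longrightarrow> \<iota> / 2 < G p"
    unfolding eventually_nhds_metric by blast
  obtain M0 where "AE x in lebesgue_on \<Omega>. \<bar>c x\<bar> \<le> M0"
    using c by (auto simp: L_infinity_def)
  then have cM0: "AE x in lebesgue. x \<in> \<Omega> \<longrightarrow> \<bar>c x\<bar> \<le> M0"
    using op by (subst (asm) AE_restrict_space_iff) auto
  define M where "M = \<bar>M0\<bar> + 1"
  have M: "0 < M" by (simp add: M_def)
  have cM: "AE x in lebesgue. x \<in> \<Omega> \<longrightarrow> \<bar>c x\<bar> \<le> M"
    using cM0 by eventually_elim (auto simp: M_def)
  have "isCont u x0" using cont by (simp add: continuous_on_eq_continuous_at)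
  then obtain \<eta>2 where \<eta>2: "0 < \<eta>2" "\<And>p. dist p x0 < \<eta>2 \<Longrightarrow> dist (u p) (u x0) < \<iota> / (2 * M)"
    unfolding continuous_at_eps_delta using \<iota> M by (metis divide_pos_pos mult_pos_pos zero_less_numeral)
  define \<eta> where "\<eta> = min (\<rho> / 2) (min \<eta>1 \<eta>2)"
  have \<eta>: "0 < \<eta>" using \<rho> \<eta>1 \<eta>2 by (simp add: \<eta>_def)
  have uHs: "integrable lebesgue (gagliardo_integrand s u u)"
    using weak by (simp add: weak_supersolution_def Hs_def)
  have uP: "integrable ?P (gagliardo_integrand s u u)"
    using integrable_lebesgue_iff_lborel[of "gagliardo_integrand s u u"] uHs gagliardo_integrand_measurable[OF um um]
    by (simp add: lborel_prod)
  have main: "integrable ?P (gagliardo_integrand s w (\<lambda>x. radial_bump \<epsilon> (x - a))) \<and>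
     \<iota> / 2 * (LINT z|lborel. radial_bump \<epsilon> (z::'a)) \<le> integral\<^sup>L ?P (gagliardo_integrand s w (\<lambda>x. radial_bump \<epsilon> (x - a)))"
    if e: "0 < \<epsilon>" and sub: "cball a \<epsilon> \<subseteq> \<Omega>" "cball a \<epsilon> \<subseteq> ball x0 \<eta>" for a \<epsilon>
  proof -
    define \<zeta> where "\<zeta> x = radial_bump \<epsilon> (x - a)" for x
    define Z where "Z = (LINT z|lborel. radial_bump \<epsilon> (z::'a))"
    have \<zeta>m[measurable]: "\<zeta> \<in> borel_measurable borel" unfolding \<zeta>_def by measurable
    have \<zeta>0: "0 \<le> \<zeta> x" for x by (simp add: \<zeta>_def)
    have supp: "dist x x0 < \<eta>" if "\<zeta> x \<noteq> 0" for x
    proof -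
      have "x \<in> cball a \<epsilon>"
        using that radial_bump_eq_0[OF e, of "x - a"] by (fastforce simp: \<zeta>_def dist_norm norm_minus_commute)
      then show ?thesis using sub by (auto simp: dist_commute)
    qed
    have \<zeta>int: "integrable lborel \<zeta>" and \<zeta>Z: "integral\<^sup>L lborel \<zeta> = Z"
      using integrable_lborel_translate[OF integrable_radial_bump[OF e], of "- a"] by (simp_all add: \<zeta>_def[abs_def] Z_def)
    have \<zeta>Hs0: "\<zeta> \<in> Hs0 s \<Omega>" and \<zeta>P: "integrable ?P (gagliardo_integrand s \<zeta> \<zeta>)"
      using radial_bump_Hs0[OF s e sub(1)] by (simp_all add: \<zeta>_def[abs_def])
    have F: "integrable ?P (gagliardo_integrand s u \<zeta>)"
    proof (rule Bochner_Integration.integrable_bound)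
      show "integrable ?P (\<lambda>z. gagliardo_integrand s u u z + gagliardo_integrand s \<zeta> \<zeta> z)"
        by (intro Bochner_Integration.integrable_add uP \<zeta>P)
      have "\<bar>b * d\<bar> * k \<le> (b * b + d * d) * k" if "0 \<le> k" for b d k :: real
      proof (intro mult_right_mono that)
        have "0 \<le> (\<bar>b\<bar> - \<bar>d\<bar>)\<^sup>2" by simp
        then have "2 * (\<bar>b\<bar> * \<bar>d\<bar>) \<le> b * b + d * d" by (simp add: power2_eq_square algebra_simps)
        moreover have "0 \<le> \<bar>b\<bar> * \<bar>d\<bar>" by simp
        ultimately show "\<bar>b * d\<bar> \<le> b * b + d * d" unfolding abs_mult by linarith
      qed
      from this[OF fractional_kernel_nonneg]
      have "\<bar>gagliardo_integrand s u \<zeta> z\<bar> \<le> gagliardo_integrand s u u z + gagliardo_integrand s \<zeta> \<zeta> z" for z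
        by (cases z) (simp add: gagliardo_integrand_eq abs_mult distrib_right[symmetric])
      then show "AE z in ?P. norm (gagliardo_integrand s u \<zeta> z) \<le> norm (gagliardo_integrand s u u z + gagliardo_integrand s \<zeta> \<zeta> z)"
        by (intro AE_I2) (smt (verit) real_norm_def)
    qed measurable
    have H: "integrable ?P (\<lambda>(x, y). \<zeta> x * (indicator ?A y * u y * fractional_kernel s (x - y)))"
    proof (rule integrable_far_interaction[OF s(1) \<rho> um \<zeta>int _ g])
      show "\<zeta> x = 0" if "\<rho> / 2 < norm (x - x0)" for x
        using supp[of x] that by (auto simp: \<eta>_def dist_norm)
    qed
    have \<zeta>A: "\<zeta> y = 0" if "y \<in> ?A" for y
      using supp[of y] that \<rho> by (auto simp: \<eta>_def dist_norm)
    note far = gagliardo_form_remove_far_part[OF \<zeta>A F H]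
    have "(LINT x:\<Omega>|lebesgue. c x * u x * \<zeta> x) \<le> gagliardo_form s u \<zeta>"
      using weak \<zeta>Hs0 \<zeta>0 by (simp add: weak_supersolution_def)
    also have "gagliardo_form s u \<zeta> = integral\<^sup>L ?P (gagliardo_integrand s u \<zeta>)"
      unfolding gagliardo_form_def
      using integral_completion[of "gagliardo_integrand s u \<zeta>" lborel] gagliardo_integrand_measurable[OF um \<zeta>m]
      by (simp add: lborel_prod)
    finally have f1: "(LINT x:\<Omega>|lebesgue. c x * u x * \<zeta> x) \<le> integral\<^sup>L ?P (gagliardo_integrand s u \<zeta>)" .
    have Z0: "0 \<le> Z" unfolding Z_def by simp
    have f2: "- (\<iota> / 2) * Z \<le> (LINT x:\<Omega>|lebesgue. c x * u x * \<zeta> x)"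
    \<comment> \<open>A divergent integral has value \<open>0\<close>, for which the bound is trivial.\<close>
    proof (cases "integrable lebesgue (\<lambda>x. indicator \<Omega> x *\<^sub>R (c x * u x * \<zeta> x))")
      case True
      have zl: "integrable lebesgue \<zeta>" "integral\<^sup>L lebesgue \<zeta> = Z"
        using integrable_lebesgue_iff_lborel[OF \<zeta>m] \<zeta>int integral_completion[of \<zeta> lborel] \<zeta>m \<zeta>Z by simp_all
      have "- (\<iota> / 2) * Z = (LINT x|lebesgue. - (\<iota> / 2) * \<zeta> x)"
        using zl by simp
      also have "\<dots> \<le> (LINT x|lebesgue. indicator \<Omega> x *\<^sub>R (c x * u x * \<zeta> x))"
      proof (rule integral_mono_AE[OF _ True])
        show "integrable lebesgue (\<lambda>x. - (\<iota> / 2) * \<zeta> x)" using zl by simp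
        show "AE x in lebesgue. - (\<iota> / 2) * \<zeta> x \<le> indicator \<Omega> x *\<^sub>R (c x * u x * \<zeta> x)"
          using cM
        proof eventually_elim
          case (elim x)
          show ?case
          proof (cases "x \<in> \<Omega> \<and> \<zeta> x \<noteq> 0")
            case True
            then have "dist x x0 < \<eta>2" using supp[of x] by (simp add: \<eta>_def)
            from \<eta>2(2)[OF this] have "\<bar>u x\<bar> \<le> \<iota> / (2 * M)" by (simp add: u0 dist_norm)
            then have "\<bar>c x\<bar> * \<bar>u x\<bar> \<le> M * (\<iota> / (2 * M))"
              using True elim M by (intro mult_mono) auto
            then have "\<bar>c x * u x\<bar> \<le> \<iota> / 2" using M by (simp add: abs_mult)
            then have "- (\<iota> / 2) \<le> c x * u x" by linarith
            then have "- (\<iota> / 2) * \<zeta> x \<le> c x * u x * \<zeta> x" using \<zeta>0 by (intro mult_right_mono)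
            then show ?thesis using True by simp
          next
            case False
            then show ?thesis using \<iota> \<zeta>0[of x] by auto
          qed
        qed
      qed
      finally show ?thesis by (simp add: set_lebesgue_integral_def)
    next
      case False
      then have "(LINT x:\<Omega>|lebesgue. c x * u x * \<zeta> x) = 0"
        unfolding set_lebesgue_integral_def by (rule not_integrable_integral_eq)
      then show ?thesis using \<iota> Z0 by simp
    qed
    have f3: "\<iota> / 2 * Z \<le> (LINT x|lborel. \<zeta> x * (LINT y|lborel. indicator ?A y * u y * fractional_kernel s (x - y)))"
    proof -
      have "\<iota> / 2 * Z = (LINT x|lborel. \<zeta> x * (\<iota> / 2))" using \<zeta>Z by simp
      also have "\<dots> \<le> (LINT x|lborel. \<zeta> x * G x)"
      proof (rule integral_mono)
        show "integrable lborel (\<lambda>x. \<zeta> x * (\<iota> / 2))" using \<zeta>int by simp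
        show "integrable lborel (\<lambda>x. \<zeta> x * G x)"
          using lborel_pair.integrable_fst'[OF H] by (simp add: G_def)
        fix x
        show "\<zeta> x * (\<iota> / 2) \<le> \<zeta> x * G x"
        proof (cases "\<zeta> x = 0")
          case False
          then have "\<iota> / 2 < G x" using supp[of x] by (intro \<eta>1) (simp add: \<eta>_def)
          then show ?thesis using \<zeta>0 by (intro mult_left_mono) auto
        qed simp
      qed
      finally show ?thesis by (simp only: G_def)
    qed
    have "\<iota> / 2 * Z \<le> integral\<^sup>L ?P (gagliardo_integrand s w \<zeta>)"
      using far(2) f1 f2 f3 unfolding w_def by linarith
    moreover have "integrable ?P (gagliardo_integrand s w \<zeta>)"
      unfolding w_def by (rule far(1))
    ultimately show ?thesis unfolding \<zeta>_def[abs_def] Z_def by blast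
  qed
  have b1: "\<bar>radial_bump \<epsilon> z\<bar> \<le> 1" for \<epsilon> and z :: 'a
    using radial_bump_le_1[of \<epsilon> z] by simp
  note moll = gagliardo_form_mollified[OF w radial_bump_measurable b1]
  show ?thesis
  proof (rule that[OF \<eta>, of "\<iota> / 2"])
    show "0 < \<iota> / 2" using \<iota> by simp
    fix a \<epsilon> assume *: "0 < \<epsilon>" "cball a \<epsilon> \<subseteq> \<Omega>" "cball a \<epsilon> \<subseteq> ball x0 \<eta>"
    note m = main[OF *]
    show "integrable lborel (\<lambda>h. second_difference (\<lambda>p. LINT x|lborel. w x * radial_bump \<epsilon> (x - p)) a h * fractional_kernel s h)"
      by (rule moll(1)) (use m in blast)
    show "\<iota> / 2 * (LINT z|lborel. radial_bump \<epsilon> (z::'a)) \<le>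
       (LINT h|lborel. second_difference (\<lambda>p. LINT x|lborel. w x * radial_bump \<epsilon> (x - p)) a h * fractional_kernel s h)"
      using m by (subst moll(2)) auto
  qed
qed

section \<open>Hopf's lemma\<close>

lemma integrable_truncation:
  fixes u :: "'a::euclidean_space \<Rightarrow> real"
  assumes u: "continuous_on UNIV u"
  shows "integrable lborel (\<lambda>x. indicator (- {y. \<rho> \<le> norm (y - x0)}) x * u x)"
proof -
  have [measurable]: "u \<in> borel_measurable borel"
    by (rule borel_measurable_continuous_onI[OF u])
  have i: "integrable lborel (\<lambda>x. indicator (cball x0 \<rho>) x *\<^sub>R u x)"
    by (intro borel_integrable_compact compact_cball continuous_on_subset[OF u]) simp
  have "AE x in lborel. norm (indicator (- {y. \<rho> \<le> norm (y - x0)}) x * u x) \<le> norm (indicator (cball x0 \<rho>) x *\<^sub>R u x)"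
    by (intro AE_I2) (auto simp: indicator_def dist_norm norm_minus_commute)
  then show ?thesis
    by (rule Bochner_Integration.integrable_bound[OF i, rotated]) measurable
qed

lemma mollification_le:
  fixes w :: "'a::euclidean_space \<Rightarrow> real"
  assumes w: "integrable lborel w" and e: "0 < \<epsilon>" and le: "\<And>y. norm (y - x) < \<epsilon> \<Longrightarrow> w y \<le> b"
  shows "(LINT y|lborel. w y * radial_bump \<epsilon> (y - x)) \<le> b * (LINT z|lborel. radial_bump \<epsilon> (z::'a))"
proof -
  have [measurable]: "w \<in> borel_measurable borel"
    using borel_measurable_integrable[OF w] by simp
  have z: "integrable lborel (\<lambda>y. radial_bump \<epsilon> (y - x))" "(LINT y|lborel. radial_bump \<epsilon> (y - x)) = (LINT z|lborel. radial_bump \<epsilon> (z::'a))"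
    using integrable_lborel_translate[OF integrable_radial_bump[OF e], of "- x"] by simp_all
  have "(LINT y|lborel. w y * radial_bump \<epsilon> (y - x)) \<le> (LINT y|lborel. b * radial_bump \<epsilon> (y - x))"
  proof (rule integral_mono)
    show "integrable lborel (\<lambda>y. w y * radial_bump \<epsilon> (y - x))"
    proof (rule Bochner_Integration.integrable_bound[OF w])
      have "\<bar>w y * radial_bump \<epsilon> (y - x)\<bar> \<le> \<bar>w y\<bar>" for y
        unfolding abs_mult using radial_bump_le_1[of \<epsilon> "y - x"] by (intro mult_right_le_one_le) auto
      then show "AE y in lborel. norm (w y * radial_bump \<epsilon> (y - x)) \<le> norm (w y)" by simp
    qed measurable
    show "integrable lborel (\<lambda>y. b * radial_bump \<epsilon> (y - x))" using z by simp
    fix y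
    show "w y * radial_bump \<epsilon> (y - x) \<le> b * radial_bump \<epsilon> (y - x)"
      using le[of y] radial_bump_eq_0[OF e, of "y - x"] by (cases "norm (y - x) < \<epsilon>") (auto intro: mult_right_mono)
  qed
  then show ?thesis using z by simp
qed

text \<open>Inside the cone the distance to the sphere that touches \<open>x0\<close> is comparable to the distance to \<open>x0\<close>: by the law of cosines
\<open>r\<^sup>2 - (norm (x - x1))\<^sup>2 = d * (2 * r * p - d)\<close>, where \<open>d = norm (x - x0)\<close> and \<open>p\<close> is the cosine of the angle.\<close>

lemma cone_in_tangent_ball:
  fixes x x0 y0 :: "'a::euclidean_space"
  assumes cone: "x \<in> inner_cone \<Omega> x0 y0 \<beta>" and \<beta>: "0 < \<beta>" "\<beta> < pi / 2" and r: "0 < r"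
    and near: "norm (x - x0) \<le> r * cos \<beta>" and ne: "x \<noteq> x0" "y0 \<noteq> x0"
  defines "x1 \<equiv> x0 + r *\<^sub>R ((y0 - x0) /\<^sub>R norm (y0 - x0))"
  shows "norm (x - x0) * (r * cos \<beta>) \<le> r\<^sup>2 - (norm (x - x1))\<^sup>2"
proof -
  define d \<nu> \<mu> where "d = norm (x - x0)" and "\<nu> = (y0 - x0) /\<^sub>R norm (y0 - x0)" and "\<mu> = (x - x0) /\<^sub>R norm (x - x0)"
  have d: "0 < d" using ne by (simp add: d_def)
  have n1: "norm \<nu> = 1" "norm \<mu> = 1" using ne by (auto simp: \<nu>_def \<mu>_def)
  have "\<bar>\<mu> \<bullet> \<nu>\<bar> \<le> 1" using Cauchy_Schwarz_ineq2[of \<mu> \<nu>] n1 by simp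
  then have p: "- 1 \<le> \<mu> \<bullet> \<nu>" "\<mu> \<bullet> \<nu> \<le> 1" by auto
  have "arccos (\<mu> \<bullet> \<nu>) < \<beta>" using cone by (simp add: inner_cone_def \<mu>_def \<nu>_def)
  then have "cos \<beta> < cos (arccos (\<mu> \<bullet> \<nu>))"
    using arccos_lbound[OF p] \<beta> by (intro cos_monotone_0_pi) auto
  then have cp: "cos \<beta> \<le> \<mu> \<bullet> \<nu>" using p by (simp add: cos_arccos)
  have xd: "x - x0 = d *\<^sub>R \<mu>" using d by (simp add: \<mu>_def d_def)
  then have x1: "x - x1 = d *\<^sub>R \<mu> - r *\<^sub>R \<nu>" by (simp add: x1_def \<nu>_def algebra_simps)
  have "(norm (x - x1))\<^sup>2 = d\<^sup>2 * (norm \<mu>)\<^sup>2 - 2 * d * r * (\<mu> \<bullet> \<nu>) + r\<^sup>2 * (norm \<nu>)\<^sup>2"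
    unfolding x1 power2_norm_eq_inner by (simp add: inner_simps inner_commute power2_eq_square algebra_simps)
  then have "r\<^sup>2 - (norm (x - x1))\<^sup>2 = d * (2 * (r * (\<mu> \<bullet> \<nu>)) - d)"
    unfolding n1 by (simp add: power2_eq_square algebra_simps)
  moreover have "r * cos \<beta> \<le> r * (\<mu> \<bullet> \<nu>)" using cp r by (intro mult_left_mono) auto
  then have "d * (r * cos \<beta>) \<le> d * (2 * (r * (\<mu> \<bullet> \<nu>)) - d)"
    using d near by (intro mult_left_mono) (auto simp: d_def)
  ultimately show ?thesis by (simp add: d_def)
qed

theorem theorem3p3:
  fixes s :: real and \<Omega> :: "'a::euclidean_space set" and c u :: "'a \<Rightarrow> real"
    and x0 y0 :: 'a and R \<delta> :: real
  assumes "0 < s" and "s < 1"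
    and "open \<Omega>"
    and "c \<in> L_infinity \<Omega>"
    and "u \<in> Hs0 s \<Omega>" and "continuous_on UNIV u"
    and "weak_supersolution s \<Omega> c u"
    and "x0 \<in> frontier \<Omega>"
    and "0 < R" and "ball y0 R \<subseteq> \<Omega>" and "x0 \<in> frontier (ball y0 R)"
    and "0 < \<delta>" and "\<forall>x \<in> ball x0 \<delta>. 0 \<le> u x"
    and "0 < Liminf (at_right 0)
           (\<lambda>t. ereal ((cs_extension s u x0 t - cs_extension s u x0 0) / t powr (2 * s)))"
  shows "\<forall>\<beta>. 0 < \<beta> \<and> \<beta> < pi / 2 \<longrightarrow>
           0 < Liminf (at x0 within inner_cone \<Omega> x0 y0 \<beta>)
                 (\<lambda>x. ereal (u x / norm (x - x0) powr s))"
proof (intro allI impI, elim conjE)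
  fix \<beta> :: real assume \<beta>: "0 < \<beta>" "\<beta> < pi / 2"
  note s = assms(1,2) and op = assms(3) and cont = assms(6) and weak = assms(7)
  have um: "u \<in> borel_measurable borel"
    by (rule borel_measurable_continuous_onI[OF cont])
  have "x0 \<notin> \<Omega>" using assms(8) op by (simp add: frontier_def interior_open)
  then have u0: "u x0 = 0" using weak by (simp add: weak_supersolution_def)
  have R: "norm (y0 - x0) = R" using assms(9,11) by (simp add: dist_norm)
  then have y0: "y0 \<noteq> x0" using assms(9) by auto
  obtain \<rho> where \<rho>: "0 < \<rho>" "\<rho> < \<delta>"
    and g: "integrable lborel (\<lambda>y. indicator {y. \<rho> \<le> norm (y - x0)} y * u y * fractional_kernel s (y - x0))"
    and g0: "0 < (LINT y|lborel. indicator {y. \<rho> \<le> norm (y - x0)} y * u y * fractional_kernel s (y - x0))"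
    using far_mass_positive[OF s um u0 assms(12) _ assms(14)] assms(13) by blast
  define w where "w = (\<lambda>x. indicator (- {y. \<rho> \<le> norm (y - x0)}) x * u x)"
  have upos: "0 \<le> u x" if "norm (x - x0) < \<rho>" for x
    using assms(13) that \<rho> by (auto simp: dist_norm norm_minus_commute)
  then have w0: "0 \<le> w x" for x by (simp add: w_def indicator_def)
  have wi: "integrable lborel w" unfolding w_def by (rule integrable_truncation[OF cont])
  define v where "v \<epsilon> p = (LINT x|lborel. w x * radial_bump \<epsilon> (x - p))" for \<epsilon> p
  define Z where "Z \<epsilon> = (LINT z|lborel. radial_bump \<epsilon> (z::'a))" for \<epsilon>
  obtain \<eta> \<kappa> where \<eta>: "0 < \<eta>" and \<kappa>: "0 < \<kappa>"
    and vi: "\<And>a \<epsilon>. 0 < \<epsilon> \<Longrightarrow> cball a \<epsilon> \<subseteq> \<Omega> \<Longrightarrow> cball a \<epsilon> \<subseteq> ball x0 \<eta> \<Longrightarrow>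
       integrable lborel (\<lambda>h. second_difference (v \<epsilon>) a h * fractional_kernel s h)"
    and vs: "\<And>a \<epsilon>. 0 < \<epsilon> \<Longrightarrow> cball a \<epsilon> \<subseteq> \<Omega> \<Longrightarrow> cball a \<epsilon> \<subseteq> ball x0 \<eta> \<Longrightarrow>
       \<kappa> * Z \<epsilon> \<le> (LINT h|lborel. second_difference (v \<epsilon>) a h * fractional_kernel s h)"
  proof (rule supersolution_near_boundary[OF s op assms(4) cont weak u0 \<rho>(1) g g0 wi[unfolded w_def]])
    fix \<eta> \<kappa> :: real
    assume "0 < \<eta>" "0 < \<kappa>"
      "\<And>a \<epsilon>. 0 < \<epsilon> \<Longrightarrow> cball a \<epsilon> \<subseteq> \<Omega> \<Longrightarrow> cball a \<epsilon> \<subseteq> ball x0 \<eta> \<Longrightarrow>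
       integrable lborel (\<lambda>h. second_difference (\<lambda>p. LINT x|lborel. indicator (- {y. \<rho> \<le> norm (y - x0)}) x * u x * radial_bump \<epsilon> (x - p)) a h * fractional_kernel s h)"
      "\<And>a \<epsilon>. 0 < \<epsilon> \<Longrightarrow> cball a \<epsilon> \<subseteq> \<Omega> \<Longrightarrow> cball a \<epsilon> \<subseteq> ball x0 \<eta> \<Longrightarrow>
       \<kappa> * (LINT z|lborel. radial_bump \<epsilon> (z::'a)) \<le>
       (LINT h|lborel. second_difference (\<lambda>p. LINT x|lborel. indicator (- {y. \<rho> \<le> norm (y - x0)}) x * u x * radial_bump \<epsilon> (x - p)) a h * fractional_kernel s h)"
    then show thesis
      by (intro that[of \<eta> \<kappa>]) (simp_all only: v_def[abs_def] Z_def w_def)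
  qed
  obtain C where C: "0 \<le> C" "\<And>r (x::'a) F. norm x < r \<Longrightarrow> integrable lborel F \<Longrightarrow>
       (\<And>h. F h \<le> second_difference (ball_barrier s r) x h * fractional_kernel s h) \<Longrightarrow> integral\<^sup>L lborel F \<le> C"
    using fractional_laplacian_barrier_bounded[OF s] by blast
  \<comment> \<open>Any height of the barrier with \<open>m * C < \<kappa>\<close> works, independently of the mollification.\<close>
  define m where "m = \<kappa> / (C + 1)"
  have m: "0 < m" "m * C < \<kappa>" using C(1) \<kappa> by (auto simp: m_def field_simps)
  \<comment> \<open>The ball of radius \<open>r\<close> inside the given one that also touches \<open>x0\<close> stays within \<open>2 * r\<close> of \<open>x0\<close>.\<close>
  define r where "r = min R (min (\<eta> / 4) (\<rho> / 4))"
  have r: "0 < r" "r \<le> R" "2 * r < \<eta>" "2 * r < \<rho>" using assms(9) \<eta> \<rho> by (auto simp: r_def)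
  define x1 where "x1 = x0 + r *\<^sub>R ((y0 - x0) /\<^sub>R norm (y0 - x0))"
  have x1x0: "norm (x1 - x0) = r" using y0 r by (simp add: x1_def)
  have "x1 - y0 = (r * inverse R) *\<^sub>R (y0 - x0) - (y0 - x0)"
    unfolding x1_def R by simp
  also have "\<dots> = ((r - R) / R) *\<^sub>R (y0 - x0)"
  proof -
    have "(r - R) / R = r * inverse R - 1" using assms(9) by (simp add: field_simps)
    then show ?thesis by (simp only: scaleR_left_diff_distrib scaleR_one)
  qed
  finally have x1y0: "norm (x1 - y0) = R - r" using R r assms(9) by simp
  have ball_\<Omega>: "y \<in> \<Omega>" and ball_x0: "norm (y - x0) < 2 * r" if "norm (y - x1) < r" for y
  proof -
    have "norm (y - y0) < R" using norm_triangle_ineq[of "y - x1" "x1 - y0"] that x1y0 by simp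
    then show "y \<in> \<Omega>" using assms(10) by (auto simp: dist_norm norm_minus_commute)
    show "norm (y - x0) < 2 * r" using norm_triangle_ineq[of "y - x1" "x1 - x0"] that x1x0 by simp
  qed
  have below: "m * Z \<epsilon> * ball_barrier s (r - \<epsilon>) (x - x1) \<le> v \<epsilon> x" if e: "0 < \<epsilon>" "\<epsilon> < r" for \<epsilon> x
  proof (rule comparison_with_barrier[OF s C(2)])
    have Z: "0 < Z \<epsilon>" unfolding Z_def by (rule integral_radial_bump_pos[OF e(1)])
    show "0 \<le> v \<epsilon> x" for x using w0 by (simp add: v_def)
    show "continuous_on UNIV (v \<epsilon>)"
      unfolding v_def[abs_def] by (rule mollification_continuous[OF wi e(1)])
    show "0 < r - \<epsilon>" using e by simp
    show "0 < m * Z \<epsilon>" using m Z by simp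
    show "m * Z \<epsilon> * C < \<kappa> * Z \<epsilon>"
      using mult_strict_right_mono[OF m(2) Z] by (simp add: algebra_simps)
    fix a assume a: "norm (a - x1) < r - \<epsilon>"
    have near: "norm (y - x1) < r" if "y \<in> cball a \<epsilon>" for y
      using that a norm_triangle_ineq[of "y - a" "a - x1"] by (simp add: dist_norm norm_minus_commute)
    have sub: "cball a \<epsilon> \<subseteq> \<Omega>" "cball a \<epsilon> \<subseteq> ball x0 \<eta>"
    proof -
      show "cball a \<epsilon> \<subseteq> \<Omega>" using near ball_\<Omega> by blast
      have "norm (y - x0) < \<eta>" if "y \<in> cball a \<epsilon>" for y
        using ball_x0[OF near[OF that]] r by linarith
      then show "cball a \<epsilon> \<subseteq> ball x0 \<eta>"
        by (metis dist_commute dist_norm mem_ball subsetI)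
    qed
    show "integrable lborel (\<lambda>h. second_difference (v \<epsilon>) a h * fractional_kernel s h)"
      by (rule vi[OF e(1) sub])
    show "\<kappa> * Z \<epsilon> \<le> (LINT h|lborel. second_difference (v \<epsilon>) a h * fractional_kernel s h)"
      by (rule vs[OF e(1) sub])
  qed
  have lower: "m * ball_barrier s r (x - x1) \<le> u x" if x: "norm (x - x1) < r" for x
  proof (rule field_le_epsilon)
    fix \<tau> :: real assume \<tau>: "0 < \<tau>"
    have ux: "0 \<le> u x" using ball_x0[OF x] r by (intro upos) simp
    have "isCont u x" using cont by (simp add: continuous_on_eq_continuous_at)
    then obtain d where d: "0 < d" "\<And>y. dist y x < d \<Longrightarrow> dist (u y) (u x) < \<tau>"
      unfolding continuous_at_eps_delta using \<tau> by blast
    \<comment> \<open>The barrier lives on a ball smaller by \<open>\<epsilon>\<close>, so that the test functions stay inside \<open>\<Omega>\<close>; both limits are taken at once.\<close>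
    have "eventually (\<lambda>\<epsilon>. \<epsilon> < min d r) (at_right 0)"
      using d r by (intro eventually_at_rightI[of 0 "min d r"]) auto
    then have "eventually (\<lambda>\<epsilon>. m * ball_barrier s (r - \<epsilon>) (x - x1) \<le> u x + \<tau>) (at_right 0)"
      using eventually_at_right_less[of "0::real"]
    proof eventually_elim
      case (elim \<epsilon>)
      have Z: "0 < Z \<epsilon>" unfolding Z_def using elim by (intro integral_radial_bump_pos) simp
      have wle: "w y \<le> u x + \<tau>" if "norm (y - x) < \<epsilon>" for y
      proof -
        have "dist (u y) (u x) < \<tau>" using that elim by (intro d) (simp add: dist_norm)
        then show ?thesis using ux \<tau> by (auto simp: w_def indicator_def dist_real_def)
      qed
      have "m * Z \<epsilon> * ball_barrier s (r - \<epsilon>) (x - x1) \<le> v \<epsilon> x"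
        using elim by (intro below) auto
      also have "\<dots> \<le> (u x + \<tau>) * Z \<epsilon>"
        unfolding v_def Z_def using elim by (intro mollification_le[OF wi _ wle]) auto
      finally have "(m * ball_barrier s (r - \<epsilon>) (x - x1)) * Z \<epsilon> \<le> (u x + \<tau>) * Z \<epsilon>"
        by (simp add: algebra_simps)
      then show ?case using Z by simp
    qed
    moreover have "((\<lambda>\<epsilon>. m * ball_barrier s (r - \<epsilon>) (x - x1)) \<longlongrightarrow> m * ball_barrier s r (x - x1)) (at_right 0)"
    proof -
      have "(norm (x - x1))\<^sup>2 < r\<^sup>2" using x by (intro power_strict_mono) auto
      then have ne: "max 0 (r\<^sup>2 - (norm (x - x1))\<^sup>2) \<noteq> 0" by simp
      have "((\<lambda>\<epsilon>. max 0 ((r - \<epsilon>)\<^sup>2 - (norm (x - x1))\<^sup>2)) \<longlongrightarrow> max 0 ((r - 0)\<^sup>2 - (norm (x - x1))\<^sup>2)) (at_right 0)"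
        by (intro tendsto_intros)
      then have "((\<lambda>\<epsilon>. max 0 ((r - \<epsilon>)\<^sup>2 - (norm (x - x1))\<^sup>2)) \<longlongrightarrow> max 0 (r\<^sup>2 - (norm (x - x1))\<^sup>2)) (at_right 0)"
        by simp
      then show ?thesis
        unfolding ball_barrier_def by (intro tendsto_mult tendsto_const tendsto_powr ne)
    qed
    ultimately show "m * ball_barrier s r (x - x1) \<le> u x + \<tau>"
      by (intro tendsto_upperbound[of _ _ "at_right (0::real)"]) auto
  qed
  have cb: "0 < cos \<beta>" using \<beta> by (intro cos_gt_zero) auto
  have bound: "m * (r * cos \<beta>) powr s \<le> u x / norm (x - x0) powr s"
    if x: "x \<in> inner_cone \<Omega> x0 y0 \<beta>" "x \<noteq> x0" "norm (x - x0) < r * cos \<beta>" for x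
  proof -
    have d: "0 < norm (x - x0)" using x by simp
    have t: "norm (x - x0) * (r * cos \<beta>) \<le> r\<^sup>2 - (norm (x - x1))\<^sup>2"
      unfolding x1_def by (rule cone_in_tangent_ball[OF x(1) \<beta> r(1) less_imp_le[OF x(3)] x(2) y0])
    have pos: "0 < norm (x - x0) * (r * cos \<beta>)" using d r cb by simp
    have "(norm (x - x1))\<^sup>2 < r\<^sup>2" using t pos by linarith
    then have xr: "norm (x - x1) < r" by (rule power2_less_imp_less) (use r in simp)
    have "m * (norm (x - x0) * (r * cos \<beta>)) powr s \<le> m * ball_barrier s r (x - x1)"
      unfolding ball_barrier_def using t pos m s by (intro mult_left_mono powr_mono2) auto
    also have "\<dots> \<le> u x" by (rule lower[OF xr])
    finally have "m * (r * cos \<beta>) powr s * norm (x - x0) powr s \<le> u x"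
      by (simp add: powr_mult algebra_simps)
    then show ?thesis using d by (simp add: pos_le_divide_eq)
  qed
  have "eventually (\<lambda>x. ereal (m * (r * cos \<beta>) powr s) \<le> ereal (u x / norm (x - x0) powr s)) (at x0 within inner_cone \<Omega> x0 y0 \<beta>)"
    unfolding eventually_at using bound r cb
    by (intro exI[of _ "r * cos \<beta>"]) (auto simp: dist_norm)
  then have "ereal (m * (r * cos \<beta>) powr s) \<le> Liminf (at x0 within inner_cone \<Omega> x0 y0 \<beta>) (\<lambda>x. ereal (u x / norm (x - x0) powr s))"
    by (rule Liminf_bounded)
  moreover have "0 < ereal (m * (r * cos \<beta>) powr s)" using m r cb by simp
  ultimately show "0 < Liminf (at x0 within inner_cone \<Omega> x0 y0 \<beta>) (\<lambda>x. ereal (u x / norm (x - x0) powr s))"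
    by (rule less_le_trans[rotated])
qed

end
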